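(* Let $f:U\to\mathbb{H}$ be a slice-regular function with associated holomorphic map $F:\mathcal{U}\to\mathbb{C}^4$. Let $\Omega\subset\mathcal{U}$ be a bounded open set with piecewise $C^1$ (positively oriented) boundary $b\Omega$, with $\overline{\Omega}\subset\mathcal{U}$ and $\Phi\circ F$ nowhere zero on $b\Omega$. Counting with multiplicities, let - $k_0$ be the number of isolated non-real zeros $q=x+vy$ of $f$ with $z=x+\iota y\in\Omega$ and $\bar z\in\Omega$; - $m_0$ be the number of (non-real) spherical zeros $[q]=\{x+vy: v\in\mathbb{S}\}$ of $f$ with $z=x+\iota y\in\Omega$ and $\bar z\in\Omega$; - $k_1$ be the number of isolated non-real zeros $q=x+vy$ of $f$ with $z=x+\iota y\in\Omega$ and $\bar z\notin\Omega$ (for one of the two ways $x+vy=x+(-v)(-y)$ of writing $q$); - $m_1$ be the number of spherical zeros $[q]=\{x+vy: v\in\mathbb{S}\}$ of $f$ with $z=x+\iota y\in\Omega$ and $\bar z\notin\Omega$ (for one of the two choices of sign of $y$); - $r$ be the number of real zeros $x$ of $f$ with $x\in\Omega$. Then $$\frac{1}{2\pi\iota}\int_{b\Omega}\frac{(\Phi\circ F)'(z)}{(\Phi\circ F)(z)}\,dz=2k_0+k_1+2r+4m_0+2m_1.$$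
   Context: $\mathbb{H}$ is the algebra of quaternions with standard basis $1,i,j,k$, $\mathbb{S}=\{q\in\mathbb{H}: q^2=-1\}$, and $\iota$ is the imaginary unit of $\mathbb{C}$. $\mathcal{U}\subset\mathbb{C}\cong\mathbb{R}^2$ is an open domain (connected) invariant under complex conjugation, and $U=\{x+vy: x+\iota y\in\mathcal{U},\ v\in\mathbb{S}\}$. A (left) slice-regular function on $U$ is $f:U\to\mathbb{H}$ with $f(x+vy)=\alpha(x,y)+v\beta(x,y)$ for all $x+\iota y\in\mathcal{U}$, $v\in\mathbb{S}$, where $\alpha,\beta:\mathcal{U}\to\mathbb{H}$ are differentiable with $\alpha(x,-y)=\alpha(x,y)$, $\beta(x,-y)=-\beta(x,y)$, $\partial_x\alpha=\partial_y\beta$, $\partial_y\alpha=-\partial_x\beta$. Writing $\alpha=\alpha_0+\alpha_1i+\alpha_2j+\alpha_3k$ and $\beta=\beta_0+\beta_1i+\beta_2j+\beta_3k$ with real components, the associated holomorphic map is $F=(f_0,f_1,f_2,f_3):\mathcal{U}\to\mathbb{C}^4$, $f_m(x+\iota y)=\alpha_m(x,y)+\iota\beta_m(x,y)$. Put $\Phi(z)=z_0^2+z_1^2+z_2^2+z_3^2$ on $\mathbb{C}^4$. The $\star$-product of slice-regular functions $f=\alpha+v\beta$ and $g=\gamma+v\delta$ is the slice-regular function $(f\star g)(x+vy)=(\alpha\gamma-\beta\delta)(x,y)+v(\alpha\delta+\beta\gamma)(x,y)$. Zeros and multiplicities ($f\not\equiv0$). A real zero $x$ has multiplicity $n$ if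 $f(q)=(q-x)^n g(q)$ with $g$ slice-regular near $x$, $g(x)\ne 0$. For a non-real sphere $S=[x+vy]=\{x+wy: w\in\mathbb{S}\}$, $y\neq0$, one can write near $S$ $$f(q)=\big((q-x)^2+y^2\big)^{m}\,\tilde f(q),\qquad \tilde f=(q-p_1)\star\cdots\star(q-p_n)\star g,$$ with $m,n\ge 0$, $\tilde f$ slice-regular and not identically zero on $S$, $p_1,\dots,p_n\in S$, and $g$ slice-regular with no zero on $S$. If $m\geq1$, $S$ is a spherical zero of multiplicity $m$; if $n\ge1$, $S$ carries an isolated non-real zero (at $p_1$) of multiplicity $n$. If both occur, both are counted. Each zero (isolated point or sphere) is counted once with its multiplicity, not once for each of its two representations by $z$ and $\bar z$. *)

theory Defs
  imports "HOL-Complex_Analysis.Complex_Analysis"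
begin

section \<open>Quaternions\<close>

datatype quat = Quat (q0: real) (q1: real) (q2: real) (q3: real)

lemma quat_eq_iff: "p = q \<longleftrightarrow> q0 p = q0 q \<and> q1 p = q1 q \<and> q2 p = q2 q \<and> q3 p = q3 q"
  by (cases p; cases q) auto

instantiation quat :: real_algebra_1
begin

definition "0 = Quat 0 0 0 0"
definition "1 = Quat 1 0 0 0"
definition "p + q = Quat (q0 p + q0 q) (q1 p + q1 q) (q2 p + q2 q) (q3 p + q3 q)"
definition "- p = Quat (- q0 p) (- q1 p) (- q2 p) (- q3 p)"
definition "p - q = Quat (q0 p - q0 q) (q1 p - q1 q) (q2 p - q2 q) (q3 p - q3 q)"
definition "r *\<^sub>R p = Quat (r * q0 p) (r * q1 p) (r * q2 p) (r * q3 p)"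
definition "p * q = Quat
  (q0 p * q0 q - q1 p * q1 q - q2 p * q2 q - q3 p * q3 q)
  (q0 p * q1 q + q1 p * q0 q + q2 p * q3 q - q3 p * q2 q)
  (q0 p * q2 q - q1 p * q3 q + q2 p * q0 q + q3 p * q1 q)
  (q0 p * q3 q + q1 p * q2 q - q2 p * q1 q + q3 p * q0 q)"

lemmas quat_arith_defs =
  zero_quat_def one_quat_def plus_quat_def uminus_quat_def minus_quat_def
  scaleR_quat_def times_quat_def

instance
  by standard (simp_all add: quat_eq_iff quat_arith_defs algebra_simps)

end

instantiation quat :: real_normed_vector
begin

definition norm_quat_def:
  "norm p = sqrt ((q0 p)\<^sup>2 + (q1 p)\<^sup>2 + (q2 p)\<^sup>2 + (q3 p)\<^sup>2)"
definition sgn_quat_def: "sgn (p :: quat) = p /\<^sub>R norm p"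
definition dist_quat_def: "dist (p :: quat) q = norm (p - q)"
definition uniformity_quat_def [code del]:
  "(uniformity :: (quat \<times> quat) filter) = (INF e\<in>{0 <..}. principal {(x, y). dist x y < e})"
definition open_quat_def [code del]:
  "open (A :: quat set) \<longleftrightarrow> (\<forall>x\<in>A. eventually (\<lambda>(x', y). x' = x \<longrightarrow> y \<in> A) uniformity)"

lemma norm_quat_Pair: "norm (p :: quat) = norm ((q0 p, q1 p), (q2 p, q3 p))"
  by (simp add: norm_quat_def norm_Pair)

instance
proof
  fix r :: real and p q :: quat
  show "(norm p = 0) = (p = 0)"
    by (simp add: norm_quat_Pair quat_eq_iff zero_quat_def zero_prod_def)
  show "norm (p + q) \<le> norm p + norm q"
    using norm_triangle_ineq[of "((q0 p, q1 p), (q2 p, q3 p))" "((q0 q, q1 q), (q2 q, q3 q))"]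
    by (simp add: norm_quat_Pair plus_quat_def)
  show "norm (r *\<^sub>R p) = \<bar>r\<bar> * norm p"
    using norm_scaleR[of r "((q0 p, q1 p), (q2 p, q3 p))"]
    by (simp add: norm_quat_Pair scaleR_quat_def)
qed (rule sgn_quat_def dist_quat_def open_quat_def uniformity_quat_def)+

end

definition imag_units :: "quat set" where
  "imag_units = {v. v\<^sup>2 = -1}"


section \<open>Slice-regular functions\<close>

text \<open>The quaternion \<open>x + v y\<close> with \<open>z = x + \<i> y\<close>.\<close>

definition slice_point :: "complex \<Rightarrow> quat \<Rightarrow> quat" where
  "slice_point z v = of_real (Re z) + v * of_real (Im z)"

definition circularization :: "complex set \<Rightarrow> quat set" where
  "circularization V = {slice_point z v | z v. z \<in> V \<and> v \<in> imag_units}"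

text \<open>The set \<open>[x + v y]\<close> with \<open>z = x + \<i> y\<close>.\<close>

definition sphere_of :: "complex \<Rightarrow> quat set" where
  "sphere_of z = slice_point z ` imag_units"

text \<open>The values of \<open>f\<close> outside \<open>circularization V\<close> are irrelevant. In the Cauchy--Riemann
  equations, \<open>A\<close> and \<open>B\<close> are the real differentials of \<open>\<alpha>\<close> and \<open>\<beta>\<close> at \<open>z\<close>, so that evaluation at
  \<open>1\<close> and at \<open>\<i>\<close> gives the partial derivatives with respect to \<open>x\<close> and \<open>y\<close>.\<close>

definition slice_regular_with ::
    "complex set \<Rightarrow> (quat \<Rightarrow> quat) \<Rightarrow> (complex \<Rightarrow> quat) \<Rightarrow> (complex \<Rightarrow> quat) \<Rightarrow> bool" where
  "slice_regular_with V f \<alpha> \<beta> \<longleftrightarrow>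
     (\<forall>z\<in>V. \<forall>v\<in>imag_units. f (slice_point z v) = \<alpha> z + v * \<beta> z) \<and>
     (\<forall>z\<in>V. \<alpha> (cnj z) = \<alpha> z \<and> \<beta> (cnj z) = - \<beta> z) \<and>
     (\<forall>z\<in>V. \<exists>A B. (\<alpha> has_derivative A) (at z) \<and> (\<beta> has_derivative B) (at z) \<and>
                  A 1 = B \<i> \<and> A \<i> = - B 1)"

definition slice_regular :: "complex set \<Rightarrow> (quat \<Rightarrow> quat) \<Rightarrow> bool" where
  "slice_regular V f \<longleftrightarrow> (\<exists>\<alpha> \<beta>. slice_regular_with V f \<alpha> \<beta>)"

definition assoc_map ::
    "(complex \<Rightarrow> quat) \<Rightarrow> (complex \<Rightarrow> quat) \<Rightarrow> complex \<Rightarrow> complex \<times> complex \<times> complex \<times> complex" where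
  "assoc_map \<alpha> \<beta> z =
     (Complex (q0 (\<alpha> z)) (q0 (\<beta> z)), Complex (q1 (\<alpha> z)) (q1 (\<beta> z)),
      Complex (q2 (\<alpha> z)) (q2 (\<beta> z)), Complex (q3 (\<alpha> z)) (q3 (\<beta> z)))"

definition Phi :: "complex \<times> complex \<times> complex \<times> complex \<Rightarrow> complex" where
  "Phi = (\<lambda>(z0, z1, z2, z3). z0\<^sup>2 + z1\<^sup>2 + z2\<^sup>2 + z3\<^sup>2)"

text \<open>\<open>h\<close> is the \<open>\<star>\<close>-product of \<open>f\<close> and \<open>g\<close> on \<open>circularization V\<close>. This is a relation because the
  product is defined through \<open>\<alpha>\<close>, \<open>\<beta>\<close>, \<open>\<gamma>\<close>, \<open>\<delta>\<close>, which are determined on \<open>V\<close> by \<open>f\<close> and \<open>g\<close>.\<close>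

definition is_star_product ::
    "complex set \<Rightarrow> (quat \<Rightarrow> quat) \<Rightarrow> (quat \<Rightarrow> quat) \<Rightarrow> (quat \<Rightarrow> quat) \<Rightarrow> bool" where
  "is_star_product V f g h \<longleftrightarrow>
     (\<exists>\<alpha> \<beta> \<gamma> \<delta>. slice_regular_with V f \<alpha> \<beta> \<and> slice_regular_with V g \<gamma> \<delta> \<and>
        slice_regular_with V h (\<lambda>z. \<alpha> z * \<gamma> z - \<beta> z * \<delta> z) (\<lambda>z. \<alpha> z * \<delta> z + \<beta> z * \<gamma> z))"

text \<open>\<open>is_linear_star_product V [p\<^sub>1, \<dots>, p\<^sub>n] g h\<close> states that
  \<open>h = (q - p\<^sub>1) \<star> \<dots> \<star> (q - p\<^sub>n) \<star> g\<close> on \<open>circularization V\<close>.\<close>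

primrec is_linear_star_product ::
    "complex set \<Rightarrow> quat list \<Rightarrow> (quat \<Rightarrow> quat) \<Rightarrow> (quat \<Rightarrow> quat) \<Rightarrow> bool" where
  "is_linear_star_product V [] g h \<longleftrightarrow> (\<forall>q\<in>circularization V. h q = g q)"
| "is_linear_star_product V (p # ps) g h \<longleftrightarrow>
     (\<exists>k. is_linear_star_product V ps g k \<and> is_star_product V (\<lambda>q. q - p) k h)"


section \<open>Zeros and multiplicities\<close>

text \<open>A circular neighbourhood of the points \<open>slice_point z v\<close> inside the domain of \<open>f\<close> is given by
  an open conjugation-invariant \<open>V \<subseteq> \<U>\<close> containing \<open>z\<close>. For non-real \<open>z\<close> it need not be connected:
  small ones are a pair of conjugate neighbourhoods.\<close>

definition circular_nhd :: "complex set \<Rightarrow> complex \<Rightarrow> complex set \<Rightarrow> bool" where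
  "circular_nhd \<U> z V \<longleftrightarrow> open V \<and> cnj ` V = V \<and> V \<subseteq> \<U> \<and> z \<in> V"

definition is_real_multiplicity :: "complex set \<Rightarrow> (quat \<Rightarrow> quat) \<Rightarrow> real \<Rightarrow> nat \<Rightarrow> bool" where
  "is_real_multiplicity \<U> f x n \<longleftrightarrow>
     (\<exists>V g. circular_nhd \<U> (of_real x) V \<and> slice_regular V g \<and> g (of_real x) \<noteq> 0 \<and>
        (\<forall>q\<in>circularization V. f q = (q - of_real x) ^ n * g q))"

definition real_zeros :: "complex set \<Rightarrow> (quat \<Rightarrow> quat) \<Rightarrow> real set" where
  "real_zeros \<U> f = {x. of_real x \<in> \<U> \<and> f (of_real x) = 0}"

definition real_multiplicity :: "complex set \<Rightarrow> (quat \<Rightarrow> quat) \<Rightarrow> real \<Rightarrow> nat" where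
  "real_multiplicity \<U> f x = (THE n. is_real_multiplicity \<U> f x n)"

text \<open>The factorization of \<open>f\<close> near the non-real sphere \<open>sphere_of z\<close>; the number \<open>n\<close> of linear
  factors is \<open>length ps\<close>.\<close>

definition sphere_factorization ::
    "complex set \<Rightarrow> (quat \<Rightarrow> quat) \<Rightarrow> complex \<Rightarrow> nat \<Rightarrow> quat list \<Rightarrow> bool" where
  "sphere_factorization \<U> f z m ps \<longleftrightarrow> Im z \<noteq> 0 \<and>
     (\<exists>V f' g. circular_nhd \<U> z V \<and> slice_regular V f' \<and> slice_regular V g \<and>
        (\<forall>q\<in>circularization V.
            f q = ((q - of_real (Re z))\<^sup>2 + of_real ((Im z)\<^sup>2)) ^ m * f' q) \<and>
        (\<exists>q\<in>sphere_of z. f' q \<noteq> 0) \<and>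
        set ps \<subseteq> sphere_of z \<and>
        (\<forall>q\<in>sphere_of z. g q \<noteq> 0) \<and>
        is_linear_star_product V ps g f')"

definition is_spherical_multiplicity :: "complex set \<Rightarrow> (quat \<Rightarrow> quat) \<Rightarrow> quat set \<Rightarrow> nat \<Rightarrow> bool" where
  "is_spherical_multiplicity \<U> f S m \<longleftrightarrow>
     m \<ge> 1 \<and> (\<exists>z ps. S = sphere_of z \<and> sphere_factorization \<U> f z m ps)"

definition spherical_zeros :: "complex set \<Rightarrow> (quat \<Rightarrow> quat) \<Rightarrow> quat set set" where
  "spherical_zeros \<U> f = {S. \<exists>m. is_spherical_multiplicity \<U> f S m}"

definition spherical_multiplicity :: "complex set \<Rightarrow> (quat \<Rightarrow> quat) \<Rightarrow> quat set \<Rightarrow> nat" where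
  "spherical_multiplicity \<U> f S = (THE m. is_spherical_multiplicity \<U> f S m)"

text \<open>The isolated zero is located at the first linear factor \<open>p\<^sub>1\<close>, which is the only zero of \<open>f'\<close>
  on the sphere. It is counted also when \<open>m \<ge> 1\<close>, where \<open>f\<close> itself vanishes on the whole sphere.\<close>

definition is_isolated_multiplicity :: "complex set \<Rightarrow> (quat \<Rightarrow> quat) \<Rightarrow> quat \<Rightarrow> nat \<Rightarrow> bool" where
  "is_isolated_multiplicity \<U> f p n \<longleftrightarrow>
     n \<ge> 1 \<and> (\<exists>z m ps. sphere_factorization \<U> f z m ps \<and> length ps = n \<and> hd ps = p)"

definition isolated_zeros :: "complex set \<Rightarrow> (quat \<Rightarrow> quat) \<Rightarrow> quat set" where
  "isolated_zeros \<U> f = {p. \<exists>n. is_isolated_multiplicity \<U> f p n}"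

definition isolated_multiplicity :: "complex set \<Rightarrow> (quat \<Rightarrow> quat) \<Rightarrow> quat \<Rightarrow> nat" where
  "isolated_multiplicity \<U> f p = (THE n. is_isolated_multiplicity \<U> f p n)"


section \<open>Piecewise \<open>C\<^sup>1\<close> positively oriented boundary\<close>

text \<open>The boundary of \<open>\<Omega>\<close> is parametrized by a finite set \<open>\<Gamma>\<close> of simple closed curves that meet each
  other in at most finitely many points (in particular, they may be disjoint). Away from a finite
  set \<open>K\<close> of parameters each curve is \<open>C\<^sup>1\<close> with non-zero velocity and has \<open>\<Omega>\<close> on its left and the
  exterior of \<open>\<Omega>\<close> on its right; \<open>\<i> * d\<close> is the left normal for the velocity \<open>d\<close>.\<close>

definition oriented_C1_boundary :: "complex set \<Rightarrow> (real \<Rightarrow> complex) set \<Rightarrow> bool" where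
  "oriented_C1_boundary \<Omega> \<Gamma> \<longleftrightarrow>
     finite \<Gamma> \<and>
     frontier \<Omega> = (\<Union>\<gamma>\<in>\<Gamma>. path_image \<gamma>) \<and>
     pairwise (\<lambda>\<gamma> \<eta>. finite (path_image \<gamma> \<inter> path_image \<eta>)) \<Gamma> \<and>
     (\<forall>\<gamma>\<in>\<Gamma>. simple_path \<gamma> \<and> pathfinish \<gamma> = pathstart \<gamma> \<and>
        (\<exists>K. finite K \<and> \<gamma> C1_differentiable_on ({0..1} - K) \<and>
           (\<forall>t\<in>{0..1} - K. let d = vector_derivative \<gamma> (at t) in
              d \<noteq> 0 \<and>
              (\<forall>\<^sub>F s in at_right 0.
                 \<gamma> t + of_real s * (\<i> * d) \<in> \<Omega> \<and> \<gamma> t - of_real s * (\<i> * d) \<notin> closure \<Omega>))))"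

end

theory Submission
  imports Defs
begin

text \<open>Write \<open>f (x + v y) = \<alpha> + v \<beta>\<close>. The map \<open>F = \<alpha> + \<i> \<beta>\<close> takes values in the complexified
  quaternions, the Cauchy--Riemann equations say that it is holomorphic, the \<open>\<star>\<close>-product of slice
  functions is the pointwise product of these maps, and \<open>Phi\<close> is the multiplicative norm form of the
  algebra. Hence \<open>h = Phi \<circ> F\<close> is a holomorphic function, and by the argument principle the integral
  counts the zeros of \<open>h\<close> in \<open>\<Omega>\<close> with their orders. The theorem then compares orders of zeros
  of \<open>h\<close> with multiplicities of zeros of \<open>f\<close>.

  Let \<open>z\<close> be non-real and \<open>P w = (w - z) (w - cnj z)\<close>. The factor \<open>((q - x)\<^sup>2 + y\<^sup>2) ^ m\<close> of \<open>f\<close> multiplies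
  \<open>F\<close> by the scalar \<open>P ^ m\<close>, hence \<open>h\<close> by \<open>P ^ (2 m)\<close>; a factor \<open>q - p\<close> with \<open>p\<close> on the sphere of \<open>z\<close>
  multiplies \<open>h\<close> by its own norm, which is \<open>P\<close>; and a slice function without zeros on the sphere has
  non-zero norm at \<open>z\<close>. So \<open>h\<close> has order \<open>2 m + n\<close> at \<open>z\<close>, and the same order at \<open>cnj z\<close>. At a
  real zero of multiplicity \<open>n\<close> the order is \<open>2 n\<close>, because there the value of the cofactor lies in the
  quaternions themselves, where \<open>Phi\<close> is the squared norm. Adding up, a sphere with both representatives in \<open>\<Omega>\<close> contributes \<open>4 m + 2 n\<close>, one with a
  single representative in \<open>\<Omega>\<close> contributes \<open>2 m + n\<close>, and a real point \<open>2 n\<close>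
  (lemma \<open>sum_zorder_eq_multiplicities\<close>).

  The factorization exists by repeated division: as long as \<open>F z = 0\<close> one can divide by \<open>P\<close>; after
  that, as long as \<open>h z = 0\<close>, the function vanishes at exactly one point \<open>p\<close> of the sphere and
  \<open>q - p\<close> splits off. Both steps lower the order of \<open>h\<close>. It is unique enough: \<open>m\<close> is the order of
  vanishing of \<open>F\<close>, then \<open>n\<close> follows from the order of \<open>h\<close>, and the first linear factor is the zero
  on the sphere of what remains after dividing by \<open>P ^ m\<close>.

  The argument principle needs that the boundary curves wind around every point of \<open>\<Omega>\<close> once in total
  and around no point off its closure, whereas the orientation hypothesis is local. This is theorem
  \<open>winding_number_oriented_C1_boundary\<close>: the difference between the total winding number and
  the indicator function of \<open>\<Omega>\<close> does not jump across smooth boundary arcs, because both functions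
  increase by one from the right to the left; so it extends to a locally constant function
  off a finite set, and it vanishes far away.\<close>

section \<open>Jump of the winding number across a smooth arc\<close>

text \<open>A path that misses a half-line starting at \<open>z\<close> carries a branch of the logarithm of \<open>w - z\<close>;
  the factor \<open>c\<close> turns the half-line into the negative real axis.\<close>

lemma winding_number_slit_plane:
  assumes "valid_path g" and "c \<noteq> 0"
    and "\<And>w. w \<in> path_image g \<Longrightarrow> c * (w - z) \<notin> \<real>\<^sub>\<le>\<^sub>0"
  shows "winding_number g z =
           (Ln (c * (pathfinish g - z)) - Ln (c * (pathstart g - z))) / (2 * of_real pi * \<i>)"
proof -
  have "((\<lambda>w. Ln (c * (w - z))) has_field_derivative 1 / (w - z)) (at w within path_image g)"
    if "w \<in> path_image g" for w
  proof -
    have "w \<noteq> z" using assms(3)[OF that] by auto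
    then show ?thesis
      using assms(2) assms(3)[OF that] by (auto intro!: derivative_eq_intros simp: field_simps)
  qed
  then have "((\<lambda>w. 1 / (w - z)) has_contour_integral
               (Ln (c * (pathfinish g - z)) - Ln (c * (pathstart g - z)))) g"
    using contour_integral_primitive[of "path_image g" "\<lambda>w. Ln (c * (w - z))" "\<lambda>w. 1 / (w - z)" g]
      assms(1) by auto
  moreover have "z \<notin> path_image g" using assms(3)[of z] by auto
  ultimately show ?thesis
    using assms(1) by (simp add: winding_number_valid_path contour_integral_unique)
qed

text \<open>The parts of the curve away from \<open>\<gamma> t\<close> have winding numbers that are continuous at \<open>\<gamma> t\<close>. On the
  remaining short arc both winding numbers are differences of logarithms, but for branches cut along
  opposite half-normals; at each end of the arc these branches differ by \<open>\<plusminus> \<i> \<pi>\<close> with opposite signs,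
  which adds up to \<open>2 \<pi> \<i>\<close>.\<close>

lemma winding_number_jump:
  fixes t :: real
  assumes \<gamma>: "valid_path \<gamma>" and t: "t \<in> {0<..<1}"
    and inj: "\<forall>s\<in>{0..1}. \<gamma> s = \<gamma> t \<longrightarrow> s = t"
    and der: "(\<gamma> has_vector_derivative d) (at t)" and d: "d \<noteq> 0"
  shows "((\<lambda>s. winding_number \<gamma> (\<gamma> t + of_real s * (\<i> * d)) -
               winding_number \<gamma> (\<gamma> t - of_real s * (\<i> * d))) \<longlongrightarrow> 1) (at_right 0)"
    and "\<forall>\<^sub>F s in at_right 0. \<gamma> t + of_real s * (\<i> * d) \<notin> path_image \<gamma> \<and>
                             \<gamma> t - of_real s * (\<i> * d) \<notin> path_image \<gamma>"
proof -
  define u where "u = (\<lambda>s. (\<gamma> s - \<gamma> t) / d)"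
  obtain e where e: "e > 0"
    and cone: "\<And>s. \<bar>s - t\<bar> < e \<Longrightarrow> norm (\<gamma> s - \<gamma> t - (s - t) *\<^sub>R d) \<le> norm d / 2 * \<bar>s - t\<bar>"
    using der d unfolding has_vector_derivative_def has_derivative_at_alt
    by (metis half_gt_zero_iff real_norm_def zero_less_norm_iff)
  have cone': "norm (u s - of_real (s - t)) \<le> \<bar>s - t\<bar> / 2" if "\<bar>s - t\<bar> < e" for s
  proof -
    have "u s - of_real (s - t) = (\<gamma> s - \<gamma> t - (s - t) *\<^sub>R d) / d"
      using d by (simp add: u_def field_simps scaleR_conv_of_real)
    then have "norm (u s - of_real (s - t)) = norm (\<gamma> s - \<gamma> t - (s - t) *\<^sub>R d) / norm d"
      by (simp add: norm_divide)
    then show ?thesis using cone[OF that] d by (simp add: pos_divide_le_eq mult.commute)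
  qed
  have ReU: "\<bar>Re (u s) - (s - t)\<bar> \<le> \<bar>s - t\<bar> / 2" if "\<bar>s - t\<bar> < e" for s
    using cone'[OF that] abs_Re_le_cmod[of "u s - of_real (s - t)"] by simp
  define h where "h = min (e / 2) (min t (1 - t))"
  define a b where "a = t - h" and "b = t + h"
  have h: "0 < h" "h < e" "h \<le> t" "h \<le> 1 - t"
    using e t by (auto simp: h_def min_less_iff_disj)
  have ab: "a \<in> {0..1}" "b \<in> {0..1}" "a < t" "t < b" "a < b"
    using h by (auto simp: a_def b_def)
  have abt: "\<bar>a - t\<bar> < e" "\<bar>b - t\<bar> < e" using h by (simp_all add: a_def b_def)
  have Rea: "Re (u a) < 0"
  proof -
    have "\<bar>Re (u a) - (a - t)\<bar> \<le> (t - a) / 2" using ReU[OF abt(1)] ab by simp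
    then have "Re (u a) - (a - t) \<le> (t - a) / 2" by (rule order_trans[OF abs_ge_self])
    then show ?thesis using ab by (simp add: field_simps)
  qed
  have Reb: "Re (u b) > 0"
  proof -
    have "\<bar>Re (u b) - (b - t)\<bar> \<le> (b - t) / 2" using ReU[OF abt(2)] ab by simp
    then have "- (Re (u b) - (b - t)) \<le> (b - t) / 2" by (rule order_trans[OF abs_ge_minus_self])
    then show ?thesis using ab by (simp add: field_simps)
  qed
  have pth: "path \<gamma>" using \<gamma> by (rule valid_path_imp_path)
  define lo where "lo = subpath 0 a \<gamma>"
  define mi where "mi = subpath a b \<gamma>"
  define hi where "hi = subpath b 1 \<gamma>"
  have vp: "valid_path mi" using \<gamma> ab by (simp add: mi_def valid_path_subpath)
  have pl: "path lo" "path hi" using pth ab by (auto simp: lo_def hi_def)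
  have ilo: "path_image lo = \<gamma> ` {0..a}" and imi: "path_image mi = \<gamma> ` {a..b}"
    and ihi: "path_image hi = \<gamma> ` {b..1}"
    using ab by (auto simp: lo_def mi_def hi_def path_image_subpath)
  have notlo: "\<gamma> t \<notin> path_image lo" and nothi: "\<gamma> t \<notin> path_image hi"
    using inj ab t by (force simp: ilo ihi)+
  have img: "path_image \<gamma> = path_image lo \<union> path_image mi \<union> path_image hi"
  proof -
    have "{0..1} = {0..a} \<union> {a..b} \<union> {b..1::real}" using ab by auto
    then have "\<gamma> ` {0..1} = \<gamma> ` {0..a} \<union> \<gamma> ` {a..b} \<union> \<gamma> ` {b..1}" by (simp only: image_Un)
    then show ?thesis unfolding ilo imi ihi by (simp add: path_image_def)
  qed
  define P where "P = (\<lambda>s. \<gamma> t + of_real s * (\<i> * d))"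
  define Q where "Q = (\<lambda>s. \<gamma> t - of_real s * (\<i> * d))"
  have PQ: "(P \<longlongrightarrow> \<gamma> t) (at_right 0)" "(Q \<longlongrightarrow> \<gamma> t) (at_right 0)"
    unfolding P_def Q_def by (auto intro!: tendsto_eq_intros)
  have closed: "closed (path_image lo)" "closed (path_image hi)"
    using pl by (auto intro: closed_path_image)
  have ev_out: "\<forall>\<^sub>F s in at_right 0. g s \<notin> path_image lo \<and> g s \<notin> path_image hi"
    if "(g \<longlongrightarrow> \<gamma> t) (at_right (0::real))" for g
    using topological_tendstoD[OF that, of "- path_image lo"]
      topological_tendstoD[OF that, of "- path_image hi"] closed notlo nothi
    by (auto simp: open_Compl elim: eventually_elim2)
  have usmall: "u s = 0 \<and> s = t" if "\<bar>s - t\<bar> < e" "Re (u s) = 0" for s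
  proof -
    have "\<bar>s - t\<bar> \<le> \<bar>s - t\<bar> / 2"
      using ReU[OF that(1)] unfolding that(2) by (simp add: abs_minus_commute)
    then have "s = t" by simp
    then show ?thesis by (simp add: u_def)
  qed
  \<comment> \<open>The arc lies in a double cone around the tangent, so it avoids the slit that starts at a
    point of the normal and points away from the curve.\<close>
  have slitP: "(\<i> / d) * (w - P s) \<notin> \<real>\<^sub>\<le>\<^sub>0" and slitQ: "(- \<i> / d) * (w - Q s) \<notin> \<real>\<^sub>\<le>\<^sub>0"
    if ws: "w \<in> path_image mi" "s > 0" for w s
  proof -
    obtain x where x: "x \<in> {a..b}" "w = \<gamma> x" using ws by (auto simp: imi)
    have xt: "\<bar>x - t\<bar> < e" using x(1) h(2) unfolding a_def b_def by (simp add: abs_less_iff)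
    have 1: "(\<i> / d) * (w - P s) = \<i> * u x + of_real s"
      and 2: "(- \<i> / d) * (w - Q s) = - \<i> * u x + of_real s"
      using d by (auto simp: P_def Q_def u_def x field_simps)
    show "(\<i> / d) * (w - P s) \<notin> \<real>\<^sub>\<le>\<^sub>0"
      unfolding 1 complex_nonpos_Reals_iff using usmall[OF xt] ws by auto
    show "(- \<i> / d) * (w - Q s) \<notin> \<real>\<^sub>\<le>\<^sub>0"
      unfolding 2 complex_nonpos_Reals_iff using usmall[OF xt] ws by auto
  qed
  have notmi: "P s \<notin> path_image mi" "Q s \<notin> path_image mi" if "s > 0" for s
    using slitP[of "P s" s] slitQ[of "Q s" s] that by auto
  show ev: "\<forall>\<^sub>F s in at_right 0. P s \<notin> path_image \<gamma> \<and> Q s \<notin> path_image \<gamma>"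
    using ev_out[OF PQ(1)] ev_out[OF PQ(2)] eventually_at_right_less[of "0::real"]
    by eventually_elim (use notmi in \<open>auto simp: img\<close>)
  have split: "winding_number \<gamma> z = winding_number lo z + winding_number mi z + winding_number hi z"
    if "z \<notin> path_image \<gamma>" for z
  proof -
    have "winding_number lo z + winding_number mi z = winding_number (subpath 0 b \<gamma>) z"
      unfolding lo_def mi_def using ab that pth by (intro winding_number_subpath_combine) auto
    moreover have "winding_number (subpath 0 b \<gamma>) z + winding_number hi z = winding_number (subpath 0 1 \<gamma>) z"
      unfolding hi_def using ab that pth by (intro winding_number_subpath_combine) auto
    ultimately show ?thesis by simp
  qed
  define c where "c = 2 * of_real pi * \<i>"
  define G where "G = (\<lambda>s. ((winding_number lo (P s) - winding_number lo (Q s))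
                   + (winding_number hi (P s) - winding_number hi (Q s)))
    + ((Ln (\<i> * u b + of_real s) - Ln (\<i> * u a + of_real s))
       - (Ln (- \<i> * u b + of_real s) - Ln (- \<i> * u a + of_real s))) / c)"
  have "\<forall>\<^sub>F s in at_right 0. winding_number \<gamma> (P s) - winding_number \<gamma> (Q s) = G s"
    using ev eventually_at_right_less[of "0::real"]
  proof eventually_elim
    case (elim s)
    have ends: "pathstart mi = \<gamma> a" "pathfinish mi = \<gamma> b" by (auto simp: mi_def)
    have "winding_number mi (P s) = (Ln (\<i> * u b + of_real s) - Ln (\<i> * u a + of_real s)) / c"
    proof -
      have "(\<i> / d) * (\<gamma> x - P s) = \<i> * u x + of_real s" for x
        using d by (auto simp: P_def u_def field_simps)
      then show ?thesis
        using winding_number_slit_plane[OF vp, of "\<i> / d" "P s"] slitP d elim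
        by (simp add: ends c_def)
    qed
    moreover have "winding_number mi (Q s) = (Ln (- \<i> * u b + of_real s) - Ln (- \<i> * u a + of_real s)) / c"
    proof -
      have "(- \<i> / d) * (\<gamma> x - Q s) = - \<i> * u x + of_real s" for x
        using d by (auto simp: Q_def u_def field_simps)
      then show ?thesis
        using winding_number_slit_plane[OF vp, of "- \<i> / d" "Q s"] slitQ d elim
        by (simp add: ends c_def)
    qed
    ultimately show ?case using elim by (simp add: split G_def diff_divide_distrib)
  qed
  moreover have "(G \<longlongrightarrow> 1) (at_right 0)"
  proof -
    have wn: "((\<lambda>s. winding_number g (P s) - winding_number g (Q s)) \<longlongrightarrow> 0) (at_right 0)"
      if "path g" "\<gamma> t \<notin> path_image g" for g
    proof -
      have "isCont (winding_number g) (\<gamma> t)"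
        using continuous_at_winding_number[OF that] .
      from isCont_tendsto_compose[OF this PQ(1)] isCont_tendsto_compose[OF this PQ(2)]
      show ?thesis by (auto intro!: tendsto_eq_intros)
    qed
    have nr: "\<i> * u b \<notin> \<real>\<^sub>\<le>\<^sub>0" "\<i> * u a \<notin> \<real>\<^sub>\<le>\<^sub>0" "- \<i> * u b \<notin> \<real>\<^sub>\<le>\<^sub>0" "- \<i> * u a \<notin> \<real>\<^sub>\<le>\<^sub>0"
      using Rea Reb by (auto simp: complex_nonpos_Reals_iff)
    have Ln_lim: "((\<lambda>s. Ln (w + of_real s)) \<longlongrightarrow> Ln w) (at_right 0)" if "w \<notin> \<real>\<^sub>\<le>\<^sub>0" for w
      by (rule tendsto_Ln) (use that in \<open>auto intro!: tendsto_eq_intros\<close>)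
    have "Ln (- (\<i> * u b)) = Ln (\<i> * u b) - \<i> * of_real pi"
      using Reb by (subst Ln_minus) auto
    moreover have "Ln (- (\<i> * u a)) = Ln (\<i> * u a) + \<i> * of_real pi"
      using Rea by (subst Ln_minus) auto
    ultimately have val: "((Ln (\<i> * u b) - Ln (\<i> * u a)) - (Ln (- \<i> * u b) - Ln (- \<i> * u a))) / c = 1"
      by (simp add: c_def)
    have "(G \<longlongrightarrow> (0 + 0) + ((Ln (\<i> * u b) - Ln (\<i> * u a)) - (Ln (- \<i> * u b) - Ln (- \<i> * u a))) / c) (at_right 0)"
      unfolding G_def
      by (intro tendsto_add tendsto_divide tendsto_diff wn Ln_lim nr pl notlo nothi tendsto_const)
        (simp add: c_def)
    then show ?thesis unfolding val by simp
  qed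
  ultimately show "((\<lambda>s. winding_number \<gamma> (P s) - winding_number \<gamma> (Q s)) \<longlongrightarrow> 1) (at_right 0)"
    by (simp add: tendsto_cong)
qed

text \<open>Winding numbers are integers, so the jump equals its limit as soon as it is close to it.\<close>

lemma winding_number_jump_eq:
  fixes t :: real
  assumes \<gamma>: "valid_path \<gamma>" and loop: "pathfinish \<gamma> = pathstart \<gamma>" and t: "t \<in> {0<..<1}"
    and inj: "\<forall>s\<in>{0..1}. \<gamma> s = \<gamma> t \<longrightarrow> s = t"
    and der: "(\<gamma> has_vector_derivative d) (at t)" and d: "d \<noteq> 0"
  shows "\<forall>\<^sub>F s in at_right 0.
           \<gamma> t + of_real s * (\<i> * d) \<notin> path_image \<gamma> \<and> \<gamma> t - of_real s * (\<i> * d) \<notin> path_image \<gamma> \<and>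
           winding_number \<gamma> (\<gamma> t + of_real s * (\<i> * d)) =
             winding_number \<gamma> (\<gamma> t - of_real s * (\<i> * d)) + 1"
proof -
  note J = winding_number_jump[OF \<gamma> t inj der d]
  have "\<forall>\<^sub>F s in at_right 0. dist (winding_number \<gamma> (\<gamma> t + of_real s * (\<i> * d)) -
               winding_number \<gamma> (\<gamma> t - of_real s * (\<i> * d))) 1 < 1"
    using tendstoD[OF J(1), of 1] by simp
  with J(2) show ?thesis
  proof eventually_elim
    case (elim s)
    have "winding_number \<gamma> (\<gamma> t + of_real s * (\<i> * d)) \<in> \<int>"
         "winding_number \<gamma> (\<gamma> t - of_real s * (\<i> * d)) \<in> \<int>"
      using elim \<gamma> loop by (auto intro!: integer_winding_number simp: valid_path_imp_path)
    then obtain m n where mn: "winding_number \<gamma> (\<gamma> t + of_real s * (\<i> * d)) = of_int m"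
         "winding_number \<gamma> (\<gamma> t - of_real s * (\<i> * d)) = of_int n"
      by (auto elim!: Ints_cases)
    have "norm (of_int (m - n - 1) :: complex) < 1"
      using elim by (simp add: mn dist_norm)
    then have "\<bar>m - n - 1\<bar> < 1"
      unfolding norm_of_int by linarith
    then have "m = n + 1" by linarith
    then show ?case using elim mn by simp
  qed
qed

section \<open>Winding numbers of an oriented boundary\<close>

text \<open>By the Jordan curve theorem; \<open>c\<close> is the orientation of the loop.\<close>

lemma simple_loop_winding_numbers:
  assumes "simple_path \<gamma>" and "pathfinish \<gamma> = pathstart \<gamma>"
  obtains c :: complex where "\<forall>z. z \<notin> path_image \<gamma> \<longrightarrow> winding_number \<gamma> z \<in> {0, c}"
    and "c = 1 \<or> c = -1"
proof -
  have out: "winding_number \<gamma> z = 0" if "z \<notin> path_image \<gamma>" "z \<notin> inside (path_image \<gamma>)" for z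
  proof (rule winding_number_zero_in_outside)
    show "z \<in> outside (path_image \<gamma>)"
      using that inside_Un_outside[of "path_image \<gamma>"] by blast
  qed (use assms in \<open>auto simp: simple_path_imp_path\<close>)
  show thesis
  proof (rule simple_closed_path_winding_number_inside[OF assms(1)])
    assume "\<And>z. z \<in> inside (path_image \<gamma>) \<Longrightarrow> winding_number \<gamma> z = 1"
    with out show thesis by (intro that[of 1]) auto
  next
    assume "\<And>z. z \<in> inside (path_image \<gamma>) \<Longrightarrow> winding_number \<gamma> z = - 1"
    with out show thesis by (intro that[of "-1"]) auto
  qed
qed

lemma mem_iff_if_connected_off_frontier:
  assumes "connected T" "T \<inter> frontier S = {}" "x \<in> T" "y \<in> T"
  shows "x \<in> S \<longleftrightarrow> y \<in> S"
  using connected_Int_frontier[of T S] assms by blast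

text \<open>The first-order condition at a minimum of the distance. It replaces a local description of the
  curve as a graph: every point near the curve lies on the normal at its nearest point.\<close>

lemma nearest_point_on_curve_normal:
  fixes \<gamma> :: "real \<Rightarrow> complex"
  assumes der: "(\<gamma> has_vector_derivative d) (at t)" and d: "d \<noteq> 0" and t: "t \<in> {0<..<1}"
    and near: "\<And>s. s \<in> {0..1} \<Longrightarrow> dist z (\<gamma> t) \<le> dist z (\<gamma> s)"
  obtains k :: real where "z = \<gamma> t + of_real k * (\<i> * d)"
proof -
  have "((\<lambda>s. \<gamma> s - z) has_derivative (\<lambda>h. h *\<^sub>R d)) (at t)"
    using der unfolding has_vector_derivative_def by (auto intro!: derivative_eq_intros)
  from has_derivative_inner[OF this this]
  have "((\<lambda>s. (\<gamma> s - z) \<bullet> (\<gamma> s - z)) has_real_derivative 2 * ((\<gamma> t - z) \<bullet> d)) (at t)"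
    unfolding has_field_derivative_def by (rule has_derivative_eq_rhs) (simp add: inner_commute fun_eq_iff)
  moreover have "(\<gamma> t - z) \<bullet> (\<gamma> t - z) \<le> (\<gamma> s - z) \<bullet> (\<gamma> s - z)" if "\<bar>t - s\<bar> < min t (1 - t)" for s
  proof -
    have "s \<in> {0..1}" using that by (auto simp: abs_less_iff)
    from near[OF this] show ?thesis
      by (simp add: dist_norm norm_minus_commute dot_square_norm)
  qed
  ultimately have "2 * ((\<gamma> t - z) \<bullet> d) = 0"
    using t by (intro DERIV_local_min[of _ _ t "min t (1 - t)"]) auto
  then have orth: "Re (z - \<gamma> t) * Re d + Im (z - \<gamma> t) * Im d = 0"
    by (simp add: inner_complex_def algebra_simps)
  define k where "k = (Im (z - \<gamma> t) * Re d - Re (z - \<gamma> t) * Im d) / (norm d)\<^sup>2"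
  have n: "(norm d)\<^sup>2 = Re d * Re d + Im d * Im d" by (simp add: cmod_def power2_eq_square)
  have n0: "(norm d)\<^sup>2 \<noteq> 0" using d by simp
  have "z - \<gamma> t = of_real k * (\<i> * d)"
  proof (rule complex_eqI)
    have "Re (z - \<gamma> t) * (norm d)\<^sup>2 = - (Im (z - \<gamma> t) * Re d - Re (z - \<gamma> t) * Im d) * Im d"
      unfolding n using orth by algebra
    then show "Re (z - \<gamma> t) = Re (of_real k * (\<i> * d))"
      using n0 by (simp add: k_def field_simps)
    have "Im (z - \<gamma> t) * (norm d)\<^sup>2 = (Im (z - \<gamma> t) * Re d - Re (z - \<gamma> t) * Im d) * Re d"
      unfolding n using orth by algebra
    then show "Im (z - \<gamma> t) = Im (of_real k * (\<i> * d))"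
      using n0 by (simp add: k_def field_simps)
  qed
  then show thesis using that[of k] by (simp add: algebra_simps)
qed

lemma oriented_C1_boundary_valid_path:
  assumes "oriented_C1_boundary \<Omega> \<Gamma>" and "\<gamma> \<in> \<Gamma>"
  shows "valid_path \<gamma>"
proof -
  have "path \<gamma>" using assms by (auto simp: oriented_C1_boundary_def simple_path_imp_path)
  then show ?thesis
    using assms unfolding oriented_C1_boundary_def valid_path_def piecewise_C1_differentiable_on_def path_def
    by blast
qed

text \<open>\<open>B\<close> collects the corners, the end points of the parametrizations and the points shared by different
  curves. Any other boundary point lies in the smooth part of one curve only.\<close>

lemma oriented_C1_boundary_good_points:
  assumes \<Gamma>: "oriented_C1_boundary \<Omega> \<Gamma>"
  obtains B where "finite B" and "B \<subseteq> frontier \<Omega>"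
    and "\<forall>\<gamma>\<in>\<Gamma>. \<forall>\<eta>\<in>\<Gamma>. \<gamma> \<noteq> \<eta> \<longrightarrow> path_image \<gamma> \<inter> path_image \<eta> \<subseteq> B"
    and "\<forall>\<gamma>\<in>\<Gamma>. \<forall>q\<in>path_image \<gamma> - B.
           \<exists>t d. t \<in> {0<..<1} \<and> \<gamma> t = q \<and> (\<gamma> has_vector_derivative d) (at t) \<and> d \<noteq> 0 \<and>
                 (\<forall>\<^sub>F s in at_right 0. q + of_real s * (\<i> * d) \<in> \<Omega> \<and> q - of_real s * (\<i> * d) \<notin> \<Omega>)"
proof -
  note D = \<Gamma>[unfolded oriented_C1_boundary_def]
  define Q where "Q = (\<lambda>\<gamma> K. finite K \<and> \<gamma> C1_differentiable_on ({0..1} - K) \<and>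
           (\<forall>t\<in>{0..1} - K. let d = vector_derivative \<gamma> (at t) in
              d \<noteq> 0 \<and>
              (\<forall>\<^sub>F s in at_right 0.
                 \<gamma> t + of_real s * (\<i> * d) \<in> \<Omega> \<and> \<gamma> t - of_real s * (\<i> * d) \<notin> closure \<Omega>)))"
  have "\<forall>\<gamma>\<in>\<Gamma>. \<exists>K. Q \<gamma> K" using D unfolding Q_def by simp
  then obtain K where KQ: "\<forall>\<gamma>\<in>\<Gamma>. Q \<gamma> (K \<gamma>)" by (rule bchoice[THEN exE])
  have K: "finite (K \<gamma>)" "\<gamma> C1_differentiable_on ({0..1} - K \<gamma>)" if "\<gamma> \<in> \<Gamma>" for \<gamma>
    using bspec[OF KQ that] unfolding Q_def by simp_all
  have KD: "vector_derivative \<gamma> (at t) \<noteq> 0"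
           "\<forall>\<^sub>F s in at_right 0.
                 \<gamma> t + of_real s * (\<i> * vector_derivative \<gamma> (at t)) \<in> \<Omega> \<and>
                 \<gamma> t - of_real s * (\<i> * vector_derivative \<gamma> (at t)) \<notin> closure \<Omega>"
    if "\<gamma> \<in> \<Gamma>" "t \<in> {0..1} - K \<gamma>" for \<gamma> t
    using bspec[OF KQ that(1)] that(2) unfolding Q_def Let_def by blast+
  define B where "B = (\<Union>\<gamma>\<in>\<Gamma>. \<gamma> ` ((K \<gamma> \<inter> {0..1}) \<union> {0,1})) \<union>
    (\<Union>\<gamma>\<in>\<Gamma>. \<Union>\<eta>\<in>\<Gamma> - {\<gamma>}. path_image \<gamma> \<inter> path_image \<eta>)"
  have fin: "finite B"
  proof -
    have "finite (path_image \<gamma> \<inter> path_image \<eta>)" if "\<gamma> \<in> \<Gamma>" "\<eta> \<in> \<Gamma> - {\<gamma>}" for \<gamma> \<eta>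
      using pairwiseD[OF D[THEN conjunct2, THEN conjunct2, THEN conjunct1], of \<gamma> \<eta>] that by auto
    moreover have "finite \<Gamma>" using D by simp
    ultimately show ?thesis
      unfolding B_def using K(1) by (intro finite_UnI finite_UN_I finite_imageI finite_Diff) simp_all
  qed
  show thesis
  proof (rule that[of B])
    show "finite B" by (rule fin)
    have "\<gamma> ` ((K \<gamma> \<inter> {0..1}) \<union> {0,1}) \<subseteq> path_image \<gamma>" for \<gamma>
      unfolding path_image_def by auto
    then show "B \<subseteq> frontier \<Omega>"
      using D[THEN conjunct2, THEN conjunct1] unfolding B_def by blast
    show "\<forall>\<gamma>\<in>\<Gamma>. \<forall>\<eta>\<in>\<Gamma>. \<gamma> \<noteq> \<eta> \<longrightarrow> path_image \<gamma> \<inter> path_image \<eta> \<subseteq> B"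
      unfolding B_def by blast
    show "\<forall>\<gamma>\<in>\<Gamma>. \<forall>q\<in>path_image \<gamma> - B.
           \<exists>t d. t \<in> {0<..<1} \<and> \<gamma> t = q \<and> (\<gamma> has_vector_derivative d) (at t) \<and> d \<noteq> 0 \<and>
                 (\<forall>\<^sub>F s in at_right 0. q + of_real s * (\<i> * d) \<in> \<Omega> \<and> q - of_real s * (\<i> * d) \<notin> \<Omega>)"
    proof (intro ballI)
      fix \<gamma> q assume g: "\<gamma> \<in> \<Gamma>" and q: "q \<in> path_image \<gamma> - B"
      then obtain t where t: "t \<in> {0..1}" "\<gamma> t = q" by (auto simp: path_image_def)
      have "\<gamma> ` ((K \<gamma> \<inter> {0..1}) \<union> {0,1}) \<subseteq> B" using g unfolding B_def by blast
      then have "t \<notin> K \<gamma>" "t \<noteq> 0" "t \<noteq> 1" using t q by blast+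
      then have t': "t \<in> {0..1} - K \<gamma>" "t \<in> {0<..<1}" using t by auto
      define d where "d = vector_derivative \<gamma> (at t)"
      have "(\<gamma> has_vector_derivative d) (at t)"
        using K(2)[OF g] t'(1) unfolding d_def C1_differentiable_on_eq
        by (simp add: vector_derivative_works)
      moreover have "\<forall>\<^sub>F s in at_right 0. q + of_real s * (\<i> * d) \<in> \<Omega> \<and> q - of_real s * (\<i> * d) \<notin> \<Omega>"
        using KD(2)[OF g t'(1)] closure_subset[of \<Omega>] unfolding d_def t(2)
        by (elim eventually_mono) blast
      ultimately show "\<exists>t d. t \<in> {0<..<1} \<and> \<gamma> t = q \<and> (\<gamma> has_vector_derivative d) (at t) \<and> d \<noteq> 0 \<and>
                   (\<forall>\<^sub>F s in at_right 0. q + of_real s * (\<i> * d) \<in> \<Omega> \<and> q - of_real s * (\<i> * d) \<notin> \<Omega>)"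
        using KD(1)[OF g t'(1)] t t'(2) unfolding d_def by blast
    qed
  qed
qed

lemma winding_number_eq_on_connected:
  assumes "path \<gamma>" "pathfinish \<gamma> = pathstart \<gamma>" "connected T" "T \<inter> path_image \<gamma> = {}"
    "x \<in> T" "y \<in> T"
  shows "winding_number \<gamma> x = winding_number \<gamma> y"
  using winding_number_constant[OF assms(1-4)] assms(5,6) unfolding constant_on_def by metis

text \<open>The segment from \<open>z\<close> to its nearest boundary point runs along the normal and meets the boundary
  only at its end, so the winding number of \<open>\<gamma>\<close> and membership in \<open>\<Omega>\<close> are the same at \<open>z\<close> and
  arbitrarily close to the arc. Crossing the arc changes both by one, so their difference does not
  depend on the side. It does not depend on the arc either, since a simple loop has only the winding numbers
  \<open>0\<close> and \<open>c\<close>, and the jump by one determines which of them is taken on the left.\<close>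

lemma winding_number_beside_arc:
  assumes \<gamma>: "valid_path \<gamma>" "simple_path \<gamma>" and loop: "pathfinish \<gamma> = pathstart \<gamma>"
    and sub: "path_image \<gamma> \<subseteq> frontier \<Omega>"
    and t: "t \<in> {0<..<1}"
    and der: "(\<gamma> has_vector_derivative d) (at t)" "d \<noteq> 0"
    and ori: "\<forall>\<^sub>F s in at_right 0. \<gamma> t + of_real s * (\<i> * d) \<in> \<Omega> \<and> \<gamma> t - of_real s * (\<i> * d) \<notin> \<Omega>"
    and z: "z \<notin> frontier \<Omega>" and near: "\<And>w. w \<in> frontier \<Omega> \<Longrightarrow> dist z (\<gamma> t) \<le> dist z w"
    and c: "\<forall>w. w \<notin> path_image \<gamma> \<longrightarrow> winding_number \<gamma> w \<in> {0, c}"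
      "c = 1 \<or> c = -1"
  shows "winding_number \<gamma> z - of_bool (z \<in> \<Omega>) = (c - 1) / 2"
proof -
  have "dist z (\<gamma> t) \<le> dist z (\<gamma> s)" if "s \<in> {0..1}" for s
    using near sub that by (auto simp: path_image_def image_subset_iff)
  then obtain k where k: "z = \<gamma> t + of_real k * (\<i> * d)"
    using nearest_point_on_curve_normal[OF der t] by blast
  have "\<gamma> t \<in> frontier \<Omega>" using sub t by (auto simp: path_image_def)
  with z k have k0: "k \<noteq> 0" by auto
  define T where "T = (\<lambda>s. \<gamma> t + of_real (s * k) * (\<i> * d)) ` {0<..1}"
  have conn: "connected T" unfolding T_def
    by (intro connected_continuous_image continuous_intros) simp
  have disj: "T \<inter> frontier \<Omega> = {}"
  proof -
    have False if "s \<in> {0<..1}" "\<gamma> t + of_real (s * k) * (\<i> * d) \<in> frontier \<Omega>" for s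
    proof -
      have "dist z (\<gamma> t) \<le> dist z (\<gamma> t + of_real (s * k) * (\<i> * d))" using near that by blast
      also have "z - (\<gamma> t + of_real (s * k) * (\<i> * d)) = of_real ((1 - s) * k) * (\<i> * d)"
        by (simp add: k algebra_simps)
      then have "dist z (\<gamma> t + of_real (s * k) * (\<i> * d)) = \<bar>(1 - s) * k\<bar> * norm d"
        by (simp only: dist_norm norm_mult norm_of_real) simp
      also have "\<dots> = (1 - s) * (\<bar>k\<bar> * norm d)"
        using that by (simp add: abs_mult)
      finally have "\<bar>k\<bar> * norm d \<le> (1 - s) * (\<bar>k\<bar> * norm d)"
        by (simp add: k dist_norm norm_mult)
      moreover have "\<bar>k\<bar> * norm d > 0" using k0 der by simp
      ultimately show False using that by (simp add: mult_le_cancel_right1)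
    qed
    then show ?thesis unfolding T_def by blast
  qed
  have zT: "z \<in> T" unfolding T_def using k by (intro image_eqI[of _ _ 1]) auto
  have inj: "\<forall>s\<in>{0..1}. \<gamma> s = \<gamma> t \<longrightarrow> s = t"
    using \<gamma>(2) t unfolding simple_path_def loop_free_def by force
  have "\<forall>\<^sub>F s in at_right 0. s \<in> {0<..<\<bar>k\<bar>}"
    using k0 by (intro eventually_at_rightI[of 0 "\<bar>k\<bar>"]) auto
  then have ev: "\<forall>\<^sub>F s in at_right 0. s \<in> {0<..<\<bar>k\<bar>} \<and>
     (\<gamma> t + of_real s * (\<i> * d) \<in> \<Omega> \<and> \<gamma> t - of_real s * (\<i> * d) \<notin> \<Omega>) \<and>
     (\<gamma> t + of_real s * (\<i> * d) \<notin> path_image \<gamma> \<and> \<gamma> t - of_real s * (\<i> * d) \<notin> path_image \<gamma> \<and>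
           winding_number \<gamma> (\<gamma> t + of_real s * (\<i> * d)) =
             winding_number \<gamma> (\<gamma> t - of_real s * (\<i> * d)) + 1)"
    using ori winding_number_jump_eq[OF \<gamma>(1) loop t inj der]
    by (rule eventually_conj[OF _ eventually_conj])
  from eventually_happens'[OF trivial_limit_at_right_real ev]
  obtain s where "s \<in> {0<..<\<bar>k\<bar>}"
    and side: "\<gamma> t + of_real s * (\<i> * d) \<in> \<Omega>" "\<gamma> t - of_real s * (\<i> * d) \<notin> \<Omega>"
    and off: "\<gamma> t + of_real s * (\<i> * d) \<notin> path_image \<gamma>" "\<gamma> t - of_real s * (\<i> * d) \<notin> path_image \<gamma>"
    and jump: "winding_number \<gamma> (\<gamma> t + of_real s * (\<i> * d)) =
             winding_number \<gamma> (\<gamma> t - of_real s * (\<i> * d)) + 1"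
    by (elim exE conjE)
  then have s: "0 < s" "s < \<bar>k\<bar>" by auto
  have wn: "winding_number \<gamma> (\<gamma> t + of_real s * (\<i> * d)) = (c + 1) / 2"
           "winding_number \<gamma> (\<gamma> t - of_real s * (\<i> * d)) = (c - 1) / 2"
    using mp[OF spec[OF c(1)] off(1)] mp[OF spec[OF c(1)] off(2)] c(2)
    unfolding jump by (elim insertE disjE; simp)+
  have same: "winding_number \<gamma> z = winding_number \<gamma> w" "z \<in> \<Omega> \<longleftrightarrow> w \<in> \<Omega>" if "w \<in> T" for w
  proof -
    have "T \<inter> path_image \<gamma> = {}" using disj sub by blast
    then show "winding_number \<gamma> z = winding_number \<gamma> w"
      using winding_number_eq_on_connected[OF valid_path_imp_path[OF \<gamma>(1)] loop conn _ zT that] by simp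
    show "z \<in> \<Omega> \<longleftrightarrow> w \<in> \<Omega>"
      by (rule mem_iff_if_connected_off_frontier[OF conn disj zT that])
  qed
  show ?thesis
  proof (cases "k > 0")
    case True
    have "\<gamma> t + of_real s * (\<i> * d) \<in> T"
      unfolding T_def using True s by (intro image_eqI[of _ _ "s / k"]) auto
    from same[OF this] wn side show ?thesis by (simp add: add_divide_distrib diff_divide_distrib)
  next
    case False
    have "\<gamma> t - of_real s * (\<i> * d) \<in> T"
      unfolding T_def using False s k0 by (intro image_eqI[of _ _ "s / (-k)"]) (auto simp: field_simps)
    from same[OF this] wn side show ?thesis by simp
  qed
qed

text \<open>Near a boundary point outside \<open>B\<close>, only the curve through that point matters: the winding numbers of all
  others are constant on a small ball.\<close>

lemma locally_constant_boundary_index: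
  assumes \<Gamma>: "oriented_C1_boundary \<Omega> \<Gamma>" and "finite B" "B \<subseteq> frontier \<Omega>"
    and BI: "\<forall>\<gamma>\<in>\<Gamma>. \<forall>\<eta>\<in>\<Gamma>. \<gamma> \<noteq> \<eta> \<longrightarrow> path_image \<gamma> \<inter> path_image \<eta> \<subseteq> B"
    and BG: "\<forall>\<gamma>\<in>\<Gamma>. \<forall>q\<in>path_image \<gamma> - B.
           \<exists>t d. t \<in> {0<..<1} \<and> \<gamma> t = q \<and> (\<gamma> has_vector_derivative d) (at t) \<and> d \<noteq> 0 \<and>
                 (\<forall>\<^sub>F s in at_right 0. q + of_real s * (\<i> * d) \<in> \<Omega> \<and> q - of_real s * (\<i> * d) \<notin> \<Omega>)"
    and p: "p \<notin> B"
  shows "\<exists>e>0. \<exists>C. \<forall>z\<in>ball p e - frontier \<Omega>. (\<Sum>\<gamma>\<in>\<Gamma>. winding_number \<gamma> z) - of_bool (z \<in> \<Omega>) = (C :: complex)"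
proof -
  note D = \<Gamma>[unfolded oriented_C1_boundary_def]
  have fin: "finite \<Gamma>" and fr: "frontier \<Omega> = (\<Union>\<gamma>\<in>\<Gamma>. path_image \<gamma>)"
    and sim: "\<And>\<gamma>. \<gamma> \<in> \<Gamma> \<Longrightarrow> simple_path \<gamma>"
    and loop: "\<And>\<gamma>. \<gamma> \<in> \<Gamma> \<Longrightarrow> pathfinish \<gamma> = pathstart \<gamma>" using D by auto
  have vp: "valid_path \<gamma>" if "\<gamma> \<in> \<Gamma>" for \<gamma> using oriented_C1_boundary_valid_path[OF \<Gamma> that] .
  have cl: "closed (path_image \<gamma>)" if "\<gamma> \<in> \<Gamma>" for \<gamma>
    using sim[OF that] by (simp add: closed_simple_path_image)
  \<comment> \<open>near \<open>p\<close> only the curves through \<open>p\<close> matter\<close>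
  have others: "\<exists>C. \<forall>z\<in>ball p e. (\<Sum>\<gamma>\<in>\<Gamma>'. winding_number \<gamma> z) = C"
    if "\<Gamma>' \<subseteq> \<Gamma>" "\<And>\<gamma>. \<gamma> \<in> \<Gamma>' \<Longrightarrow> ball p e \<inter> path_image \<gamma> = {}" "e > 0" for \<Gamma>' e
  proof (intro exI ballI)
    fix z assume "z \<in> ball p e"
    then show "(\<Sum>\<gamma>\<in>\<Gamma>'. winding_number \<gamma> z) = (\<Sum>\<gamma>\<in>\<Gamma>'. winding_number \<gamma> p)"
      using that vp loop
      by (intro sum.cong refl winding_number_eq_on_connected[of _ "ball p e"] valid_path_imp_path)
        auto
  qed
  show ?thesis
  proof (cases "p \<in> frontier \<Omega>")
    case False
    then have "open (- frontier \<Omega>)" "p \<in> - frontier \<Omega>" by (auto simp: open_Compl)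
    then obtain e where e: "e > 0" "ball p e \<subseteq> - frontier \<Omega>" by (meson open_contains_ball)
    have "ball p e \<inter> path_image \<gamma> = {}" if "\<gamma> \<in> \<Gamma>" for \<gamma> using e(2) fr that by blast
    from others[OF subset_refl this e(1)]
    obtain C where "\<forall>z\<in>ball p e. (\<Sum>\<gamma>\<in>\<Gamma>. winding_number \<gamma> z) = C" ..
    moreover have "of_bool (z \<in> \<Omega>) = (of_bool (p \<in> \<Omega>) :: complex)" if "z \<in> ball p e" for z
    proof -
      have "z \<in> \<Omega> \<longleftrightarrow> p \<in> \<Omega>"
        using e by (intro mem_iff_if_connected_off_frontier[of "ball p e"] that) auto
      then show ?thesis by (simp only:)
    qed
    ultimately have "\<forall>z\<in>ball p e - frontier \<Omega>. (\<Sum>\<gamma>\<in>\<Gamma>. winding_number \<gamma> z) - of_bool (z \<in> \<Omega>)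
        = C - of_bool (p \<in> \<Omega>)"
      by simp
    then show ?thesis using e(1) by blast
  next
    case True
    then obtain \<gamma> where g: "\<gamma> \<in> \<Gamma>" "p \<in> path_image \<gamma>" using fr by auto
    \<comment> \<open>halving the radius keeps the nearest boundary point of \<open>z\<close> inside the larger ball\<close>
    define X where "X = B \<union> (\<Union>\<eta>\<in>\<Gamma> - {\<gamma>}. path_image \<eta>)"
    have "closed X" unfolding X_def using fin cl
      by (intro closed_Un[OF finite_imp_closed[OF assms(2)]] closed_UN) auto
    then have "open (- X)" by (rule open_Compl)
    moreover have "p \<notin> path_image \<eta>" if "\<eta> \<in> \<Gamma> - {\<gamma>}" for \<eta>
      using BI g that p by blast
    then have "p \<in> - X" using p unfolding X_def by blast
    ultimately obtain e' where e': "e' > 0" "ball p e' \<subseteq> - X"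
      unfolding open_contains_ball by blast
    define e where "e = e' / 2"
    have e: "e > 0" "e \<le> e'" using e' by (auto simp: e_def)
    have ball_sub: "ball p e \<subseteq> ball p e'" using e by auto
    have "ball p e \<inter> path_image \<eta> = {}" if "\<eta> \<in> \<Gamma> - {\<gamma>}" for \<eta>
      using that e' ball_sub unfolding X_def by blast
    from others[OF Diff_subset this e(1)]
    obtain C where C: "\<forall>z\<in>ball p e. (\<Sum>\<gamma>\<in>\<Gamma> - {\<gamma>}. winding_number \<gamma> z) = C" ..
    obtain c where c: "\<forall>z. z \<notin> path_image \<gamma> \<longrightarrow> winding_number \<gamma> z \<in> {0, c}" "c = 1 \<or> c = -1"
      by (rule simple_loop_winding_numbers[OF sim[OF g(1)] loop[OF g(1)]])
    have "winding_number \<gamma> z - of_bool (z \<in> \<Omega>) = (c - 1) / 2" if z: "z \<in> ball p e - frontier \<Omega>" for z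
    proof -
      obtain q where q: "q \<in> frontier \<Omega>" "\<And>w. w \<in> frontier \<Omega> \<Longrightarrow> dist z q \<le> dist z w"
        using distance_attains_inf[OF frontier_closed, of \<Omega> z] True by blast
      have "dist p q \<le> dist p z + dist z q" by (rule dist_triangle)
      also have "\<dots> \<le> dist p z + dist z p" using q(2)[OF True] by simp
      also have "\<dots> < e'" using z by (simp add: dist_commute e_def)
      finally have "q \<in> ball p e'" by simp
      then have qX: "q \<notin> X" using e' by auto
      then have "q \<in> path_image \<gamma> - B" using q(1) fr by (auto simp: X_def)
      from bspec[OF bspec[OF BG g(1)] this] obtain t d where t: "t \<in> {0<..<1}" "\<gamma> t = q"
          "(\<gamma> has_vector_derivative d) (at t)" "d \<noteq> 0"
          "\<forall>\<^sub>F s in at_right 0. q + of_real s * (\<i> * d) \<in> \<Omega> \<and> q - of_real s * (\<i> * d) \<notin> \<Omega>"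
        by blast
      show ?thesis
      proof (rule winding_number_beside_arc[OF vp[OF g(1)] sim[OF g(1)] loop[OF g(1)] _ t(1,3,4)])
        show "path_image \<gamma> \<subseteq> frontier \<Omega>" using fr g(1) by blast
        show "z \<notin> frontier \<Omega>" using z by blast
      qed (use t(2,5) q(2) c in \<open>simp_all\<close>)
    qed
    then have "\<forall>z\<in>ball p e - frontier \<Omega>. (\<Sum>\<gamma>\<in>\<Gamma>. winding_number \<gamma> z) - of_bool (z \<in> \<Omega>) = C + (c - 1) / 2"
      using C by (simp add: sum.remove[OF fin g(1)] add_diff_eq[symmetric] add.commute)
    then show ?thesis using e by blast
  qed
qed

text \<open>A finite set does not disconnect the plane, so the difference between the two sides of the
  equation, which is locally constant off the corners and crossings, has its value far away everywhere.\<close>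

theorem winding_number_oriented_C1_boundary:
  assumes \<Gamma>: "oriented_C1_boundary \<Omega> \<Gamma>" and "open \<Omega>" "bounded \<Omega>" and z: "z \<notin> frontier \<Omega>"
  shows "(\<Sum>\<gamma>\<in>\<Gamma>. winding_number \<gamma> z) = of_bool (z \<in> \<Omega>)"
proof -
  define N where "N = (\<lambda>z. (\<Sum>\<gamma>\<in>\<Gamma>. winding_number \<gamma> z) - of_bool (z \<in> \<Omega>))"
  obtain B where B: "finite B" "B \<subseteq> frontier \<Omega>"
    and BI: "\<forall>\<gamma>\<in>\<Gamma>. \<forall>\<eta>\<in>\<Gamma>. \<gamma> \<noteq> \<eta> \<longrightarrow> path_image \<gamma> \<inter> path_image \<eta> \<subseteq> B"
    and BG: "\<forall>\<gamma>\<in>\<Gamma>. \<forall>q\<in>path_image \<gamma> - B.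
           \<exists>t d. t \<in> {0<..<1} \<and> \<gamma> t = q \<and> (\<gamma> has_vector_derivative d) (at t) \<and> d \<noteq> 0 \<and>
                 (\<forall>\<^sub>F s in at_right 0. q + of_real s * (\<i> * d) \<in> \<Omega> \<and> q - of_real s * (\<i> * d) \<notin> \<Omega>)"
    by (rule oriented_C1_boundary_good_points[OF \<Gamma>])
  have loc: "\<exists>e>0. \<exists>C. \<forall>z\<in>ball p e - frontier \<Omega>. N z = C" if "p \<notin> B" for p
    unfolding N_def by (rule locally_constant_boundary_index[OF \<Gamma> B BI BG that])
  \<comment> \<open>a ball inside the frontier would have to meet \<open>\<Omega>\<close>\<close>
  have dense: "\<exists>w. w \<in> ball p e - frontier \<Omega>" if "e > 0" for p e
  proof (rule ccontr)
    assume "\<not> ?thesis"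
    then have sub: "ball p e \<subseteq> frontier \<Omega>" by blast
    then have "p \<in> closure \<Omega>" using that centre_in_ball[of p e] unfolding frontier_def by blast
    then have "ball p e \<inter> \<Omega> \<noteq> {}"
      using that by (metis IntI centre_in_ball empty_iff open_Int_closure_eq_empty open_ball)
    then show False
      using sub \<open>open \<Omega>\<close> by (auto simp: frontier_def interior_open)
  qed
  define A where "A = (\<lambda>P. {p. p \<notin> B \<and> (\<exists>e>0. \<forall>w\<in>ball p e - frontier \<Omega>. P (N w))})"
  have opA: "open (A P)" for P
    unfolding open_contains_ball
  proof
    fix p assume "p \<in> A P"
    then obtain e where e: "p \<notin> B" "e > 0" "\<forall>w\<in>ball p e - frontier \<Omega>. P (N w)"
      by (auto simp: A_def)
    have "open (ball p e - B)" using B(1) by (intro open_Diff finite_imp_closed) auto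
    moreover have "p \<in> ball p e - B" using e by simp
    ultimately obtain e' where e': "e' > 0" "ball p e' \<subseteq> ball p e - B"
      by (meson open_contains_ball)
    have "y \<in> A P" if y: "y \<in> ball p e'" for y
    proof -
      obtain e2 where "e2 > 0" "ball y e2 \<subseteq> ball p e'"
        using y open_ball[of p e'] unfolding open_contains_ball by blast
      then show ?thesis using y e e' unfolding A_def by blast
    qed
    then show "\<exists>e>0. ball p e \<subseteq> A P" using e' by blast
  qed
  have cover: "- B \<subseteq> A (\<lambda>c. c = 0) \<union> A (\<lambda>c. c \<noteq> 0)"
  proof
    fix p assume "p \<in> - B"
    then obtain e C where "e > 0" "\<forall>z\<in>ball p e - frontier \<Omega>. N z = C" using loc[of p] by auto
    then show "p \<in> A (\<lambda>c. c = 0) \<union> A (\<lambda>c. c \<noteq> 0)"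
      using \<open>p \<in> - B\<close> by (cases "C = 0") (auto simp: A_def)
  qed
  have disj: "A (\<lambda>c. c = 0) \<inter> A (\<lambda>c. c \<noteq> 0) \<inter> - B = {}"
  proof -
    have False if pA: "p \<in> A (\<lambda>c. c = 0)" "p \<in> A (\<lambda>c. c \<noteq> 0)" for p
    proof -
      obtain e where e: "e > 0" "\<forall>w\<in>ball p e - frontier \<Omega>. N w = 0"
        using pA(1) unfolding A_def by blast
      obtain e' where e': "e' > 0" "\<forall>w\<in>ball p e' - frontier \<Omega>. N w \<noteq> 0"
        using pA(2) unfolding A_def by blast
      obtain w where "w \<in> ball p (min e e') - frontier \<Omega>" using dense[of "min e e'" p] e e' by auto
      then have "w \<in> ball p e - frontier \<Omega>" "w \<in> ball p e' - frontier \<Omega>" by auto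
      then show False using e(2) e'(2) by blast
    qed
    then show ?thesis by blast
  qed
  have conn: "connected (- B)"
    using connected_open_delete_finite[of UNIV B] B by (simp add: Compl_eq_Diff_UNIV connected_UNIV)
  \<comment> \<open>far away both the winding numbers and the indicator of \<open>\<Omega>\<close> vanish\<close>
  have far: "A (\<lambda>c. c = 0) \<inter> - B \<noteq> {}"
  proof -
    note D = \<Gamma>[unfolded oriented_C1_boundary_def]
    have "\<exists>R. \<forall>z. R \<le> norm z \<longrightarrow> winding_number \<gamma> z = 0" if "\<gamma> \<in> \<Gamma>" for \<gamma>
      using D that by (intro winding_number_zero_at_infinity) (auto simp: simple_path_imp_path)
    then obtain R where R: "\<And>\<gamma> z. \<gamma> \<in> \<Gamma> \<Longrightarrow> R \<gamma> \<le> norm z \<Longrightarrow> winding_number \<gamma> z = 0" by metis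
    obtain R0 where R0: "\<forall>x\<in>\<Omega> \<union> B. norm x \<le> R0"
      using \<open>bounded \<Omega>\<close> finite_imp_bounded[OF B(1)] bounded_Un bounded_iff by metis
    define M where "M = \<bar>R0\<bar> + (\<Sum>\<gamma>\<in>\<Gamma>. \<bar>R \<gamma>\<bar>)"
    have M: "R \<gamma> \<le> M" if "\<gamma> \<in> \<Gamma>" for \<gamma>
      using member_le_sum[of \<gamma> \<Gamma> "\<lambda>\<gamma>. \<bar>R \<gamma>\<bar>"] that D by (auto simp: M_def)
    have M0: "R0 \<le> M" unfolding M_def by (smt (verit) sum_nonneg abs_ge_zero)
    have zero: "N w = 0" if "norm w > M" for w
    proof -
      have "(\<Sum>\<gamma>\<in>\<Gamma>. winding_number \<gamma> w) = 0"
        using that M R by (intro sum.neutral) force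
      moreover have "w \<notin> \<Omega>" using that M0 R0 by force
      ultimately show ?thesis by (simp add: N_def)
    qed
    define p :: complex where "p = of_real (\<bar>M\<bar> + 2)"
    have np: "norm p = \<bar>M\<bar> + 2" unfolding p_def norm_of_real by simp
    have "norm w > M" if "w \<in> ball p 1" for w
      using that norm_triangle_ineq2[of p w] np by (auto simp: dist_norm)
    then have "p \<in> A (\<lambda>c. c = 0)"
      using zero np M0 R0 unfolding A_def by (intro CollectI conjI exI[of _ 1]) force+
    then show ?thesis by (auto simp: A_def)
  qed
  have "A (\<lambda>c. c \<noteq> 0) \<inter> - B = {}"
    using connectedD[OF conn opA opA disj cover] far by blast
  moreover have "z \<notin> B" using z B(2) by blast
  ultimately have "z \<in> A (\<lambda>c. c = 0)" using cover by blast
  then have "N z = 0" using z by (auto simp: A_def)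
  then show ?thesis by (simp add: N_def)
qed

section \<open>The argument principle for cycles\<close>

text \<open>The loops are joined to a base point by arcs that are traversed in both directions, so that the
  arcs cancel. Thus results about a single loop apply to cycles.\<close>

lemma concat_loops:
  assumes S: "open S" "connected S" "a \<in> S" and "finite \<Gamma>"
    and "\<forall>\<gamma>\<in>\<Gamma>. valid_path \<gamma> \<and> pathfinish \<gamma> = pathstart \<gamma> \<and> path_image \<gamma> \<subseteq> S"
  shows "\<exists>g. valid_path g \<and> pathstart g = a \<and> pathfinish g = a \<and> path_image g \<subseteq> S \<and>
           (\<forall>z. z \<notin> S \<longrightarrow> winding_number g z = (\<Sum>\<gamma>\<in>\<Gamma>. winding_number \<gamma> z)) \<and>
           (\<forall>f. f holomorphic_on S \<longrightarrow> contour_integral g f = (\<Sum>\<gamma>\<in>\<Gamma>. contour_integral \<gamma> f))"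
  using assms(4,5)
proof (induction \<Gamma> rule: finite_induct)
  case empty
  have "winding_number (linepath a a) z = 0" if "z \<notin> S" for z
    using winding_number_trivial[of z a] S(3) that by metis
  then show ?case
    using S by (intro exI[of _ "linepath a a"]) (simp add: contour_integral_trivial del: linepath_trivial)
next
  case (insert \<gamma> \<Gamma>)
  then obtain g where g: "valid_path g" "pathstart g = a" "pathfinish g = a" "path_image g \<subseteq> S"
    and gw: "\<And>z. z \<notin> S \<Longrightarrow> winding_number g z = (\<Sum>\<gamma>\<in>\<Gamma>. winding_number \<gamma> z)"
    and gi: "\<And>f. f holomorphic_on S \<Longrightarrow> contour_integral g f = (\<Sum>\<gamma>\<in>\<Gamma>. contour_integral \<gamma> f)"
    by auto
  have \<gamma>: "valid_path \<gamma>" "pathfinish \<gamma> = pathstart \<gamma>" "path_image \<gamma> \<subseteq> S"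
    using insert.prems by auto
  have "pathstart \<gamma> \<in> S" using \<gamma>(3) pathstart_in_path_image by blast
  then obtain s where "polynomial_function s" and s: "path_image s \<subseteq> S" "pathstart s = a" "pathfinish s = pathstart \<gamma>"
    using connected_open_polynomial_connected[OF S(1,2) S(3)] by blast
  then have vs: "valid_path s" by (simp add: valid_path_polynomial_function)
  define g' where "g' = (s +++ (\<gamma> +++ reversepath s)) +++ g"
  have vp: "valid_path g'" and se: "pathstart g' = a" "pathfinish g' = a"
    and im: "path_image g' \<subseteq> S"
    using vs s \<gamma> g by (simp_all add: g'_def path_image_join)
  have "winding_number g' z = (\<Sum>\<gamma>\<in>insert \<gamma> \<Gamma>. winding_number \<gamma> z)" if z: "z \<notin> S" for z
  proof -
    have nz: "z \<notin> path_image s" "z \<notin> path_image \<gamma>" "z \<notin> path_image g" using z s \<gamma> g by auto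
    have "path s" "path \<gamma>" "path g" using vs \<gamma> g by (auto intro: valid_path_imp_path)
    then have "winding_number g' z = winding_number \<gamma> z + winding_number g z"
      using s \<gamma> g nz unfolding g'_def
      by (simp add: winding_number_join winding_number_reversepath path_image_join)
    then show ?thesis using insert.hyps gw[OF z] by simp
  qed
  moreover have "contour_integral g' f = (\<Sum>\<gamma>\<in>insert \<gamma> \<Gamma>. contour_integral \<gamma> f)"
    if f: "f holomorphic_on S" for f
  proof -
    have ci: "f contour_integrable_on p" if "valid_path p" "path_image p \<subseteq> S" for p
      using contour_integrable_holomorphic_simple[OF f S(1) that] .
    have "contour_integral g' f = contour_integral \<gamma> f + contour_integral g f"
      using vs s \<gamma> g ci unfolding g'_def
      by (simp add: contour_integral_join contour_integral_reversepath contour_integrable_reversepath)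
    then show ?thesis using insert.hyps gi[OF f] by simp
  qed
  ultimately show ?case using vp se im by blast
qed

text \<open>The arcs that join the boundary curves to one loop have to avoid all zeros of \<open>h\<close>, which is possible
  because removing a countable set keeps \<open>U\<close> connected. The zeros outside \<open>\<Omega>\<close> can be infinite in number;
  they are removed from the domain, as the total winding number around them is zero.\<close>

lemma argument_principle_cycle:
  assumes U: "open U" "connected U" and h: "h holomorphic_on U"
    and \<Omega>: "open \<Omega>" "\<Omega> \<noteq> {}" "compact (closure \<Omega>)" "closure \<Omega> \<subseteq> U"
    and nz: "\<forall>z\<in>frontier \<Omega>. h z \<noteq> 0" "frontier \<Omega> \<noteq> {}"
    and \<Gamma>: "finite \<Gamma>" "\<forall>\<gamma>\<in>\<Gamma>. valid_path \<gamma> \<and> pathfinish \<gamma> = pathstart \<gamma> \<and> path_image \<gamma> \<subseteq> frontier \<Omega>"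
    and wn: "\<forall>z. z \<notin> frontier \<Omega> \<longrightarrow> (\<Sum>\<gamma>\<in>\<Gamma>. winding_number \<gamma> z) = of_bool (z \<in> \<Omega>)"
  shows "finite {z \<in> \<Omega>. h z = 0}"
    and "(\<Sum>\<gamma>\<in>\<Gamma>. contour_integral \<gamma> (\<lambda>z. deriv h z / h z)) =
           2 * of_real pi * \<i> * of_int (\<Sum>z | z \<in> \<Omega> \<and> h z = 0. zorder h z)"
proof -
  obtain a where a: "a \<in> frontier \<Omega>" "h a \<noteq> 0" using nz by auto
  have fr: "frontier \<Omega> \<subseteq> U" "\<Omega> \<subseteq> U" using \<Omega> closure_subset[of \<Omega>] by (auto simp: frontier_def)
  have aU: "a \<in> U" using a fr by blast
  have zeros: "finite {z \<in> closure \<Omega>. h z = 0}" "countable {z \<in> U. h z = 0}"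
  proof (atomize(full), cases "h constant_on U")
    case True
    then have "\<forall>z\<in>U. h z = h a" using aU by (auto simp: constant_on_def)
    then have e: "{z \<in> U. h z = 0} = {}" "{z \<in> closure \<Omega>. h z = 0} = {}" using a \<Omega> by auto
    then show "finite {z \<in> closure \<Omega>. h z = 0} \<and> countable {z \<in> U. h z = 0}" unfolding e by simp
  next
    case False
    note fin = holomorphic_compact_finite_zeros[OF h U _ _ this]
    obtain C :: "nat \<Rightarrow> complex set" where C: "\<And>n. compact (C n)" "\<And>n. C n \<subseteq> U" "\<Union>(range C) = U"
      using open_Union_compact_subsets[OF U(1)] by metis
    have "{z \<in> U. h z = 0} = (\<Union>n. {z \<in> C n. h z = 0})" using C(3) by blast
    moreover have "countable (\<Union>n. {z \<in> C n. h z = 0})"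
      by (rule countable_UN[OF countableI_type]) (rule countable_finite[OF fin[OF C(1,2)]])
    ultimately show "finite {z \<in> closure \<Omega>. h z = 0} \<and> countable {z \<in> U. h z = 0}"
      using fin[OF \<Omega>(3,4)] by simp
  qed
  define Z where "Z = {z \<in> \<Omega>. h z = 0}"
  show finZ: "finite {z \<in> \<Omega>. h z = 0}"
    by (rule finite_subset[OF _ zeros(1)]) (use closure_subset[of \<Omega>] in auto)
  define S0 where "S0 = {z \<in> U. h z \<noteq> 0}"
  have "S0 = U - {z \<in> U. h z = 0}" by (auto simp: S0_def)
  then have conS0: "connected S0" using connected_open_diff_countable[OF _ U zeros(2)] by simp
  have "S0 = U \<inter> h -` (- {0})" by (auto simp: S0_def)
  then have opS0: "open S0"
    using continuous_open_preimage[OF holomorphic_on_imp_continuous_on[OF h] U(1), of "- {0}"]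
    by (simp add: open_Compl)
  have frS0: "frontier \<Omega> \<subseteq> S0" using fr(1) nz(1) unfolding S0_def by blast
  have aS0: "a \<in> S0" using a(1) frS0 by blast
  have \<Gamma>S0: "\<forall>\<gamma>\<in>\<Gamma>. valid_path \<gamma> \<and> pathfinish \<gamma> = pathstart \<gamma> \<and> path_image \<gamma> \<subseteq> S0"
    using \<Gamma>(2) frS0 by (meson order_trans)
  from concat_loops[OF opS0 conS0 aS0 \<Gamma>(1) \<Gamma>S0]
  obtain g where g: "valid_path g" "pathstart g = a" "pathfinish g = a" "path_image g \<subseteq> S0"
    and gw: "\<forall>z. z \<notin> S0 \<longrightarrow> winding_number g z = (\<Sum>\<gamma>\<in>\<Gamma>. winding_number \<gamma> z)"
    and gi: "\<forall>f. f holomorphic_on S0 \<longrightarrow> contour_integral g f = (\<Sum>\<gamma>\<in>\<Gamma>. contour_integral \<gamma> f)"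
    by (elim exE conjE)
  define S where "S = S0 \<union> \<Omega>"
  have opS: "open S" unfolding S_def using opS0 \<Omega>(1) by (rule open_Un)
  have SU: "S \<subseteq> U" using fr by (auto simp: S_def S0_def)
  have "S = U - {z \<in> U. h z = 0 \<and> z \<notin> \<Omega>}" using fr by (auto simp: S_def S0_def)
  moreover have "countable {z \<in> U. h z = 0 \<and> z \<notin> \<Omega>}" by (rule countable_subset[OF _ zeros(2)]) auto
  ultimately have conS: "connected S" using connected_open_diff_countable[OF _ U] by simp
  have pz: "{w \<in> S. h w = 0 \<or> w \<in> {}} = Z" by (auto simp: S_def S0_def Z_def)
  have hS: "h holomorphic_on S" using h SU by (rule holomorphic_on_subset)
  have h0: "(\<lambda>z. deriv h z / h z) holomorphic_on S0"
    using h opS0 SU U by (intro holomorphic_intros) (auto simp: S0_def S_def intro: holomorphic_on_subset)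
  have "contour_integral g (\<lambda>z. deriv h z * 1 / h z) =
          2 * pi * \<i> * (\<Sum>p\<in>{w \<in> S. h w = 0 \<or> w \<in> {}}. winding_number g p * 1 * zorder h p)"
  proof (rule argument_principle[of S h "{}" "\<lambda>_. 1" g])
    show "\<forall>z. z \<notin> S \<longrightarrow> winding_number g z = 0"
    proof (intro allI impI)
      fix z assume "z \<notin> S"
      then have "z \<notin> S0" "z \<notin> \<Omega>" "z \<notin> frontier \<Omega>" using frS0 by (auto simp: S_def)
      then show "winding_number g z = 0" using gw wn[rule_format, of z] by simp
    qed
    show "finite {w \<in> S. h w = 0 \<or> w \<in> {}}" unfolding pz Z_def by (rule finZ)
  qed (use opS conS hS g in \<open>auto simp: S_def S0_def\<close>)
  also have "(\<Sum>p\<in>{w \<in> S. h w = 0 \<or> w \<in> {}}. winding_number g p * 1 * zorder h p)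
              = (\<Sum>p\<in>Z. of_int (zorder h p))"
    unfolding pz
  proof (rule sum.cong[OF refl])
    fix p assume p: "p \<in> Z"
    then have "winding_number g p = 1"
      using gw wn[rule_format, of p] nz(1) by (auto simp: Z_def S0_def)
    then show "winding_number g p * 1 * zorder h p = of_int (zorder h p)" by simp
  qed
  finally show "(\<Sum>\<gamma>\<in>\<Gamma>. contour_integral \<gamma> (\<lambda>z. deriv h z / h z)) =
           2 * of_real pi * \<i> * of_int (\<Sum>z | z \<in> \<Omega> \<and> h z = 0. zorder h z)"
    using gi h0 by (simp add: Z_def)
qed

section \<open>Complexified quaternions\<close>

text \<open>The four complex coordinates of \<open>a + \<i> b\<close> with quaternions \<open>a\<close> and \<open>b\<close>; here \<open>\<i>\<close> is central and not
  to be confused with the quaternion unit.\<close>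

type_synonym cquat = "complex \<times> complex \<times> complex \<times> complex"

definition re_part :: "cquat \<Rightarrow> quat" where
  "re_part = (\<lambda>(a, b, c, d). Quat (Re a) (Re b) (Re c) (Re d))"

definition im_part :: "cquat \<Rightarrow> quat" where
  "im_part = (\<lambda>(a, b, c, d). Quat (Im a) (Im b) (Im c) (Im d))"

definition cq_times :: "cquat \<Rightarrow> cquat \<Rightarrow> cquat" where
  "cq_times = (\<lambda>(a0, a1, a2, a3) (b0, b1, b2, b3).
     (a0 * b0 - a1 * b1 - a2 * b2 - a3 * b3,
      a0 * b1 + a1 * b0 + a2 * b3 - a3 * b2,
      a0 * b2 - a1 * b3 + a2 * b0 + a3 * b1,
      a0 * b3 + a1 * b2 - a2 * b1 + a3 * b0))"

definition cq_scale :: "complex \<Rightarrow> cquat \<Rightarrow> cquat" where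
  "cq_scale c = (\<lambda>(a0, a1, a2, a3). (c * a0, c * a1, c * a2, c * a3))"

text \<open>The value on the slice of \<open>v\<close> is obtained by putting \<open>v\<close> for the central imaginary unit.\<close>

definition slice_value :: "quat \<Rightarrow> cquat \<Rightarrow> quat" where
  "slice_value v t = re_part t + v * im_part t"

lemma cquat_eq_iff: "s = t \<longleftrightarrow> re_part s = re_part t \<and> im_part s = im_part t"
  by (cases s; cases t) (auto simp: re_part_def im_part_def complex_eq_iff)

lemma parts_times:
  "re_part (cq_times s t) = re_part s * re_part t - im_part s * im_part t"
  "im_part (cq_times s t) = re_part s * im_part t + im_part s * re_part t"
  by (cases s; cases t; simp add: re_part_def im_part_def cq_times_def times_quat_def minus_quat_def
      plus_quat_def algebra_simps)+

lemma parts_scale: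
  "re_part (cq_scale c t) = of_real (Re c) * re_part t - of_real (Im c) * im_part t"
  "im_part (cq_scale c t) = of_real (Re c) * im_part t + of_real (Im c) * re_part t"
  by (cases t; simp add: re_part_def im_part_def cq_scale_def of_real_def quat_arith_defs)+

lemma parts_assoc_map: "re_part (assoc_map \<alpha> \<beta> z) = \<alpha> z" "im_part (assoc_map \<alpha> \<beta> z) = \<beta> z"
  by (auto simp: assoc_map_def re_part_def im_part_def)

text \<open>\<open>Phi\<close> is the norm form of the complexified quaternions; this is Euler's four-square identity.\<close>

lemma Phi_times: "Phi (cq_times s t) = Phi s * Phi t"
  by (cases s; cases t) (simp add: Phi_def cq_times_def power2_eq_square algebra_simps)

lemma Phi_scale: "Phi (cq_scale c t) = c\<^sup>2 * Phi t"
  by (cases t) (simp add: Phi_def cq_scale_def power2_eq_square algebra_simps)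

lemma cq_times_scale: "cq_times s (cq_scale c t) = cq_scale c (cq_times s t)"
  by (cases s; cases t) (simp add: cq_times_def cq_scale_def algebra_simps)

lemma cq_scale_scale: "cq_scale a (cq_scale b t) = cq_scale (a * b) t"
  by (cases t) (simp add: cq_scale_def mult.assoc)

lemma cq_scale_1 [simp]: "cq_scale 1 t = t"
  by (cases t) (simp add: cq_scale_def)

lemma of_real_quat: "of_real r = Quat r 0 0 0"
  by (simp add: of_real_def scaleR_quat_def one_quat_def)

lemma of_real_commute_quat: "(p :: quat) * of_real r = of_real r * p"
  by (simp add: of_real_quat times_quat_def)

lemma imag_units_iff: "v \<in> imag_units \<longleftrightarrow> q0 v = 0 \<and> (q1 v)\<^sup>2 + (q2 v)\<^sup>2 + (q3 v)\<^sup>2 = 1"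
proof
  assume "v \<in> imag_units"
  then have "v * v = -1" by (simp add: imag_units_def power2_eq_square)
  then have *: "q0 v * q0 v - q1 v * q1 v - q2 v * q2 v - q3 v * q3 v = -1"
      "q0 v * q1 v = 0" "q0 v * q2 v = 0" "q0 v * q3 v = 0"
    by (auto simp: quat_eq_iff times_quat_def uminus_quat_def one_quat_def mult.commute)
  have "q0 v = 0"
  proof (rule ccontr)
    assume "q0 v \<noteq> 0"
    then have "q0 v * q0 v = -1" using * by simp
    then show False using zero_le_square[of "q0 v"] by linarith
  qed
  then show "q0 v = 0 \<and> (q1 v)\<^sup>2 + (q2 v)\<^sup>2 + (q3 v)\<^sup>2 = 1" using * by (simp add: power2_eq_square)
next
  assume "q0 v = 0 \<and> (q1 v)\<^sup>2 + (q2 v)\<^sup>2 + (q3 v)\<^sup>2 = 1"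
  then show "v \<in> imag_units"
    by (simp add: imag_units_def power2_eq_square quat_eq_iff times_quat_def uminus_quat_def one_quat_def)
qed

lemma imag_unit_square: "v \<in> imag_units \<Longrightarrow> v * v = -1"
  by (simp add: imag_units_def power2_eq_square)

lemma imag_unit_square_left: "v \<in> imag_units \<Longrightarrow> v * (v * q) = - q"
  by (simp add: imag_unit_square flip: mult.assoc)

lemma uminus_imag_unit [simp]: "- v \<in> imag_units \<longleftrightarrow> v \<in> imag_units"
  by (simp add: imag_units_def)

lemma imag_units_nonempty: "Quat 0 1 0 0 \<in> imag_units"
  by (simp add: imag_units_iff)

lemma quat_norm_mult: "norm (p * q) = norm p * norm (q :: quat)"
  unfolding norm_quat_def real_sqrt_mult[symmetric]
  by (rule arg_cong[of _ _ sqrt]) (simp add: times_quat_def, algebra)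

lemma quat_mult_eq_0_iff: "p * q = 0 \<longleftrightarrow> p = 0 \<or> q = (0 :: quat)"
  using quat_norm_mult[of p q] by (metis mult_eq_0_iff norm_eq_zero)

text \<open>The values at \<open>v\<close> and \<open>-v\<close> already determine both parts.\<close>

lemma slice_value_eqD:
  assumes "\<And>v. v \<in> imag_units \<Longrightarrow> slice_value v s = slice_value v t"
  shows "s = t"
proof -
  let ?v = "Quat 0 1 0 0"
  have 1: "re_part s + ?v * im_part s = re_part t + ?v * im_part t"
    and 2: "re_part s - ?v * im_part s = re_part t - ?v * im_part t"
    using assms[of ?v] assms[of "- ?v"] imag_units_nonempty by (auto simp: slice_value_def)
  have "2 *\<^sub>R re_part s = (re_part s + ?v * im_part s) + (re_part s - ?v * im_part s)"
    by (simp add: scaleR_2)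
  also have "\<dots> = 2 *\<^sub>R re_part t" unfolding 1 2 by (simp add: scaleR_2)
  finally have re: "re_part s = re_part t" by simp
  with 1 have "?v * (im_part s - im_part t) = 0" by (simp add: right_diff_distrib)
  then have "im_part s = im_part t"
    by (auto simp: quat_mult_eq_0_iff) (simp add: zero_quat_def)
  with re show ?thesis by (simp add: cquat_eq_iff)
qed

text \<open>Two zeros on one sphere force \<open>(u - v) * im_part t = 0\<close>, and quaternions have no zero divisors.\<close>

lemma slice_value_inj:
  assumes "slice_value v t = 0" "slice_value u t = 0" "t \<noteq> (0, 0, 0, 0)"
  shows "u = v"
proof -
  have "(u - v) * im_part t = 0"
    using assms by (simp add: slice_value_def left_diff_distrib add_eq_0_iff)
  then consider "u = v" | "im_part t = 0" by (auto simp: quat_mult_eq_0_iff)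
  then show ?thesis
  proof cases
    case 2
    then have "re_part t = 0" using assms by (simp add: slice_value_def)
    with 2 have "t = (0, 0, 0, 0)"
      by (simp add: cquat_eq_iff) (simp add: re_part_def im_part_def zero_quat_def)
    with assms show ?thesis by simp
  qed
qed

text \<open>For \<open>t = a + \<i> b\<close> one has \<open>Phi t = |a|\<^sup>2 - |b|\<^sup>2 + 2 \<i> \<langle>a, b\<rangle>\<close>. When this vanishes and \<open>b \<noteq> 0\<close>,
  the solution \<open>v\<close> of \<open>a + v b = 0\<close> has norm one and real part zero, so it is an imaginary unit.\<close>

lemma Phi_eq_0_iff: "Phi t = 0 \<longleftrightarrow> (\<exists>v\<in>imag_units. slice_value v t = 0)"
proof
  obtain a b where ab: "re_part t = a" "im_part t = b" by blast
  have Phi: "Phi t = Complex ((q0 a)\<^sup>2 + (q1 a)\<^sup>2 + (q2 a)\<^sup>2 + (q3 a)\<^sup>2 - ((q0 b)\<^sup>2 + (q1 b)\<^sup>2 + (q2 b)\<^sup>2 + (q3 b)\<^sup>2))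
      (2 * (q0 a * q0 b + q1 a * q1 b + q2 a * q2 b + q3 a * q3 b))"
    unfolding ab[symmetric]
    by (cases t) (simp add: Phi_def re_part_def im_part_def complex_eq_iff power2_eq_square)
  {
    assume "Phi t = 0"
    then have n: "(q0 a)\<^sup>2 + (q1 a)\<^sup>2 + (q2 a)\<^sup>2 + (q3 a)\<^sup>2 = (q0 b)\<^sup>2 + (q1 b)\<^sup>2 + (q2 b)\<^sup>2 + (q3 b)\<^sup>2"
      and o: "q0 a * q0 b + q1 a * q1 b + q2 a * q2 b + q3 a * q3 b = 0"
      unfolding Phi by (simp_all add: complex_eq_iff)
    show "\<exists>v\<in>imag_units. slice_value v t = 0"
    proof (cases "b = 0")
      case True
      with n have "norm a = 0" by (simp add: norm_quat_def zero_quat_def)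
      then show ?thesis using True imag_units_nonempty by (auto simp: slice_value_def ab)
    next
      case False
      define N where "N = (q0 b)\<^sup>2 + (q1 b)\<^sup>2 + (q2 b)\<^sup>2 + (q3 b)\<^sup>2"
      define bc where "bc = Quat (q0 b) (- q1 b) (- q2 b) (- q3 b)"
      define v where "v = - (1 / N) *\<^sub>R (a * bc)"
      have "norm b \<noteq> 0" using False by simp
      then have N: "N \<noteq> 0" by (simp add: norm_quat_def N_def)
      have bcb: "bc * b = of_real N"
        by (simp add: bc_def N_def of_real_quat times_quat_def power2_eq_square)
      have "v * b = - (1 / N) *\<^sub>R (a * (bc * b))" by (simp add: v_def mult.assoc)
      also have "\<dots> = - a" unfolding bcb using N by (simp add: of_real_commute_quat of_real_def)
      finally have vb: "v * b = - a" .
      have "(q0 a)\<^sup>2 + (q1 a)\<^sup>2 + (q2 a)\<^sup>2 + (q3 a)\<^sup>2 = N" using n by (simp add: N_def)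
      then have na: "(norm a)\<^sup>2 = N" by (simp add: norm_quat_def N_def)
      have nbc: "(norm bc)\<^sup>2 = N" by (simp add: norm_quat_def bc_def N_def)
      have "q0 (a * bc) = 0" using o by (simp add: times_quat_def bc_def algebra_simps)
      then have q0v: "q0 v = 0" by (simp add: v_def scaleR_quat_def uminus_quat_def)
      have "(norm v)\<^sup>2 = (1 / N)\<^sup>2 * ((norm a)\<^sup>2 * (norm bc)\<^sup>2)"
        by (simp add: v_def quat_norm_mult power_mult_distrib power_divide)
      also have "\<dots> = 1" unfolding na nbc using N by (simp add: power2_eq_square)
      finally have "v \<in> imag_units" using q0v by (simp add: imag_units_iff norm_quat_def)
      then show ?thesis using vb by (intro bexI[of _ v]) (simp_all add: slice_value_def ab)
    qed
  next
    assume "\<exists>v\<in>imag_units. slice_value v t = 0"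
    then obtain v where v: "v \<in> imag_units" and "a + v * b = 0" by (auto simp: slice_value_def ab)
    then have a: "a = - (v * b)" by (simp add: add_eq_0_iff2)
    have "(norm a)\<^sup>2 = (norm v)\<^sup>2 * (norm b)\<^sup>2" unfolding a by (simp add: quat_norm_mult power_mult_distrib)
    moreover have "(norm v)\<^sup>2 = 1" using v by (simp add: imag_units_iff norm_quat_def)
    ultimately have "(q0 a)\<^sup>2 + (q1 a)\<^sup>2 + (q2 a)\<^sup>2 + (q3 a)\<^sup>2 = (q0 b)\<^sup>2 + (q1 b)\<^sup>2 + (q2 b)\<^sup>2 + (q3 b)\<^sup>2"
      by (simp add: norm_quat_def)
    moreover have "q0 a * q0 b + q1 a * q1 b + q2 a * q2 b + q3 a * q3 b = 0"
      using v unfolding a imag_units_iff by (simp add: times_quat_def uminus_quat_def algebra_simps)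
    ultimately show "Phi t = 0" unfolding Phi by (simp add: complex_eq_iff)
  }
qed

lemma slice_value_scale:
  assumes "v \<in> imag_units"
  shows "slice_value v (cq_scale c t) = slice_point c v * slice_value v t"
  by (simp add: slice_value_def slice_point_def parts_scale of_real_def ring_distribs mult.assoc
      imag_unit_square_left[OF assms] scaleR_right_distrib scaleR_right_diff_distrib)

lemma slice_value_complex: "slice_value v (c, 0, 0, 0) = slice_point c v"
  by (simp add: slice_value_def slice_point_def re_part_def im_part_def of_real_quat)

lemma slice_point_mult:
  assumes "v \<in> imag_units"
  shows "slice_point (a * b) v = slice_point a v * slice_point b v"
  using slice_value_scale[OF assms, of a "(b, 0, 0, 0)"]
  by (simp add: cq_scale_def slice_value_complex)

lemma slice_point_add: "slice_point (a + b) v = slice_point a v + slice_point b v"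
  by (simp add: slice_point_def algebra_simps)

lemma slice_point_of_real [simp]: "slice_point (of_real r) v = of_real r"
  by (simp add: slice_point_def)

lemma slice_point_diff: "slice_point (a - b) v = slice_point a v - slice_point b v"
  by (simp add: slice_point_def algebra_simps)

lemma slice_point_power:
  assumes "v \<in> imag_units"
  shows "slice_point (a ^ n) v = slice_point a v ^ n"
  using slice_point_of_real[of 1 v] by (induction n) (simp_all add: slice_point_mult[OF assms])

lemma slice_point_coords:
  assumes "v \<in> imag_units"
  shows "slice_point z v = Quat (Re z) (q1 v * Im z) (q2 v * Im z) (q3 v * Im z)"
  using assms by (simp add: slice_point_def imag_units_iff quat_eq_iff of_real_quat quat_arith_defs)

text \<open>A quaternion has exactly two representations \<open>x + v y\<close>, or one for each imaginary unit if it is real.\<close>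

lemma slice_point_eqD:
  assumes "v \<in> imag_units" "u \<in> imag_units" "slice_point z v = slice_point w u"
  shows "w = z \<and> (Im z \<noteq> 0 \<longrightarrow> u = v) \<or> w = cnj z \<and> (Im z \<noteq> 0 \<longrightarrow> u = - v)"
proof -
  have e: "Re z = Re w" "q1 v * Im z = q1 u * Im w" "q2 v * Im z = q2 u * Im w" "q3 v * Im z = q3 u * Im w"
    using assms by (simp_all add: slice_point_coords)
  have "(Im z)\<^sup>2 = ((q1 v)\<^sup>2 + (q2 v)\<^sup>2 + (q3 v)\<^sup>2) * (Im z)\<^sup>2" using assms by (simp add: imag_units_iff)
  also have "\<dots> = (q1 v * Im z)\<^sup>2 + (q2 v * Im z)\<^sup>2 + (q3 v * Im z)\<^sup>2" by algebra
  also have "\<dots> = ((q1 u)\<^sup>2 + (q2 u)\<^sup>2 + (q3 u)\<^sup>2) * (Im w)\<^sup>2" unfolding e by algebra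
  also have "\<dots> = (Im w)\<^sup>2" using assms by (simp add: imag_units_iff)
  finally consider "Im w = Im z" | "Im w = - Im z" by (auto simp: power2_eq_iff)
  then show ?thesis
  proof cases
    case 1
    then show ?thesis
      using e assms by (auto simp: complex_eq_iff quat_eq_iff imag_units_iff)
  next
    case 2
    then have "(q1 v + q1 u) * Im z = 0" "(q2 v + q2 u) * Im z = 0" "(q3 v + q3 u) * Im z = 0"
      using e by (simp_all add: distrib_right)
    then show ?thesis
      using 2 e(1) assms by (auto simp: complex_eq_iff quat_eq_iff imag_units_iff uminus_quat_def)
  qed
qed

section \<open>Stem functions\<close>

text \<open>Stem functions are handled one coordinate at a time; quantifying over the projections avoids
  repeating each argument four times.\<close>

definition coords :: "(cquat \<Rightarrow> complex) set" where
  "coords = {fst, fst \<circ> snd, fst \<circ> snd \<circ> snd, snd \<circ> snd \<circ> snd}"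

lemma coords_mem [simp]:
  "fst \<in> coords" "fst \<circ> snd \<in> coords" "fst \<circ> snd \<circ> snd \<in> coords" "snd \<circ> snd \<circ> snd \<in> coords"
  by (auto simp: coords_def)

lemma coords_eqI:
  assumes "\<And>k. k \<in> coords \<Longrightarrow> k s = k t"
  shows "s = t"
  using assms[of fst] assms[of "fst \<circ> snd"] assms[of "fst \<circ> snd \<circ> snd"] assms[of "snd \<circ> snd \<circ> snd"]
  by (simp add: prod_eq_iff)

lemma coords_scale: "k \<in> coords \<Longrightarrow> k (cq_scale c t) = c * k t"
  by (cases t) (auto simp: coords_def cq_scale_def)

lemma coords_zero: "k \<in> coords \<Longrightarrow> k (0, 0, 0, 0) = 0"
  by (auto simp: coords_def)

definition holomorphic_stem :: "complex set \<Rightarrow> (complex \<Rightarrow> cquat) \<Rightarrow> bool" where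
  "holomorphic_stem V F \<longleftrightarrow>
     (\<forall>k\<in>coords. (\<lambda>z. k (F z)) holomorphic_on V \<and> (\<forall>z\<in>V. k (F (cnj z)) = cnj (k (F z))))"

lemma holomorphic_stemD:
  assumes "holomorphic_stem V F" "k \<in> coords"
  shows "(\<lambda>z. k (F z)) holomorphic_on V" and "z \<in> V \<Longrightarrow> k (F (cnj z)) = cnj (k (F z))"
  using assms by (auto simp: holomorphic_stem_def)

lemma holomorphic_stem_tuple:
  "holomorphic_stem V (\<lambda>z. (f0 z, f1 z, f2 z, f3 z)) \<longleftrightarrow>
     (\<forall>f\<in>{f0, f1, f2, f3}. f holomorphic_on V \<and> (\<forall>z\<in>V. f (cnj z) = cnj (f z)))"
  by (auto simp: holomorphic_stem_def coords_def)

lemma holomorphic_stem_choice: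
  assumes "\<And>k. k \<in> coords \<Longrightarrow> \<exists>g. g holomorphic_on V \<and> (\<forall>z\<in>V. g (cnj z) = cnj (g z)) \<and> P k g"
  obtains G where "holomorphic_stem V G" and "\<forall>k\<in>coords. P k (\<lambda>z. k (G z))"
proof -
  have "\<forall>k\<in>coords. \<exists>g. g holomorphic_on V \<and> (\<forall>z\<in>V. g (cnj z) = cnj (g z)) \<and> P k g"
    using assms by blast
  from bchoice[OF this] obtain g where g: "\<forall>k\<in>coords. g k holomorphic_on V \<and>
      (\<forall>z\<in>V. g k (cnj z) = cnj (g k z)) \<and> P k (g k)" ..
  define G where "G = (\<lambda>z. (g fst z, g (fst \<circ> snd) z, g (fst \<circ> snd \<circ> snd) z, g (snd \<circ> snd \<circ> snd) z))"
  have kG: "k (G z) = g k z" if "k \<in> coords" for k z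
    using that by (auto simp: coords_def G_def)
  then have "(\<lambda>z. k (G z)) = g k" if "k \<in> coords" for k using that by (simp add: fun_eq_iff)
  then show thesis using g by (intro that[of G]) (simp_all add: holomorphic_stem_def kG)
qed

lemma holomorphic_stem_times:
  assumes "holomorphic_stem V F" "holomorphic_stem V G"
  shows "holomorphic_stem V (\<lambda>z. cq_times (F z) (G z))"
proof -
  have F: "k \<in> coords \<Longrightarrow> (\<lambda>z. k (F z)) holomorphic_on V" "k \<in> coords \<Longrightarrow> z \<in> V \<Longrightarrow> k (F (cnj z)) = cnj (k (F z))" for k z
    using assms(1) by (auto simp: holomorphic_stem_def)
  have G: "k \<in> coords \<Longrightarrow> (\<lambda>z. k (G z)) holomorphic_on V" "k \<in> coords \<Longrightarrow> z \<in> V \<Longrightarrow> k (G (cnj z)) = cnj (k (G z))" for k z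
    using assms(2) by (auto simp: holomorphic_stem_def)
  have c: "fst \<in> coords" "fst \<circ> snd \<in> coords" "fst \<circ> snd \<circ> snd \<in> coords" "snd \<circ> snd \<circ> snd \<in> coords"
    by (auto simp: coords_def)
  show ?thesis
    using F(1)[OF c(1)] F(1)[OF c(2)] F(1)[OF c(3)] F(1)[OF c(4)] G(1)[OF c(1)] G(1)[OF c(2)] G(1)[OF c(3)] G(1)[OF c(4)]
      F(2)[OF c(1)] F(2)[OF c(2)] F(2)[OF c(3)] F(2)[OF c(4)] G(2)[OF c(1)] G(2)[OF c(2)] G(2)[OF c(3)] G(2)[OF c(4)]
    unfolding cq_times_def case_prod_unfold holomorphic_stem_tuple
    by (auto intro!: holomorphic_intros)
qed

lemma holomorphic_stem_scale:
  assumes "p holomorphic_on V" "\<And>z. z \<in> V \<Longrightarrow> p (cnj z) = cnj (p z)" "holomorphic_stem V F"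
  shows "holomorphic_stem V (\<lambda>z. cq_scale (p z) (F z))"
  using assms by (auto simp: holomorphic_stem_def coords_scale intro!: holomorphic_intros)

lemma holomorphic_Phi:
  assumes "holomorphic_stem V F"
  shows "(\<lambda>z. Phi (F z)) holomorphic_on V"
proof -
  have F: "k \<in> coords \<Longrightarrow> (\<lambda>z. k (F z)) holomorphic_on V" for k
    using assms by (auto simp: holomorphic_stem_def)
  have c: "fst \<in> coords" "fst \<circ> snd \<in> coords" "fst \<circ> snd \<circ> snd \<in> coords" "snd \<circ> snd \<circ> snd \<in> coords"
    by (auto simp: coords_def)
  show ?thesis
    using F[OF c(1)] F[OF c(2)] F[OF c(3)] F[OF c(4)]
    unfolding Phi_def case_prod_unfold by (auto intro!: holomorphic_intros)
qed

lemma holomorphic_stem_subset: "holomorphic_stem V F \<Longrightarrow> W \<subseteq> V \<Longrightarrow> holomorphic_stem W F"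
  by (auto simp: holomorphic_stem_def intro: holomorphic_on_subset)

lemma holomorphic_stem_parts_cnj:
  assumes "holomorphic_stem V F" "z \<in> V"
  shows "re_part (F (cnj z)) = re_part (F z)" "im_part (F (cnj z)) = - im_part (F z)"
  using assms by (auto simp: holomorphic_stem_def coords_def re_part_def im_part_def case_prod_unfold
      quat_eq_iff uminus_quat_def)

lemma holomorphic_stem_real:
  assumes "holomorphic_stem V F" "of_real x \<in> V"
  shows "im_part (F (of_real x)) = 0"
  using holomorphic_stem_parts_cnj(2)[OF assms] by (simp add: quat_eq_iff uminus_quat_def zero_quat_def)

text \<open>\<open>F\<close> is the holomorphic map associated with \<open>f\<close>. The quaternionic pair \<open>\<alpha>\<close>, \<open>\<beta>\<close> of the definition of
  slice regularity is recovered as its two parts.\<close>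

definition slice_rep :: "complex set \<Rightarrow> (quat \<Rightarrow> quat) \<Rightarrow> (complex \<Rightarrow> cquat) \<Rightarrow> bool" where
  "slice_rep V f F \<longleftrightarrow> holomorphic_stem V F \<and>
     (\<forall>z\<in>V. \<forall>v\<in>imag_units. f (slice_point z v) = slice_value v (F z))"

lemma bounded_linear_quat_coords:
  "bounded_linear q0" "bounded_linear q1" "bounded_linear q2" "bounded_linear q3"
  by (rule bounded_linear_intro[where K = 1];
      auto simp: plus_quat_def scaleR_quat_def norm_quat_def intro!: real_le_rsqrt)+

text \<open>Under the Cauchy--Riemann equations the real differential is multiplication by a complex number.\<close>

lemma Cauchy_Riemann_field_differentiable:
  assumes L: "bounded_linear (L :: quat \<Rightarrow> real)"
    and A: "(\<alpha> has_derivative A) (at z)" and B: "(\<beta> has_derivative B) (at z)"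
    and CR: "A 1 = B \<i>" "A \<i> = - B 1"
  shows "(\<lambda>z. Complex (L (\<alpha> z)) (L (\<beta> z))) field_differentiable (at z)"
proof -
  define c where "c = Complex (L (A 1)) (L (B 1))"
  have lin: "linear A" "linear B" "linear L"
    using A B L by (auto dest: has_derivative_linear bounded_linear.linear)
  have h: "h = Re h *\<^sub>R 1 + Im h *\<^sub>R \<i>" for h :: complex by (simp add: complex_eq_iff)
  have Th: "T h = Re h *\<^sub>R T 1 + Im h *\<^sub>R T \<i>" if "linear T" for T :: "complex \<Rightarrow> quat" and h
    using arg_cong[OF h[of h], of T] by (simp only: linear_add[OF that] linear_scale[OF that])
  have Ah: "L (A h) = Re h * L (A 1) - Im h * L (B 1)" and Bh: "L (B h) = Re h * L (B 1) + Im h * L (A 1)" for h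
    unfolding Th[OF lin(1), of h] Th[OF lin(2), of h] CR
    by (simp_all add: linear_add[OF lin(3)] linear_scale[OF lin(3)] linear_neg[OF lin(3)] linear_diff[OF lin(3)])
  note dA = has_derivative_of_real[OF bounded_linear.has_derivative[OF L A], where 'a = complex]
  note dB = has_derivative_of_real[OF bounded_linear.has_derivative[OF L B], where 'a = complex]
  have "((\<lambda>z. of_real (L (\<alpha> z)) + \<i> * of_real (L (\<beta> z)) :: complex) has_derivative
          (\<lambda>h. of_real (L (A h)) + \<i> * of_real (L (B h)))) (at z)"
    by (rule has_derivative_add[OF dA has_derivative_mult_right[OF dB]])
  moreover have "of_real (L (A h)) + \<i> * of_real (L (B h)) = c * h" for h
    unfolding Ah[of h] Bh[of h] c_def by (simp add: complex_eq_iff)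
  ultimately have "((\<lambda>z. Complex (L (\<alpha> z)) (L (\<beta> z))) has_field_derivative c) (at z)"
    unfolding has_field_derivative_def by (simp add: Complex_eq)
  then show ?thesis unfolding field_differentiable_def by blast
qed

lemma re_part_basis: "re_part t = Re (fst t) *\<^sub>R Quat 1 0 0 0 + Re ((fst \<circ> snd) t) *\<^sub>R Quat 0 1 0 0
      + Re ((fst \<circ> snd \<circ> snd) t) *\<^sub>R Quat 0 0 1 0 + Re ((snd \<circ> snd \<circ> snd) t) *\<^sub>R Quat 0 0 0 1"
  by (cases t) (simp add: re_part_def plus_quat_def scaleR_quat_def)

lemma im_part_basis: "im_part t = Im (fst t) *\<^sub>R Quat 1 0 0 0 + Im ((fst \<circ> snd) t) *\<^sub>R Quat 0 1 0 0
      + Im ((fst \<circ> snd \<circ> snd) t) *\<^sub>R Quat 0 0 1 0 + Im ((snd \<circ> snd \<circ> snd) t) *\<^sub>R Quat 0 0 0 1"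
  by (cases t) (simp add: im_part_def plus_quat_def scaleR_quat_def)

text \<open>The Cauchy--Riemann equations for \<open>\<alpha>\<close> and \<open>\<beta>\<close> are those of the four complex coordinates of
  \<open>\<alpha> + \<i> \<beta>\<close>, and the parities of \<open>\<alpha>\<close> and \<open>\<beta>\<close> in \<open>y\<close> are the symmetry of the coordinates.\<close>

lemma slice_regular_with_iff:
  assumes V: "open V"
  shows "slice_regular_with V f (\<lambda>z. re_part (F z)) (\<lambda>z. im_part (F z)) \<longleftrightarrow> slice_rep V f F"
proof
  assume R: "slice_regular_with V f (\<lambda>z. re_part (F z)) (\<lambda>z. im_part (F z))"
  have co: "k (F z) = Complex (L (re_part (F z))) (L (im_part (F z)))"
    if "(k, L) \<in> {(fst, q0), (fst \<circ> snd, q1), (fst \<circ> snd \<circ> snd, q2), (snd \<circ> snd \<circ> snd, q3)}" for k L z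
    using that by (auto simp: re_part_def im_part_def case_prod_unfold)
  have "(\<lambda>z. k (F z)) holomorphic_on V \<and> (\<forall>z\<in>V. k (F (cnj z)) = cnj (k (F z)))"
    if kL: "(k, L) \<in> {(fst, q0), (fst \<circ> snd, q1), (fst \<circ> snd \<circ> snd, q2), (snd \<circ> snd \<circ> snd, q3)}" for k L
  proof
    have L: "bounded_linear L" using kL bounded_linear_quat_coords by auto
    show "(\<lambda>z. k (F z)) holomorphic_on V"
      unfolding co[OF kL] holomorphic_on_def
    proof
      fix z assume "z \<in> V"
      then obtain A B where "((\<lambda>z. re_part (F z)) has_derivative A) (at z)"
          "((\<lambda>z. im_part (F z)) has_derivative B) (at z)" "A 1 = B \<i>" "A \<i> = - B 1"
        using R unfolding slice_regular_with_def by blast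
      from Cauchy_Riemann_field_differentiable[OF L this]
      show "(\<lambda>z. Complex (L (re_part (F z))) (L (im_part (F z)))) field_differentiable at z within V"
        by (rule field_differentiable_at_within)
    qed
    show "\<forall>z\<in>V. k (F (cnj z)) = cnj (k (F z))"
      unfolding co[OF kL] using R linear_neg[OF bounded_linear.linear[OF L]]
      unfolding slice_regular_with_def by (simp add: complex_eq_iff)
  qed
  then have "holomorphic_stem V F" unfolding holomorphic_stem_def coords_def by blast
  with R show "slice_rep V f F"
    unfolding slice_rep_def slice_regular_with_def slice_value_def by blast
next
  assume R: "slice_rep V f F"
  then have H: "holomorphic_stem V F" by (simp add: slice_rep_def)
  have "\<exists>A B. ((\<lambda>z. re_part (F z)) has_derivative A) (at z) \<and> ((\<lambda>z. im_part (F z)) has_derivative B) (at z) \<and>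
              A 1 = B \<i> \<and> A \<i> = - B 1" if z: "z \<in> V" for z
  proof -
    have "\<exists>c. ((\<lambda>z. k (F z)) has_field_derivative c) (at z)" if "k \<in> coords" for k
      using holomorphic_stemD(1)[OF H that] z V
      by (meson field_differentiable_def holomorphic_on_imp_differentiable_at)
    then obtain c where "\<And>k. k \<in> coords \<Longrightarrow> ((\<lambda>z. k (F z)) has_field_derivative c k) (at z)"
      by metis
    then have c: "((\<lambda>z. k (F z)) has_derivative (\<lambda>h. c k * h)) (at z)" if "k \<in> coords" for k
      using that by (simp add: has_field_derivative_def)
    have Re': "((\<lambda>z. Re (k (F z))) has_derivative (\<lambda>h. Re (c k * h))) (at z)"
      and Im': "((\<lambda>z. Im (k (F z))) has_derivative (\<lambda>h. Im (c k * h))) (at z)" if "k \<in> coords" for k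
      using bounded_linear.has_derivative[OF bounded_linear_Re c[OF that]]
        bounded_linear.has_derivative[OF bounded_linear_Im c[OF that]] by auto
    let ?D = "\<lambda>T h. T (c fst * h) *\<^sub>R Quat 1 0 0 0 + T (c (fst \<circ> snd) * h) *\<^sub>R Quat 0 1 0 0
      + T (c (fst \<circ> snd \<circ> snd) * h) *\<^sub>R Quat 0 0 1 0 + T (c (snd \<circ> snd \<circ> snd) * h) *\<^sub>R Quat 0 0 0 1 :: quat"
    have m: "fst \<in> coords" "fst \<circ> snd \<in> coords" "fst \<circ> snd \<circ> snd \<in> coords" "snd \<circ> snd \<circ> snd \<in> coords"
      by (auto simp: coords_def)
    have "((\<lambda>z. re_part (F z)) has_derivative ?D Re) (at z)"
      unfolding re_part_basis
      by (intro has_derivative_add has_derivative_scaleR_left Re' m)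
    moreover have "((\<lambda>z. im_part (F z)) has_derivative ?D Im) (at z)"
      unfolding im_part_basis
      by (intro has_derivative_add has_derivative_scaleR_left Im' m)
    moreover have "?D Re 1 = ?D Im \<i>" by simp
    moreover have "?D Re \<i> = - ?D Im 1" by (simp add: quat_eq_iff quat_arith_defs)
    ultimately show ?thesis by blast
  qed
  with R holomorphic_stem_parts_cnj[OF H]
  show "slice_regular_with V f (\<lambda>z. re_part (F z)) (\<lambda>z. im_part (F z))"
    unfolding slice_rep_def slice_regular_with_def slice_value_def by blast
qed

lemma slice_regular_with_imp_rep:
  assumes "open V" "slice_regular_with V f \<alpha> \<beta>"
  shows "slice_rep V f (assoc_map \<alpha> \<beta>)"
  using assms slice_regular_with_iff[OF assms(1), of f "assoc_map \<alpha> \<beta>"] by (simp add: parts_assoc_map)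

lemma slice_regular_iff_rep:
  assumes "open V"
  shows "slice_regular V f \<longleftrightarrow> (\<exists>F. slice_rep V f F)"
  using slice_regular_with_imp_rep[OF assms] slice_regular_with_iff[OF assms]
  unfolding slice_regular_def by metis

lemma is_star_product_iff_rep:
  assumes V: "open V"
  shows "is_star_product V f g h \<longleftrightarrow>
    (\<exists>F G. slice_rep V f F \<and> slice_rep V g G \<and> slice_rep V h (\<lambda>z. cq_times (F z) (G z)))"
proof
  assume "is_star_product V f g h"
  then obtain \<alpha> \<beta> \<gamma> \<delta> where *: "slice_regular_with V f \<alpha> \<beta>" "slice_regular_with V g \<gamma> \<delta>"
    "slice_regular_with V h (\<lambda>z. \<alpha> z * \<gamma> z - \<beta> z * \<delta> z) (\<lambda>z. \<alpha> z * \<delta> z + \<beta> z * \<gamma> z)"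
    unfolding is_star_product_def by blast
  have "assoc_map (\<lambda>z. \<alpha> z * \<gamma> z - \<beta> z * \<delta> z) (\<lambda>z. \<alpha> z * \<delta> z + \<beta> z * \<gamma> z) =
        (\<lambda>z. cq_times (assoc_map \<alpha> \<beta> z) (assoc_map \<gamma> \<delta> z))"
    by (rule ext) (simp add: cquat_eq_iff parts_times parts_assoc_map)
  then show "\<exists>F G. slice_rep V f F \<and> slice_rep V g G \<and> slice_rep V h (\<lambda>z. cq_times (F z) (G z))"
    using *[THEN slice_regular_with_imp_rep[OF V]] by auto
next
  assume "\<exists>F G. slice_rep V f F \<and> slice_rep V g G \<and> slice_rep V h (\<lambda>z. cq_times (F z) (G z))"
  then show "is_star_product V f g h"
    unfolding is_star_product_def slice_regular_with_iff[OF V, symmetric] parts_times by blast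
qed

lemma slice_rep_unique:
  assumes "slice_rep V f F" "slice_rep V f G" "z \<in> V"
  shows "F z = G z"
  using assms by (intro slice_value_eqD) (auto simp: slice_rep_def)

text \<open>The two representations of a non-real quaternion by \<open>(z, v)\<close> and \<open>(cnj z, -v)\<close> give the same value
  because of the symmetry of \<open>F\<close>, and at real points the part multiplied by \<open>v\<close> vanishes.\<close>

lemma slice_rep_exists:
  assumes H: "holomorphic_stem V F"
  shows "\<exists>f. slice_rep V f F"
proof -
  define f where "f = (\<lambda>q. SOME r. \<exists>z\<in>V. \<exists>v\<in>imag_units. q = slice_point z v \<and> r = slice_value v (F z))"
  have "f (slice_point z v) = slice_value v (F z)" if z: "z \<in> V" and v: "v \<in> imag_units" for z v
    unfolding f_def
  proof (rule some_equality)
    show "\<exists>w\<in>V. \<exists>u\<in>imag_units. slice_point z v = slice_point w u \<and> slice_value v (F z) = slice_value u (F w)"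
      using z v by blast
    fix r assume "\<exists>w\<in>V. \<exists>u\<in>imag_units. slice_point z v = slice_point w u \<and> r = slice_value u (F w)"
    then obtain w u where w: "w \<in> V" "u \<in> imag_units" "slice_point z v = slice_point w u" "r = slice_value u (F w)"
      by blast
    have real: "im_part (F z) = 0" if "Im z = 0"
      using holomorphic_stem_real[OF H, of "Re z"] z that by (simp add: complex_is_Real_iff )
    show "r = slice_value v (F z)"
      using slice_point_eqD[OF v w(2,3)]
    proof
      assume *: "w = z \<and> (Im z \<noteq> 0 \<longrightarrow> u = v)"
      then show ?thesis using w real by (cases "Im z = 0") (auto simp: slice_value_def)
    next
      assume *: "w = cnj z \<and> (Im z \<noteq> 0 \<longrightarrow> u = - v)"
      then show ?thesis
        using w real holomorphic_stem_parts_cnj[OF H z] by (cases "Im z = 0") (auto simp: slice_value_def)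
    qed
  qed
  with H show ?thesis by (auto simp: slice_rep_def)
qed

lemma slice_rep_cong:
  assumes "slice_rep V f F" "\<And>z. z \<in> V \<Longrightarrow> F z = G z" "\<And>z. z \<in> V \<Longrightarrow> cnj z \<in> V"
  shows "slice_rep V f G"
proof -
  have "(\<lambda>z. k (F z)) holomorphic_on V \<longleftrightarrow> (\<lambda>z. k (G z)) holomorphic_on V" for k :: "cquat \<Rightarrow> complex"
    by (rule holomorphic_cong) (use assms in auto)
  then show ?thesis using assms by (simp add: slice_rep_def holomorphic_stem_def)
qed

lemma slice_rep_subset: "slice_rep V f F \<Longrightarrow> W \<subseteq> V \<Longrightarrow> slice_rep W f F"
  by (auto simp: slice_rep_def intro: holomorphic_stem_subset)

section \<open>Factorization at a zero\<close>

text \<open>The real quadratic polynomial \<open>(w - x)\<^sup>2 + y\<^sup>2\<close> of the sphere of \<open>z0 = x + \<i> y\<close>.\<close>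

definition sphere_poly :: "complex \<Rightarrow> complex \<Rightarrow> complex" where
  "sphere_poly z0 w = (w - z0) * (w - cnj z0)"

lemma sphere_poly_cnj: "sphere_poly z0 (cnj w) = cnj (sphere_poly z0 w)"
  by (simp add: sphere_poly_def mult.commute)

lemma sphere_poly_alt: "sphere_poly z0 w = (w - of_real (Re z0))\<^sup>2 + of_real ((Im z0)\<^sup>2)"
  by (simp add: sphere_poly_def complex_eq_iff power2_eq_square algebra_simps)

lemma sphere_poly_holomorphic: "sphere_poly z0 holomorphic_on V"
  unfolding sphere_poly_def by (intro holomorphic_intros)

lemma sphere_poly_eq_0_iff: "sphere_poly z0 w = 0 \<longleftrightarrow> w = z0 \<or> w = cnj z0"
  by (auto simp: sphere_poly_def)

lemma holomorphic_divide_zero: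
  assumes "f holomorphic_on U" "open U" "f a = 0"
  shows "\<exists>g. g holomorphic_on U \<and> (\<forall>z. f z = (z - a) * g z)"
proof (intro exI conjI allI)
  let ?g = "\<lambda>z. if z = a then deriv f a else (f z - f a) / (z - a)"
  show "?g holomorphic_on U" by (rule pole_lemma_open[OF assms(1,2)])
  show "f z = (z - a) * ?g z" for z using assms(3) by auto
qed

lemma holomorphic_stem_divide:
  assumes U: "open U" "cnj ` U = U"
    and F: "holomorphic_stem U F"
    and p: "\<And>z. z \<in> U \<Longrightarrow> p (cnj z) = cnj (p z)"
    and div: "\<And>k. k \<in> coords \<Longrightarrow> \<exists>g. g holomorphic_on U \<and> (\<forall>z\<in>U. k (F z) = p z * g z)"
  obtains G where "holomorphic_stem U G" and "\<forall>z\<in>U. F z = cq_scale (p z) (G z)"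
proof -
  have cU: "cnj z \<in> U" if "z \<in> U" for z using U(2) that by blast
  have "\<exists>g. g holomorphic_on U \<and> (\<forall>z\<in>U. g (cnj z) = cnj (g z)) \<and> (\<forall>z\<in>U. k (F z) = p z * g z)"
    if k: "k \<in> coords" for k
  proof -
    obtain g where g: "g holomorphic_on U" "\<forall>z\<in>U. k (F z) = p z * g z" using div[OF k] by blast
    \<comment> \<open>averaging with the reflected quotient makes it symmetric without evaluating it at the zeros of \<open>p\<close>\<close>
    define g' where "g' = (\<lambda>z. (g z + cnj (g (cnj z))) / 2)"
    have "cnj \<circ> g \<circ> cnj holomorphic_on U"
      using g(1) U by (intro holomorphic_on_compose_cnj_cnj) auto
    then have "(\<lambda>z. cnj (g (cnj z))) holomorphic_on U" by (simp add: o_def)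
    then have "g' holomorphic_on U" unfolding g'_def by (intro holomorphic_intros g(1)) auto
    moreover have "\<forall>z\<in>U. g' (cnj z) = cnj (g' z)" by (simp add: g'_def add.commute)
    moreover have "k (F z) = p z * g' z" if z: "z \<in> U" for z
    proof -
      have "cnj (k (F z)) = cnj (p z) * g (cnj z)"
        using g(2) cU[OF z] p[OF z] holomorphic_stemD(2)[OF F k z] by metis
      then have "k (F z) = p z * cnj (g (cnj z))" by (metis complex_cnj_cnj complex_cnj_mult)
      with g(2) z show ?thesis by (simp add: g'_def distrib_left)
    qed
    ultimately show ?thesis by blast
  qed
  then obtain G where G: "holomorphic_stem U G" "\<forall>k\<in>coords. \<forall>z\<in>U. k (F z) = p z * k (G z)"
    by (rule holomorphic_stem_choice[where P = "\<lambda>k g. \<forall>z\<in>U. k (F z) = p z * g z"])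
  then have "\<forall>z\<in>U. F z = cq_scale (p z) (G z)"
    by (intro ballI coords_eqI) (simp add: coords_scale)
  with G(1) show thesis by (rule that)
qed

lemma holomorphic_stem_divide_real:
  assumes U: "open U" "cnj ` U = U" and F: "holomorphic_stem U F" and 0: "F (of_real x) = (0, 0, 0, 0)"
  obtains G where "holomorphic_stem U G" and "\<forall>z\<in>U. F z = cq_scale (z - of_real x) (G z)"
proof (rule holomorphic_stem_divide[OF U F, of "\<lambda>z. z - of_real x"])
  fix k assume k: "k \<in> coords"
  have "k (F (of_real x)) = 0" unfolding 0 coords_zero[OF k] ..
  from holomorphic_divide_zero[of "\<lambda>z. k (F z)", OF holomorphic_stemD(1)[OF F k] U(1) this]
  show "\<exists>g. g holomorphic_on U \<and> (\<forall>z\<in>U. k (F z) = (z - of_real x) * g z)" by blast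
qed (use that in auto)

lemma holomorphic_stem_divide_sphere:
  assumes U: "open U" "cnj ` U = U" and F: "holomorphic_stem U F"
    and z0: "z0 \<in> U" "Im z0 \<noteq> 0" and 0: "F z0 = (0, 0, 0, 0)"
  obtains G where "holomorphic_stem U G" and "\<forall>z\<in>U. F z = cq_scale (sphere_poly z0 z) (G z)"
proof (rule holomorphic_stem_divide[OF U F, of "sphere_poly z0"])
  fix k assume k: "k \<in> coords"
  have ne: "cnj z0 \<noteq> z0" using z0 by (simp add: complex_eq_iff)
  have k0: "k (F z0) = 0" unfolding 0 coords_zero[OF k] ..
  obtain g where g: "g holomorphic_on U" "\<forall>z. k (F z) = (z - z0) * g z"
    using holomorphic_divide_zero[of "\<lambda>z. k (F z)", OF holomorphic_stemD(1)[OF F k] U(1) k0] by blast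
  have "k (F (cnj z0)) = 0" using holomorphic_stemD(2)[OF F k z0(1)] k0 by simp
  then have "g (cnj z0) = 0" using g(2)[rule_format, of "cnj z0"] ne by simp
  then obtain g' where g': "g' holomorphic_on U" "\<forall>z. g z = (z - cnj z0) * g' z"
    using holomorphic_divide_zero[OF g(1) U(1)] by blast
  have "\<forall>z\<in>U. k (F z) = sphere_poly z0 z * g' z"
    using g(2) g'(2) by (simp add: sphere_poly_def mult.assoc)
  then show "\<exists>g. g holomorphic_on U \<and> (\<forall>z\<in>U. k (F z) = sphere_poly z0 z * g z)"
    using g'(1) by blast
qed (use that in \<open>auto simp: sphere_poly_cnj\<close>)

text \<open>The factor \<open>(w - z0) ^ k * q w\<close> occurs with \<open>q w\<close> equal to one or to a power of \<open>w - cnj z0\<close>.\<close>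

lemma zorder_mult_power:
  assumes U: "open U" "connected U" "z0 \<in> U" and h1: "h1 holomorphic_on U" "\<exists>w\<in>U. h1 w \<noteq> 0"
    and q: "q holomorphic_on U" "q z0 \<noteq> 0"
    and eq: "\<And>w. w \<in> U \<Longrightarrow> h w = (w - z0) ^ k * q w * h1 w"
  shows "zorder h z0 = zorder h1 z0 + int k"
proof -
  note Z = zorder_exist_zero[OF h1(1) U h1(2)]
  define n where "n = nat (zorder h1 z0)"
  have n: "zorder h1 z0 = int n" using Z by (simp add: n_def split: if_splits)
  from Z obtain r where r: "r > 0" "cball z0 r \<subseteq> U" "zor_poly h1 z0 holomorphic_on cball z0 r"
    "\<forall>w\<in>cball z0 r. h1 w = zor_poly h1 z0 w * (w - z0) ^ n \<and> zor_poly h1 z0 w \<noteq> 0"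
    unfolding n_def by blast
  have sub: "ball z0 r \<subseteq> cball z0 r" by auto
  show ?thesis
  proof (rule zorder_eqI[of "ball z0 r" _ "\<lambda>w. q w * zor_poly h1 z0 w"])
    show "(\<lambda>w. q w * zor_poly h1 z0 w) holomorphic_on ball z0 r"
      using holomorphic_on_subset[OF q(1) order_trans[OF sub r(2)]] holomorphic_on_subset[OF r(3) sub]
      by (intro holomorphic_intros)
    show "q z0 * zor_poly h1 z0 z0 \<noteq> 0" using q(2) r by simp
    show "h w = q w * zor_poly h1 z0 w * (w - z0) powi (zorder h1 z0 + int k)" if w: "w \<in> ball z0 r" for w
    proof -
      have "w \<in> U" "w \<in> cball z0 r" using w sub r(2) by auto
      then show ?thesis
        using eq r(4) unfolding n of_nat_add[symmetric] power_int_of_nat by (simp add: power_add)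
    qed
  qed (use r in auto)
qed

text \<open>Division by \<open>p\<close> stops because each step lowers the order of \<open>Phi \<circ> F\<close> at \<open>z0\<close> by two. The polynomial \<open>p\<close>
  is \<open>w - x\<close> at a real point and \<open>sphere_poly z0\<close> otherwise.\<close>

lemma holomorphic_stem_maximal_power:
  assumes U: "open U" "connected U" "z0 \<in> U"
    and p: "\<And>w. p w = (w - z0) * q w" "q holomorphic_on U" "q z0 \<noteq> 0"
    and div: "\<And>F. holomorphic_stem U F \<Longrightarrow> F z0 = (0, 0, 0, 0) \<Longrightarrow>
                \<exists>G. holomorphic_stem U G \<and> (\<forall>z\<in>U. F z = cq_scale (p z) (G z))"
    and F: "holomorphic_stem U F" "\<exists>w\<in>U. Phi (F w) \<noteq> 0"
  shows "\<exists>m G. holomorphic_stem U G \<and> (\<forall>z\<in>U. F z = cq_scale (p z ^ m) (G z)) \<and> G z0 \<noteq> (0, 0, 0, 0)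
           \<and> (\<exists>w\<in>U. Phi (G w) \<noteq> 0)"
  using F
proof (induction "nat (zorder (\<lambda>w. Phi (F w)) z0)" arbitrary: F rule: less_induct)
  case less
  show ?case
  proof (cases "F z0 = (0, 0, 0, 0)")
    case False
    then show ?thesis using less.prems by (intro exI[of _ 0] exI[of _ F]) simp
  next
    case True
    then obtain G where G: "holomorphic_stem U G" "\<forall>z\<in>U. F z = cq_scale (p z) (G z)"
      using div less.prems(1) by blast
    have PG: "Phi (F w) = (w - z0) ^ 2 * (q w)\<^sup>2 * Phi (G w)" if "w \<in> U" for w
      using G(2) that p(1) by (simp add: Phi_scale power_mult_distrib)
    have nz: "\<exists>w\<in>U. Phi (G w) \<noteq> 0" using less.prems(2) PG by fastforce
    have "zorder (\<lambda>w. Phi (F w)) z0 = zorder (\<lambda>w. Phi (G w)) z0 + int 2"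
      by (rule zorder_mult_power[OF U holomorphic_Phi[OF G(1)] nz _ _ PG])
        (use p in \<open>auto intro!: holomorphic_intros\<close>)
    moreover have "zorder (\<lambda>w. Phi (G w)) z0 \<ge> 0"
      using zorder_exist_zero[OF holomorphic_Phi[OF G(1)] U nz] by (auto split: if_splits)
    ultimately have "nat (zorder (\<lambda>w. Phi (G w)) z0) < nat (zorder (\<lambda>w. Phi (F w)) z0)" by simp
    from less.hyps[OF this G(1) nz] obtain m H where
      H: "holomorphic_stem U H" "\<forall>z\<in>U. G z = cq_scale (p z ^ m) (H z)" "H z0 \<noteq> (0, 0, 0, 0)" "\<exists>w\<in>U. Phi (H w) \<noteq> 0"
      by blast
    have "\<forall>z\<in>U. F z = cq_scale (p z ^ Suc m) (H z)"
      using G(2) H(2) by (simp add: cq_scale_scale)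
    with H show ?thesis by blast
  qed
qed

text \<open>The stem function of \<open>q - p\<close>. Below, \<open>conj_linear_stem p\<close> belongs to \<open>q\<close> minus the quaternionic
  conjugate of \<open>p\<close>; their product is the polynomial of the sphere through \<open>p\<close>.\<close>

definition linear_stem :: "quat \<Rightarrow> complex \<Rightarrow> cquat" where
  "linear_stem p z = (z - of_real (q0 p), - of_real (q1 p), - of_real (q2 p), - of_real (q3 p))"

definition conj_linear_stem :: "quat \<Rightarrow> complex \<Rightarrow> cquat" where
  "conj_linear_stem p z = (z - of_real (q0 p), of_real (q1 p), of_real (q2 p), of_real (q3 p))"

lemma holomorphic_linear_stem: "holomorphic_stem V (linear_stem p)" "holomorphic_stem V (conj_linear_stem p)"
  unfolding linear_stem_def conj_linear_stem_def holomorphic_stem_tuple by (auto intro!: holomorphic_intros)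

lemma linear_stem_parts:
  "re_part (linear_stem p z) = of_real (Re z) - p" "im_part (linear_stem p z) = of_real (Im z)"
  by (simp_all add: linear_stem_def re_part_def im_part_def of_real_quat quat_eq_iff minus_quat_def)

lemma slice_rep_linear: "slice_rep V (\<lambda>q. q - p) (linear_stem p)"
  by (auto simp: slice_rep_def holomorphic_linear_stem slice_value_def linear_stem_parts slice_point_def)

lemma sphere_norm:
  assumes "p \<in> sphere_of z0"
  shows "q0 p = Re z0" "(q1 p)\<^sup>2 + (q2 p)\<^sup>2 + (q3 p)\<^sup>2 = (Im z0)\<^sup>2"
proof -
  obtain v where v: "v \<in> imag_units" "p = slice_point z0 v" using assms by (auto simp: sphere_of_def)
  then have "(q1 p)\<^sup>2 + (q2 p)\<^sup>2 + (q3 p)\<^sup>2 = ((q1 v)\<^sup>2 + (q2 v)\<^sup>2 + (q3 v)\<^sup>2) * (Im z0)\<^sup>2"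
    by (simp add: slice_point_coords power_mult_distrib distrib_right)
  with v show "q0 p = Re z0" "(q1 p)\<^sup>2 + (q2 p)\<^sup>2 + (q3 p)\<^sup>2 = (Im z0)\<^sup>2"
    by (simp_all add: slice_point_coords imag_units_iff)
qed

lemma linear_stem_norm:
  assumes "p \<in> sphere_of z0"
  shows "Phi (linear_stem p w) = sphere_poly z0 w"
    and "cq_times (linear_stem p w) (cq_times (conj_linear_stem p w) t) = cq_scale (sphere_poly z0 w) t"
proof -
  have s: "(of_real (Im z0))\<^sup>2 = (of_real (q1 p))\<^sup>2 + (of_real (q2 p))\<^sup>2 + (of_real (q3 p) :: complex)\<^sup>2"
    using sphere_norm(2)[OF assms] by (metis of_real_add of_real_power)
  have P: "sphere_poly z0 w = (w - of_real (q0 p))\<^sup>2 + ((of_real (q1 p))\<^sup>2 + (of_real (q2 p))\<^sup>2 + (of_real (q3 p))\<^sup>2)"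
    unfolding sphere_poly_alt sphere_norm(1)[OF assms] s[symmetric] by simp
  show "Phi (linear_stem p w) = sphere_poly z0 w"
    unfolding P by (simp add: Phi_def linear_stem_def)
  show "cq_times (linear_stem p w) (cq_times (conj_linear_stem p w) t) = cq_scale (sphere_poly z0 w) t"
    unfolding P by (cases t) (simp add: cq_times_def cq_scale_def linear_stem_def conj_linear_stem_def
      power2_eq_square algebra_simps)
qed

text \<open>Both facts reduce to \<open>v * v = -1\<close>: with \<open>z = x + \<i> y\<close> and \<open>p = x + v y\<close>, the value at \<open>z\<close> of the stem
  function of \<open>q - p\<close> is \<open>y\<close> times \<open>- v + \<i>\<close> and the
  conjugate one is \<open>y\<close> times \<open>v + \<i>\<close>. The first says that \<open>(q - p) \<star> g\<close> vanishes at \<open>p\<close>; the second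
  makes the conjugate factor times \<open>F\<close> divisible when \<open>f\<close> vanishes at \<open>p\<close>.\<close>

lemma linear_stem_zero:
  assumes v: "v \<in> imag_units"
  shows "slice_value v (cq_times (linear_stem (slice_point z v) z) t) = 0"
    and "slice_value v t = 0 \<Longrightarrow> cq_times (conj_linear_stem (slice_point z v) z) t = (0, 0, 0, 0)"
proof -
  have l: "re_part (linear_stem (slice_point z v) z) = - (Im z *\<^sub>R v)"
      "im_part (linear_stem (slice_point z v) z) = Im z *\<^sub>R 1"
    by (simp_all add: linear_stem_parts slice_point_def of_real_def)
  show "slice_value v (cq_times (linear_stem (slice_point z v) z) t) = 0"
    by (simp add: slice_value_def parts_times l distrib_left right_diff_distrib imag_unit_square_left[OF v])
  have c: "re_part (conj_linear_stem (slice_point z v) z) = Im z *\<^sub>R v"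
      "im_part (conj_linear_stem (slice_point z v) z) = Im z *\<^sub>R 1"
    using v by (simp_all add: conj_linear_stem_def re_part_def im_part_def slice_point_coords imag_units_iff
        quat_eq_iff scaleR_quat_def one_quat_def)
  assume "slice_value v t = 0"
  then have a: "re_part t = - (v * im_part t)" by (simp add: slice_value_def add_eq_0_iff2)
  show "cq_times (conj_linear_stem (slice_point z v) z) t = (0, 0, 0, 0)"
    unfolding cquat_eq_iff parts_times c a
    by (simp add: imag_unit_square_left[OF v]) (simp add: re_part_def im_part_def zero_quat_def)
qed

lemma holomorphic_eq_if_eq_off_two_points:
  assumes "open V" "z \<in> V" "f holomorphic_on V" "g holomorphic_on V"
    and "\<And>w. w \<in> V \<Longrightarrow> w \<noteq> z \<Longrightarrow> w \<noteq> z' \<Longrightarrow> f w = g w"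
  shows "f z = g z"
proof -
  have "isCont f z" "isCont g z"
    using assms by (auto intro: holomorphic_on_imp_continuous_on continuous_on_interior simp: interior_open)
  then have lim: "(f \<longlongrightarrow> f z) (at z)" "(g \<longlongrightarrow> g z) (at z)" by (auto simp: isCont_def)
  have "\<forall>\<^sub>F w in at z. w \<in> V \<and> w \<noteq> z \<and> w \<noteq> z'"
    using eventually_at_in_open'[OF assms(1,2)] eventually_neq_at_within[of z' z UNIV] eventually_neq_at_within[of z z UNIV]
    by eventually_elim auto
  then have "\<forall>\<^sub>F w in at z. f w = g w" by eventually_elim (use assms(5) in auto)
  then have "(f \<longlongrightarrow> g z) (at z)" using lim(2) by (simp add: tendsto_cong)
  then show ?thesis using lim(1) tendsto_unique[of "at z"] by auto
qed

text \<open>Off the zeros of \<open>p\<close> the factor cancels pointwise, and at \<open>z\<close> by continuity.\<close>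

lemma cq_scale_cancel:
  assumes V: "open V" "z \<in> V" and F: "holomorphic_stem V F" "holomorphic_stem V G"
    and q: "q holomorphic_on V"
    and p: "\<And>w. w \<noteq> z \<Longrightarrow> w \<noteq> z' \<Longrightarrow> p w \<noteq> 0"
    and eq: "\<And>w. w \<in> V \<Longrightarrow> cq_scale (p w) (F w) = cq_scale (p w * q w) (G w)"
  shows "F z = cq_scale (q z) (G z)"
proof (rule coords_eqI)
  fix k assume k: "k \<in> coords"
  have "k (F z) = q z * k (G z)"
  proof (rule holomorphic_eq_if_eq_off_two_points[OF V, of _ _ z'])
    show "(\<lambda>w. k (F w)) holomorphic_on V" by (rule holomorphic_stemD(1)[OF F(1) k])
    show "(\<lambda>w. q w * k (G w)) holomorphic_on V"
      by (intro holomorphic_intros q holomorphic_stemD(1)[OF F(2) k])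
    show "k (F w) = q w * k (G w)" if w: "w \<in> V" "w \<noteq> z" "w \<noteq> z'" for w
      using arg_cong[OF eq[OF w(1)], of k] p[OF w(2,3)] by (simp add: coords_scale[OF k])
  qed
  then show "k (F z) = k (cq_scale (q z) (G z))" by (simp add: coords_scale[OF k])
qed

text \<open>If \<open>Phi (F z0) = 0\<close> then \<open>f\<close> vanishes at some point \<open>p\<close> of the sphere. Multiplying \<open>F\<close> by the
  conjugate factor of \<open>p\<close> gives a map that vanishes at \<open>z0\<close>, hence is divisible by the polynomial of the
  sphere; the quotient \<open>G\<close> satisfies \<open>F = (q - p) \<star> G\<close>. Its norm has one zero less at \<open>z0\<close>.\<close>

lemma linear_factorization_exists:
  assumes U: "open U" "connected U" "cnj ` U = U" and z0: "z0 \<in> U" "Im z0 \<noteq> 0"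
    and F: "slice_rep U f F" "\<exists>w\<in>U. Phi (F w) \<noteq> 0"
  shows "\<exists>ps g G. set ps \<subseteq> sphere_of z0 \<and> slice_rep U g G \<and> Phi (G z0) \<noteq> 0 \<and> is_linear_star_product U ps g f"
  using F
proof (induction "nat (zorder (\<lambda>w. Phi (F w)) z0)" arbitrary: f F rule: less_induct)
  case less
  have stem: "holomorphic_stem U F" using less.prems(1) by (simp add: slice_rep_def)
  have cU: "cnj w \<in> U" if "w \<in> U" for w using U(3) that by blast
  show ?case
  proof (cases "Phi (F z0) = 0")
    case False
    then show ?thesis
      using less.prems(1) by (intro exI[of _ "[]"] exI[of _ f] exI[of _ F]) simp
  next
    case True
    then obtain v where v: "v \<in> imag_units" "slice_value v (F z0) = 0" by (auto simp: Phi_eq_0_iff)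
    define p where "p = slice_point z0 v"
    have p: "p \<in> sphere_of z0" using v by (auto simp: p_def sphere_of_def)
    \<comment> \<open>the identity \<open>F = (q - p) \<star> G\<close> is multiplied by the conjugate factor of \<open>p\<close>\<close>
    have stem': "holomorphic_stem U (\<lambda>z. cq_times (conj_linear_stem p z) (F z))"
      by (intro holomorphic_stem_times holomorphic_linear_stem stem)
    have zero: "cq_times (conj_linear_stem p z0) (F z0) = (0, 0, 0, 0)"
      unfolding p_def by (rule linear_stem_zero(2)[OF v])
    obtain G where G: "holomorphic_stem U G"
      "\<forall>z\<in>U. cq_times (conj_linear_stem p z) (F z) = cq_scale (sphere_poly z0 z) (G z)"
      by (rule holomorphic_stem_divide_sphere[OF U(1,3) stem' z0 zero])
    have eq: "cq_scale (sphere_poly z0 w) (F w) = cq_scale (sphere_poly z0 w * 1) (cq_times (linear_stem p w) (G w))"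
      if "w \<in> U" for w
      using G(2) that linear_stem_norm(2)[OF p, of w "F w"] by (simp add: cq_times_scale)
    have FG: "F z = cq_times (linear_stem p z) (G z)" if z: "z \<in> U" for z
    proof (cases "sphere_poly z0 z = 0")
      case False
      then show ?thesis
        using eq[OF z] by (cases "F z"; cases "cq_times (linear_stem p z) (G z)") (auto simp: cq_scale_def)
    next
      case True
      have stemp: "holomorphic_stem U (\<lambda>w. cq_times (linear_stem p w) (G w))"
        by (intro holomorphic_stem_times holomorphic_linear_stem G)
      have "F z = cq_scale 1 (cq_times (linear_stem p z) (G z))"
        by (rule cq_scale_cancel[OF U(1) z stem stemp holomorphic_on_const _ eq, of "cnj z"])
          (use True in \<open>auto simp: sphere_poly_eq_0_iff\<close>)
      then show ?thesis by simp
    qed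
    obtain g where g: "slice_rep U g G" using slice_rep_exists[OF G(1)] by blast
    have PG: "Phi (F w) = (w - z0) ^ 1 * (w - cnj z0) * Phi (G w)" if "w \<in> U" for w
      using FG[OF that] by (simp add: Phi_times linear_stem_norm(1)[OF p] sphere_poly_def)
    have nz: "\<exists>w\<in>U. Phi (G w) \<noteq> 0" using less.prems(2) PG by fastforce
    have "zorder (\<lambda>w. Phi (F w)) z0 = zorder (\<lambda>w. Phi (G w)) z0 + int 1"
      by (rule zorder_mult_power[OF U(1,2) z0(1) holomorphic_Phi[OF G(1)] nz _ _ PG])
        (use z0 in \<open>auto intro!: holomorphic_intros simp: complex_eq_iff\<close>)
    moreover have "zorder (\<lambda>w. Phi (G w)) z0 \<ge> 0"
      using zorder_exist_zero[OF holomorphic_Phi[OF G(1)] U(1,2) z0(1) nz] by (auto split: if_splits)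
    ultimately have "nat (zorder (\<lambda>w. Phi (G w)) z0) < nat (zorder (\<lambda>w. Phi (F w)) z0)" by simp
    from less.hyps[OF this g nz] obtain ps h H where
      IH: "set ps \<subseteq> sphere_of z0" "slice_rep U h H" "Phi (H z0) \<noteq> 0" "is_linear_star_product U ps h g"
      by blast
    have "slice_rep U f (\<lambda>z. cq_times (linear_stem p z) (G z))"
      by (rule slice_rep_cong[OF less.prems(1) FG cU])
    then have "is_star_product U (\<lambda>q. q - p) g f"
      unfolding is_star_product_iff_rep[OF U(1)] using g slice_rep_linear by blast
    with IH p show ?thesis
      by (intro exI[of _ "p # ps"] exI[of _ h] exI[of _ H]) auto
  qed
qed

lemma slice_point_sphere_poly:
  assumes "v \<in> imag_units"
  shows "slice_point (sphere_poly z0 w) v = (slice_point w v - of_real (Re z0))\<^sup>2 + of_real ((Im z0)\<^sup>2)"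
  unfolding sphere_poly_alt slice_point_add slice_point_power[OF assms] slice_point_diff slice_point_of_real ..

text \<open>Once the polynomial of the sphere has been divided out as often as possible, \<open>F'\<close> does not vanish at
  \<open>z0\<close>, so \<open>f'\<close> is not identically zero on the sphere; linear factors remove its remaining zero.\<close>

lemma sphere_factorization_exists:
  assumes U: "open U" "connected U" "cnj ` U = U" and z0: "z0 \<in> U" "Im z0 \<noteq> 0"
    and F: "slice_rep U f F" "\<exists>w\<in>U. Phi (F w) \<noteq> 0"
  shows "\<exists>m ps. sphere_factorization U f z0 m ps"
proof -
  have stem: "holomorphic_stem U F" using F(1) by (simp add: slice_rep_def)
  have "\<exists>m G. holomorphic_stem U G \<and> (\<forall>z\<in>U. F z = cq_scale (sphere_poly z0 z ^ m) (G z)) \<and> G z0 \<noteq> (0, 0, 0, 0)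
           \<and> (\<exists>w\<in>U. Phi (G w) \<noteq> 0)"
  proof (rule holomorphic_stem_maximal_power[OF U(1,2) z0(1) sphere_poly_def _ _ _ stem F(2)])
    fix H assume "holomorphic_stem U H" "H z0 = (0, 0, 0, 0)"
    then show "\<exists>G. holomorphic_stem U G \<and> (\<forall>z\<in>U. H z = cq_scale (sphere_poly z0 z) (G z))"
      using holomorphic_stem_divide_sphere[OF U(1,3) _ z0] by blast
  qed (use z0 in \<open>auto intro!: holomorphic_intros simp: complex_eq_iff\<close>)
  then obtain m F' where F': "holomorphic_stem U F'" "\<forall>z\<in>U. F z = cq_scale (sphere_poly z0 z ^ m) (F' z)"
    "F' z0 \<noteq> (0, 0, 0, 0)" "\<exists>w\<in>U. Phi (F' w) \<noteq> 0" by blast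
  obtain f' where f': "slice_rep U f' F'" using slice_rep_exists[OF F'(1)] by blast
  obtain ps g G where ps: "set ps \<subseteq> sphere_of z0" "slice_rep U g G" "Phi (G z0) \<noteq> 0" "is_linear_star_product U ps g f'"
    using linear_factorization_exists[OF U z0 f' F'(4)] by blast
  have "\<exists>v\<in>imag_units. slice_value v (F' z0) \<noteq> 0"
  proof (rule ccontr)
    assume "\<not> ?thesis"
    then have "F' z0 = (0, 0, 0, 0)"
      by (intro slice_value_eqD) (simp_all add: slice_value_def re_part_def im_part_def flip: zero_quat_def)
    with F'(3) show False ..
  qed
  then have a: "\<exists>q\<in>sphere_of z0. f' q \<noteq> 0"
    using f' z0 unfolding slice_rep_def sphere_of_def by auto
  have b: "\<forall>q\<in>sphere_of z0. g q \<noteq> 0"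
    using ps(2,3) z0 unfolding slice_rep_def sphere_of_def Phi_eq_0_iff by auto
  have c: "\<forall>q\<in>circularization U. f q = ((q - of_real (Re z0))\<^sup>2 + of_real ((Im z0)\<^sup>2)) ^ m * f' q"
  proof
    fix q assume "q \<in> circularization U"
    then obtain w v where w: "w \<in> U" "v \<in> imag_units" "q = slice_point w v" by (auto simp: circularization_def)
    have "f q = slice_value v (cq_scale (sphere_poly z0 w ^ m) (F' w))" using F(1) F'(2) w by (simp add: slice_rep_def)
    also have "\<dots> = slice_point (sphere_poly z0 w) v ^ m * f' q"
      using f' w by (simp add: slice_value_scale slice_point_power slice_rep_def)
    finally show "f q = ((q - of_real (Re z0))\<^sup>2 + of_real ((Im z0)\<^sup>2)) ^ m * f' q"
      unfolding slice_point_sphere_poly[OF w(2)] w(3) .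
  qed
  have "circular_nhd U z0 U" using U z0 by (simp add: circular_nhd_def)
  moreover have "slice_regular U f'" "slice_regular U g"
    using f' ps(2) slice_regular_iff_rep[OF U(1)] by blast+
  ultimately have "sphere_factorization U f z0 m ps"
    unfolding sphere_factorization_def using z0 a b c ps by blast
  then show ?thesis by blast
qed

text \<open>Each linear factor contributes its norm \<open>sphere_poly z\<close>, and the leftmost factor causes a zero at
  its own point.\<close>

lemma is_linear_star_product_stem:
  assumes V: "open V" "cnj ` V = V"
    and "is_linear_star_product V ps g h" "set ps \<subseteq> sphere_of z" "slice_rep V g G"
  shows "\<exists>H. slice_rep V h H \<and> (\<forall>w\<in>V. Phi (H w) = sphere_poly z w ^ length ps * Phi (G w)) \<and>
           (\<forall>v\<in>imag_units. ps \<noteq> [] \<longrightarrow> hd ps = slice_point z v \<longrightarrow> slice_value v (H z) = 0)"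
  using assms(3,4)
proof (induction ps arbitrary: h)
  case Nil
  have "h (slice_point w v) = g (slice_point w v)" if "w \<in> V" "v \<in> imag_units" for w v
    using Nil(1) that unfolding is_linear_star_product.simps circularization_def by blast
  then have "slice_rep V h G"
    using assms(5) unfolding slice_rep_def by simp
  then show ?case by auto
next
  case (Cons p ps)
  then obtain k where k: "is_linear_star_product V ps g k" "is_star_product V (\<lambda>q. q - p) k h" by auto
  have p: "p \<in> sphere_of z" using Cons.prems by simp
  obtain K where K: "slice_rep V k K" "\<forall>w\<in>V. Phi (K w) = sphere_poly z w ^ length ps * Phi (G w)"
    using Cons.IH[OF k(1)] Cons.prems by auto
  obtain L K' where LK: "slice_rep V (\<lambda>q. q - p) L" "slice_rep V k K'" "slice_rep V h (\<lambda>z. cq_times (L z) (K' z))"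
    using k(2) unfolding is_star_product_iff_rep[OF V(1)] by blast
  have "cq_times (L w) (K' w) = cq_times (linear_stem p w) (K w)" if "w \<in> V" for w
    using slice_rep_unique[OF LK(1) slice_rep_linear that] slice_rep_unique[OF LK(2) K(1) that] by simp
  moreover have "cnj w \<in> V" if "w \<in> V" for w using V(2) that by blast
  ultimately have "slice_rep V h (\<lambda>z. cq_times (linear_stem p z) (K z))"
    by (rule slice_rep_cong[OF LK(3)])
  then show ?case
    using K(2) linear_stem_zero(1) by (intro exI[of _ "\<lambda>z. cq_times (linear_stem p z) (K z)"])
      (auto simp: Phi_times linear_stem_norm(1)[OF p])
qed

section \<open>Uniqueness of multiplicities and counting\<close>

lemma slice_rep_scale:
  assumes F: "slice_rep V f' F'" and p: "p holomorphic_on V" "\<And>z. z \<in> V \<Longrightarrow> p (cnj z) = cnj (p z)"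
    and f: "\<And>w v. w \<in> V \<Longrightarrow> v \<in> imag_units \<Longrightarrow> f (slice_point w v) = slice_point (p w) v * f' (slice_point w v)"
  shows "slice_rep V f (\<lambda>w. cq_scale (p w) (F' w))"
  using assms unfolding slice_rep_def by (auto simp: slice_value_scale intro: holomorphic_stem_scale)

text \<open>Translation of a factorization of \<open>f\<close> into one of \<open>F\<close>. The neighbourhood may be
  disconnected: the stem function is determined by \<open>f\<close> pointwise, so \<open>F\<close> factors on all of it.\<close>

lemma sphere_factorization_stem:
  assumes F: "slice_rep U f F" and fac: "sphere_factorization U f z m ps"
  shows "\<exists>V F' G. open V \<and> z \<in> V \<and> V \<subseteq> U \<and> holomorphic_stem V F' \<and> F' z \<noteq> (0, 0, 0, 0) \<and>
           (\<forall>w\<in>V. F w = cq_scale (sphere_poly z w ^ m) (F' w)) \<and>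
           holomorphic_stem V G \<and> Phi (G z) \<noteq> 0 \<and>
           (\<forall>w\<in>V. Phi (F w) = sphere_poly z w ^ (2 * m + length ps) * Phi (G w)) \<and>
           (\<forall>v\<in>imag_units. ps \<noteq> [] \<longrightarrow> hd ps = slice_point z v \<longrightarrow> slice_value v (F' z) = 0)"
proof -
  obtain V f' g where V: "circular_nhd U z V" and reg: "slice_regular V f'" "slice_regular V g"
    and f: "\<forall>q\<in>circularization V. f q = ((q - of_real (Re z))\<^sup>2 + of_real ((Im z)\<^sup>2)) ^ m * f' q"
    and f'0: "\<exists>q\<in>sphere_of z. f' q \<noteq> 0" and ps: "set ps \<subseteq> sphere_of z"
    and g0: "\<forall>q\<in>sphere_of z. g q \<noteq> 0" and star: "is_linear_star_product V ps g f'"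
    using fac unfolding sphere_factorization_def by blast
  have oV: "open V" "cnj ` V = V" "V \<subseteq> U" "z \<in> V" using V by (auto simp: circular_nhd_def)
  obtain G where G: "slice_rep V g G" using reg(2) slice_regular_iff_rep[OF oV(1)] by blast
  obtain F' where F': "slice_rep V f' F'" "\<forall>w\<in>V. Phi (F' w) = sphere_poly z w ^ length ps * Phi (G w)"
    and hd: "\<forall>v\<in>imag_units. ps \<noteq> [] \<longrightarrow> hd ps = slice_point z v \<longrightarrow> slice_value v (F' z) = 0"
    using is_linear_star_product_stem[OF oV(1,2) star ps G] by blast
  have "slice_rep V f (\<lambda>w. cq_scale (sphere_poly z w ^ m) (F' w))"
  proof (rule slice_rep_scale[OF F'(1)])
    fix w v assume w: "w \<in> V" "v \<in> imag_units"
    then have "slice_point w v \<in> circularization V" by (auto simp: circularization_def)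
    then show "f (slice_point w v) = slice_point (sphere_poly z w ^ m) v * f' (slice_point w v)"
      using f by (simp add: slice_point_power[OF w(2)] slice_point_sphere_poly[OF w(2)])
  qed (auto intro!: holomorphic_intros sphere_poly_holomorphic simp: sphere_poly_cnj)
  from slice_rep_unique[OF slice_rep_subset[OF F oV(3)] this]
  have FF': "\<forall>w\<in>V. F w = cq_scale (sphere_poly z w ^ m) (F' w)" by blast
  have 1: "F' z \<noteq> (0, 0, 0, 0)"
  proof
    assume "F' z = (0, 0, 0, 0)"
    then have "slice_value v (F' z) = 0" for v
      by (simp add: slice_value_def re_part_def im_part_def flip: zero_quat_def)
    then show False using f'0 F'(1) oV(4) unfolding slice_rep_def sphere_of_def by auto
  qed
  have 2: "Phi (G z) \<noteq> 0"
    using g0 G oV(4) unfolding slice_rep_def sphere_of_def Phi_eq_0_iff by auto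
  have 3: "\<forall>w\<in>V. Phi (F w) = sphere_poly z w ^ (2 * m + length ps) * Phi (G w)"
    using FF' F'(2) by (simp add: Phi_scale power_add power_mult[symmetric] mult.commute[of m])
  show ?thesis
    using oV 1 2 3 FF' hd F'(1) G unfolding slice_rep_def by blast
qed

lemma sphere_factorization_zorder:
  assumes F: "slice_rep U f F" and fac: "sphere_factorization U f z m ps"
  shows "zorder (\<lambda>w. Phi (F w)) z = int (2 * m + length ps)"
proof -
  define N where "N = 2 * m + length ps"
  obtain V G where V: "open V" "z \<in> V" and G: "holomorphic_stem V G" "Phi (G z) \<noteq> 0"
    and eq: "\<forall>w\<in>V. Phi (F w) = sphere_poly z w ^ N * Phi (G w)"
    using sphere_factorization_stem[OF F fac] unfolding N_def by blast
  have z: "Im z \<noteq> 0" using fac by (simp add: sphere_factorization_def)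
  show ?thesis unfolding N_def[symmetric]
  proof (rule zorder_eqI[OF V, of "\<lambda>w. (w - cnj z) ^ N * Phi (G w)"])
    show "(\<lambda>w. (w - cnj z) ^ N * Phi (G w)) holomorphic_on V"
      by (intro holomorphic_intros holomorphic_Phi[OF G(1)])
    have "z \<noteq> cnj z" using z by (auto simp: complex_eq_iff)
    then show "(z - cnj z) ^ N * Phi (G z) \<noteq> 0" using G(2) by simp
    show "Phi (F w) = (w - cnj z) ^ N * Phi (G w) * (w - z) powi int N" if "w \<in> V" for w
      using eq that by (simp add: sphere_poly_def power_mult_distrib power_int_of_nat)
  qed
qed

text \<open>If \<open>m < m'\<close>, then cancelling \<open>sphere_poly z ^ m\<close> would make the first cofactor vanish at \<open>z\<close>. So
  \<open>m = m'\<close>, the cofactors agree at \<open>z\<close>, and they have only one zero on the sphere.\<close>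

lemma sphere_factorization_unique:
  assumes F: "slice_rep U f F"
    and fac: "sphere_factorization U f z m ps" "sphere_factorization U f z m' ps'"
  shows "m = m'" and "length ps = length ps'" and "ps \<noteq> [] \<Longrightarrow> hd ps = hd ps'"
proof -
  have key: "m \<ge> m' \<and> (m = m' \<longrightarrow> ps \<noteq> [] \<longrightarrow> ps' \<noteq> [] \<longrightarrow> hd ps = hd ps')"
    if fac: "sphere_factorization U f z m ps" "sphere_factorization U f z m' ps'" for m m' ps ps'
  proof -
    obtain V G where V: "open V" "z \<in> V" and G: "holomorphic_stem V G" "G z \<noteq> (0, 0, 0, 0)"
      "\<forall>w\<in>V. F w = cq_scale (sphere_poly z w ^ m) (G w)"
      "\<forall>v\<in>imag_units. ps \<noteq> [] \<longrightarrow> hd ps = slice_point z v \<longrightarrow> slice_value v (G z) = 0"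
      using sphere_factorization_stem[OF F fac(1)] by blast
    obtain V' G' where V': "open V'" "z \<in> V'" and G': "holomorphic_stem V' G'"
      "\<forall>w\<in>V'. F w = cq_scale (sphere_poly z w ^ m') (G' w)"
      "\<forall>v\<in>imag_units. ps' \<noteq> [] \<longrightarrow> hd ps' = slice_point z v \<longrightarrow> slice_value v (G' z) = 0"
      using sphere_factorization_stem[OF F fac(2)] by blast
    have quot: "G z = cq_scale (sphere_poly z z ^ (m' - m)) (G' z)" if le: "m \<le> m'"
    proof (rule cq_scale_cancel[where V = "V \<inter> V'" and z' = "cnj z" and p = "\<lambda>w. sphere_poly z w ^ m"
          and q = "\<lambda>w. sphere_poly z w ^ (m' - m)"])
      show "open (V \<inter> V')" "z \<in> V \<inter> V'" using V V' by auto
      show "holomorphic_stem (V \<inter> V') G" "holomorphic_stem (V \<inter> V') G'"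
        using holomorphic_stem_subset[OF G(1)] holomorphic_stem_subset[OF G'(1)] by simp_all
      show "(\<lambda>w. sphere_poly z w ^ (m' - m)) holomorphic_on V \<inter> V'"
        by (intro holomorphic_intros sphere_poly_holomorphic)
      show "sphere_poly z w ^ m \<noteq> 0" if "w \<noteq> z" "w \<noteq> cnj z" for w
        using that by (simp add: sphere_poly_eq_0_iff)
      fix w assume "w \<in> V \<inter> V'"
      then have "cq_scale (sphere_poly z w ^ m) (G w) = cq_scale (sphere_poly z w ^ m') (G' w)"
        using G(3) G'(2) by (metis IntD1 IntD2)
      moreover have "sphere_poly z w ^ m' = sphere_poly z w ^ m * sphere_poly z w ^ (m' - m)"
        using le by (simp flip: power_add)
      ultimately show "cq_scale (sphere_poly z w ^ m) (G w) =
            cq_scale (sphere_poly z w ^ m * sphere_poly z w ^ (m' - m)) (G' w)" by simp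
    qed
    have "m \<ge> m'"
    proof (rule ccontr)
      assume "\<not> m \<ge> m'"
      then have "G z = cq_scale 0 (G' z)" using quot by (simp add: sphere_poly_def power_0_left)
      then show False using G(2) by (cases "G' z") (simp add: cq_scale_def)
    qed
    moreover have "hd ps = hd ps'" if eq: "m = m'" "ps \<noteq> []" "ps' \<noteq> []"
    proof -
      have GG: "G z = G' z" using quot eq by simp
      have sub: "set ps \<subseteq> sphere_of z" "set ps' \<subseteq> sphere_of z" using fac by (auto simp: sphere_factorization_def)
      have "hd ps \<in> sphere_of z" "hd ps' \<in> sphere_of z" using sub eq(2,3) by (auto dest: hd_in_set)
      then obtain v v' where v: "v \<in> imag_units" "hd ps = slice_point z v" "v' \<in> imag_units" "hd ps' = slice_point z v'"
        by (auto simp: sphere_of_def)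
      have "slice_value v (G z) = 0" "slice_value v' (G z) = 0"
        using G(4) G'(3) eq v GG by auto
      then have "v' = v" using G(2) by (rule slice_value_inj)
      then show ?thesis using v by simp
    qed
    ultimately show ?thesis by blast
  qed
  show m: "m = m'" using key[OF fac] key[OF fac(2,1)] by simp
  show l: "length ps = length ps'"
    using sphere_factorization_zorder[OF F fac(1)] sphere_factorization_zorder[OF F fac(2)] m by simp
  show "hd ps = hd ps'" if "ps \<noteq> []" using key[OF fac] m l that by (metis length_0_conv)
qed

lemma sphere_of_cnj: "sphere_of (cnj z) = sphere_of z"
proof -
  have "slice_point (cnj z) v = slice_point z (- v)" for v by (simp add: slice_point_def)
  then have "sphere_of (cnj z) = slice_point z ` (uminus ` imag_units)" by (auto simp: sphere_of_def image_image)
  moreover have "uminus ` imag_units = imag_units"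
    by (auto intro!: image_eqI[of _ uminus "- _"])
  ultimately show ?thesis by (simp add: sphere_of_def)
qed

lemma sphere_of_mem_iff:
  assumes "q \<in> sphere_of z"
  shows "q \<in> sphere_of w \<longleftrightarrow> w = z \<or> w = cnj z"
proof
  assume "q \<in> sphere_of w"
  with assms show "w = z \<or> w = cnj z" unfolding sphere_of_def by (blast dest: slice_point_eqD)
qed (use assms sphere_of_cnj in auto)

lemma sphere_of_eq_iff: "sphere_of w = sphere_of z \<longleftrightarrow> w = z \<or> w = cnj z"
proof
  assume eq: "sphere_of w = sphere_of z"
  have "slice_point z (Quat 0 1 0 0) \<in> sphere_of z" unfolding sphere_of_def using imag_units_nonempty by blast
  with eq show "w = z \<or> w = cnj z" using sphere_of_mem_iff by blast
qed (auto simp: sphere_of_cnj)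

lemma sphere_factorization_cnj:
  assumes "sphere_factorization U f z m ps"
  shows "sphere_factorization U f (cnj z) m ps"
proof -
  have "circular_nhd U (cnj z) V" if "circular_nhd U z V" for V
    using that unfolding circular_nhd_def by blast
  then show ?thesis
    using assms unfolding sphere_factorization_def sphere_of_cnj by (simp, blast)
qed

text \<open>At a real point \<open>f\<close> and its stem function have the same value, so the norm of the cofactor does not
  vanish there.\<close>

lemma is_real_multiplicity_zorder:
  assumes F: "slice_rep U f F" and mult: "is_real_multiplicity U f x n"
  shows "zorder (\<lambda>w. Phi (F w)) (of_real x) = int (2 * n)"
proof -
  obtain V g where V: "circular_nhd U (of_real x) V" and g: "slice_regular V g" "g (of_real x) \<noteq> 0"
    and f: "\<forall>q\<in>circularization V. f q = (q - of_real x) ^ n * g q"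
    using mult unfolding is_real_multiplicity_def by blast
  have oV: "open V" "cnj ` V = V" "V \<subseteq> U" "of_real x \<in> V" using V by (auto simp: circular_nhd_def)
  obtain G where G: "slice_rep V g G" using g(1) slice_regular_iff_rep[OF oV(1)] by blast
  then have stem: "holomorphic_stem V G" by (simp add: slice_rep_def)
  have "slice_rep V f (\<lambda>w. cq_scale ((w - of_real x) ^ n) (G w))"
  proof (rule slice_rep_scale[OF G])
    fix w v assume w: "w \<in> V" "v \<in> imag_units"
    then have "slice_point w v \<in> circularization V" by (auto simp: circularization_def)
    then show "f (slice_point w v) = slice_point ((w - of_real x) ^ n) v * g (slice_point w v)"
      using f by (simp add: slice_point_power[OF w(2)] slice_point_diff)
  qed (auto intro!: holomorphic_intros)
  from slice_rep_unique[OF slice_rep_subset[OF F oV(3)] this]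
  have eq: "F w = cq_scale ((w - of_real x) ^ n) (G w)" if "w \<in> V" for w using that by blast
  have nz: "Phi (G (of_real x)) \<noteq> 0"
  proof
    assume "Phi (G (of_real x)) = 0"
    then obtain v where "v \<in> imag_units" "slice_value v (G (of_real x)) = 0" by (auto simp: Phi_eq_0_iff)
    then have "g (slice_point (of_real x) v) = 0" using G oV(4) by (simp add: slice_rep_def del: slice_point_of_real)
    then show False using g(2) by simp
  qed
  show ?thesis
  proof (rule zorder_eqI[OF oV(1,4) holomorphic_Phi[OF stem] nz])
    show "Phi (F w) = Phi (G w) * (w - of_real x) powi int (2 * n)" if "w \<in> V" for w
      unfolding eq[OF that] Phi_scale power_int_of_nat by (simp add: power_mult[symmetric] mult.commute)
  qed
qed

lemma is_real_multiplicity_exists: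
  assumes U: "open U" "connected U" "cnj ` U = U" and x: "of_real x \<in> U"
    and F: "slice_rep U f F" "\<exists>w\<in>U. Phi (F w) \<noteq> 0"
  shows "\<exists>n. is_real_multiplicity U f x n"
proof -
  have stem: "holomorphic_stem U F" using F(1) by (simp add: slice_rep_def)
  have "\<exists>m G. holomorphic_stem U G \<and> (\<forall>z\<in>U. F z = cq_scale ((z - of_real x) ^ m) (G z)) \<and> G (of_real x) \<noteq> (0, 0, 0, 0)
           \<and> (\<exists>w\<in>U. Phi (G w) \<noteq> 0)"
  proof (rule holomorphic_stem_maximal_power[OF U(1,2) x _ _ _ _ stem F(2), of "\<lambda>w. w - of_real x" "\<lambda>_. 1"])
    fix H assume "holomorphic_stem U H" "H (of_real x) = (0, 0, 0, 0)"
    then show "\<exists>G. holomorphic_stem U G \<and> (\<forall>z\<in>U. H z = cq_scale (z - of_real x) (G z))"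
      using holomorphic_stem_divide_real[OF U(1,3)] by blast
  qed auto
  then obtain n G where G: "holomorphic_stem U G" "\<forall>z\<in>U. F z = cq_scale ((z - of_real x) ^ n) (G z)"
    "G (of_real x) \<noteq> (0, 0, 0, 0)" by blast
  obtain g where g: "slice_rep U g G" using slice_rep_exists[OF G(1)] by blast
  have im: "im_part (G (of_real x)) = 0" by (rule holomorphic_stem_real[OF G(1) x])
  have "g (of_real x) = slice_value (Quat 0 1 0 0) (G (of_real x))"
    using g x imag_units_nonempty slice_point_of_real unfolding slice_rep_def by metis
  also have "\<dots> = re_part (G (of_real x))" by (simp add: slice_value_def im)
  finally have gx: "g (of_real x) = re_part (G (of_real x))" .
  have "g (of_real x) \<noteq> 0"
  proof
    assume "g (of_real x) = 0"
    then have "G (of_real x) = (0, 0, 0, 0)"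
      using im gx unfolding cquat_eq_iff by (simp add: re_part_def im_part_def zero_quat_def)
    with G(3) show False ..
  qed
  moreover have "\<forall>q\<in>circularization U. f q = (q - of_real x) ^ n * g q"
  proof
    fix q assume "q \<in> circularization U"
    then obtain w v where w: "w \<in> U" "v \<in> imag_units" "q = slice_point w v" by (auto simp: circularization_def)
    have "f q = slice_value v (cq_scale ((w - of_real x) ^ n) (G w))" using F(1) G(2) w by (simp add: slice_rep_def)
    then show "f q = (q - of_real x) ^ n * g q"
      using g w by (simp add: slice_value_scale slice_point_power slice_point_diff slice_rep_def)
  qed
  moreover have "circular_nhd U (of_real x) U" using U x by (simp add: circular_nhd_def)
  moreover have "slice_regular U g" using g slice_regular_iff_rep[OF U(1)] by blast
  ultimately show ?thesis unfolding is_real_multiplicity_def by blast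
qed

lemma real_multiplicity_zorder:
  assumes U: "open U" "connected U" "cnj ` U = U" and x: "of_real x \<in> U"
    and F: "slice_rep U f F" "\<exists>w\<in>U. Phi (F w) \<noteq> 0"
  shows "zorder (\<lambda>w. Phi (F w)) (of_real x) = int (2 * real_multiplicity U f x)"
proof -
  obtain n where n: "is_real_multiplicity U f x n" using is_real_multiplicity_exists[OF assms] by blast
  have "real_multiplicity U f x = n"
    unfolding real_multiplicity_def
  proof (rule the_equality[where P = "is_real_multiplicity U f x", OF n])
    fix n' assume "is_real_multiplicity U f x n'"
    from is_real_multiplicity_zorder[OF F(1) this] is_real_multiplicity_zorder[OF F(1) n]
    show "n' = n" by simp
  qed
  then show ?thesis using is_real_multiplicity_zorder[OF F(1) n] by simp
qed

lemma real_zeros_iff: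
  assumes F: "slice_rep U f F"
  shows "real_zeros U f = {x. of_real x \<in> U \<and> Phi (F (of_real x)) = 0}"
proof -
  have "f (of_real x) = 0 \<longleftrightarrow> Phi (F (of_real x)) = 0" if x: "of_real x \<in> U" for x
  proof -
    have "f (of_real x) = slice_value v (F (of_real x))" if "v \<in> imag_units" for v
      using F x that slice_point_of_real unfolding slice_rep_def by metis
    then show ?thesis unfolding Phi_eq_0_iff using imag_units_nonempty by metis
  qed
  then show ?thesis by (auto simp: real_zeros_def)
qed

text \<open>An object \<open>c z\<close>, such as a sphere or its isolated zero, is represented by the two points \<open>z\<close> and
  \<open>cnj z\<close>. Summing the weight over points of \<open>\<Omega>\<close> counts it twice if both of them lie in \<open>\<Omega>\<close> and once
  otherwise.\<close>

lemma sum_over_conjugate_pairs: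
  fixes w :: "complex \<Rightarrow> nat" and c :: "complex \<Rightarrow> 'x" and mult :: "'x \<Rightarrow> nat"
  assumes fin: "finite Z" and Z: "Z \<subseteq> \<Omega>" "\<And>z. z \<in> Z \<Longrightarrow> Im z \<noteq> 0"
    and cZ: "\<And>z. z \<in> Z \<Longrightarrow> cnj z \<in> \<Omega> \<Longrightarrow> cnj z \<in> Z"
    and w: "\<And>z. z \<in> Z \<Longrightarrow> w (cnj z) = w z"
    and c: "\<And>z. z \<in> Z \<Longrightarrow> c (cnj z) = c z" "\<And>z z'. z \<in> Z \<Longrightarrow> z' \<in> Z \<Longrightarrow> c z' = c z \<Longrightarrow> z' = z \<or> z' = cnj z"
    and mult: "\<And>z. z \<in> Z \<Longrightarrow> mult (c z) = w z"
  shows "(\<Sum>z\<in>Z. w z) = 2 * (\<Sum>x\<in>c ` {z \<in> Z. cnj z \<in> \<Omega>}. mult x) + (\<Sum>x\<in>c ` {z \<in> Z. cnj z \<notin> \<Omega>}. mult x)"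
proof -
  define A where "A = {z \<in> Z. cnj z \<in> \<Omega> \<and> Im z > 0}"
  define B where "B = {z \<in> Z. cnj z \<notin> \<Omega>}"
  have fA: "finite A" "finite B" using fin by (auto simp: A_def B_def)
  have cA: "cnj z \<in> Z" "cnj z \<in> \<Omega>" "z \<in> Z" "z \<in> \<Omega>" "Im z > 0" if "z \<in> A" for z
    using that cZ Z by (auto simp: A_def)
  have split: "Z = (A \<union> cnj ` A) \<union> B"
  proof
    show "Z \<subseteq> (A \<union> cnj ` A) \<union> B"
    proof
      fix z assume z: "z \<in> Z"
      show "z \<in> (A \<union> cnj ` A) \<union> B"
      proof (cases "cnj z \<in> \<Omega> \<and> Im z < 0")
        case True
        then have "cnj z \<in> A" using z Z cZ[OF z] by (auto simp: A_def)
        then have "cnj (cnj z) \<in> cnj ` A" by blast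
        then show ?thesis by simp
      next
        case False
        then show ?thesis using z Z(2)[OF z] by (auto simp: A_def B_def)
      qed
    qed
    show "(A \<union> cnj ` A) \<union> B \<subseteq> Z" using cA by (auto simp: B_def)
  qed
  have disj: "A \<inter> cnj ` A = {}" "(A \<union> cnj ` A) \<inter> B = {}"
  proof -
    have False if "z \<in> A" "z = cnj y" "y \<in> A" for z y using cA(5)[OF that(1)] cA(5)[OF that(3)] that(2) by simp
    then show "A \<inter> cnj ` A = {}" by blast
    have "z \<notin> B" if "z \<in> A \<union> cnj ` A" for z using that cA(2,4) by (auto simp: B_def)
    then show "(A \<union> cnj ` A) \<inter> B = {}" by blast
  qed
  have "(\<Sum>z\<in>Z. w z) = (\<Sum>z\<in>A. w z) + (\<Sum>z\<in>cnj ` A. w z) + (\<Sum>z\<in>B. w z)"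
    unfolding split using fA disj by (simp add: sum.union_disjoint)
  also have "(\<Sum>z\<in>cnj ` A. w z) = (\<Sum>z\<in>A. w z)"
    using w cA by (subst sum.reindex) (auto intro!: sum.cong inj_onI)
  also have "(\<Sum>z\<in>A. w z) = (\<Sum>x\<in>c ` A. mult x)"
  proof (subst sum.reindex)
    show "inj_on c A"
    proof (rule inj_onI)
      fix z z' assume "z \<in> A" "z' \<in> A" "c z = c z'"
      then show "z = z'" using c(2)[of z' z] cA(3,5)[of z] cA(3,5)[of z'] by auto
    qed
  qed (use mult cA in auto)
  also have "c ` A = c ` {z \<in> Z. cnj z \<in> \<Omega>}"
  proof -
    have "c z \<in> c ` A" if "z \<in> Z" "cnj z \<in> \<Omega>" for z
    proof (cases "Im z > 0")
      case True
      then show ?thesis using that by (auto simp: A_def)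
    next
      case False
      then have "cnj z \<in> A" using that Z cZ by (fastforce simp: A_def)
      then show ?thesis using c(1)[OF that(1)] by (metis imageI)
    qed
    then show ?thesis by (auto simp: A_def)
  qed
  also have "(\<Sum>z\<in>B. w z) = (\<Sum>x\<in>c ` B. mult x)"
  proof (subst sum.reindex)
    show "inj_on c B"
    proof (rule inj_onI)
      fix z z' assume "z \<in> B" "z' \<in> B" "c z = c z'"
      then show "z = z'" using c(2)[of z' z] Z(1) by (auto simp: B_def)
    qed
  qed (use mult in \<open>auto simp: B_def\<close>)
  finally show ?thesis by (simp add: B_def)
qed

text \<open>A factorization is chosen at every non-real point; by uniqueness its exponents are the
  multiplicities and are the same at conjugate points.\<close>

lemma sum_zorder_eq_multiplicities:
  assumes U: "open U" "connected U" "cnj ` U = U"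
    and F: "slice_rep U f F" "\<exists>w\<in>U. Phi (F w) \<noteq> 0"
    and \<Omega>: "\<Omega> \<subseteq> U" "finite {z \<in> \<Omega>. Phi (F z) = 0}"
  shows "(\<Sum>z | z \<in> \<Omega> \<and> Phi (F z) = 0. zorder (\<lambda>w. Phi (F w)) z) = int
     (2 * (\<Sum>q | q \<in> isolated_zeros U f \<and> (\<exists>z. q \<in> sphere_of z \<and> z \<in> \<Omega> \<and> cnj z \<in> \<Omega>). isolated_multiplicity U f q) +
      (\<Sum>q | q \<in> isolated_zeros U f \<and> (\<exists>z. q \<in> sphere_of z \<and> z \<in> \<Omega> \<and> cnj z \<notin> \<Omega>). isolated_multiplicity U f q) +
      2 * (\<Sum>x | x \<in> real_zeros U f \<and> of_real x \<in> \<Omega>. real_multiplicity U f x) +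
      4 * (\<Sum>S | S \<in> spherical_zeros U f \<and> (\<exists>z. S = sphere_of z \<and> z \<in> \<Omega> \<and> cnj z \<in> \<Omega>). spherical_multiplicity U f S) +
      2 * (\<Sum>S | S \<in> spherical_zeros U f \<and> (\<exists>z. S = sphere_of z \<and> z \<in> \<Omega> \<and> cnj z \<notin> \<Omega>). spherical_multiplicity U f S))"
proof -
  define h where "h = (\<lambda>w. Phi (F w))"
  have hol: "h holomorphic_on U" unfolding h_def using F(1) by (intro holomorphic_Phi) (simp add: slice_rep_def)
  have "\<forall>z\<in>{z\<in>U. Im z \<noteq> 0}. \<exists>r. sphere_factorization U f z (fst r) (snd r)"
    using sphere_factorization_exists[OF U _ _ F] by simp
  from bchoice[OF this] obtain r where r: "\<forall>z\<in>{z\<in>U. Im z \<noteq> 0}. sphere_factorization U f z (fst (r z)) (snd (r z))" ..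
  define M where "M = (\<lambda>z. fst (r z))"
  define n where "n = (\<lambda>z. length (snd (r z)))"
  define pt where "pt = (\<lambda>z. hd (snd (r z)))"
  have fac: "sphere_factorization U f z (M z) (snd (r z))" if "z \<in> U" "Im z \<noteq> 0" for z
    using r that by (simp add: M_def)
  have fin: "z \<in> U" "Im z \<noteq> 0" if "sphere_factorization U f z m ps" for z m ps
    using that by (auto simp: sphere_factorization_def circular_nhd_def)
  have uniq: "m = M z" "length ps = n z" "ps \<noteq> [] \<Longrightarrow> hd ps = pt z"
    if "sphere_factorization U f z m ps" for z m ps
    using sphere_factorization_unique[OF F(1) that fac[OF fin[OF that]]] by (simp_all add: n_def pt_def)
  have sym: "M (cnj z) = M z" "n (cnj z) = n z" "n z \<ge> 1 \<Longrightarrow> pt (cnj z) = pt z" if z: "z \<in> U" "Im z \<noteq> 0" for z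
  proof -
    note u = uniq[OF sphere_factorization_cnj[OF fac[OF z]]]
    show "M (cnj z) = M z" "n (cnj z) = n z" using u(1,2) by (simp_all add: n_def)
    assume "n z \<ge> 1"
    then have "snd (r z) \<noteq> []" by (auto simp: n_def)
    then show "pt (cnj z) = pt z" using u(3) by (simp add: pt_def)
  qed
  have ptS: "pt z \<in> sphere_of z" if z: "z \<in> U" "Im z \<noteq> 0" "n z \<ge> 1" for z
  proof -
    have "set (snd (r z)) \<subseteq> sphere_of z" using fac[OF z(1,2)] unfolding sphere_factorization_def by blast
    moreover have "snd (r z) \<noteq> []" using z(3) by (auto simp: n_def)
    ultimately show ?thesis unfolding pt_def using hd_in_set by blast
  qed
  have zo: "zorder h z = int (2 * M z + n z)" if z: "z \<in> U" "Im z \<noteq> 0" for z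
    using sphere_factorization_zorder[OF F(1) fac[OF z]] by (simp add: h_def n_def)
  have zero: "h z = 0 \<longleftrightarrow> zorder h z > 0" if "z \<in> U" for z
    using zorder_exist_zero[OF hol U(1,2) that] F(2) by (auto simp: h_def split: if_splits)
  define Z where "Z = {z \<in> \<Omega>. h z = 0 \<and> Im z \<noteq> 0}"
  have finZ: "finite Z" by (rule finite_subset[OF _ \<Omega>(2)]) (auto simp: Z_def h_def)
  define ZM where "ZM = {z \<in> Z. M z \<ge> 1}"
  define Zn where "Zn = {z \<in> Z. n z \<ge> 1}"
  have memZ: "z \<in> Z \<longleftrightarrow> z \<in> \<Omega> \<and> Im z \<noteq> 0 \<and> 2 * M z + n z > 0" for z
    using zero[of z] zo[of z] \<Omega>(1) by (auto simp: Z_def)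
  have ZU: "z \<in> U" "Im z \<noteq> 0" if "z \<in> Z" for z using that \<Omega>(1) by (auto simp: Z_def)
  have ZMU: "z \<in> U" "Im z \<noteq> 0" "M z \<ge> 1" if "z \<in> ZM" for z using that ZU by (auto simp: ZM_def)
  have ZnU: "z \<in> U" "Im z \<noteq> 0" "n z \<ge> 1" if "z \<in> Zn" for z using that ZU by (auto simp: Zn_def)

  have sph: "is_spherical_multiplicity U f S m \<longleftrightarrow> m \<ge> 1 \<and> (\<exists>z. z \<in> U \<and> Im z \<noteq> 0 \<and> S = sphere_of z \<and> m = M z)" for S m
  proof
    assume "is_spherical_multiplicity U f S m"
    then obtain z ps where "m \<ge> 1" "S = sphere_of z" "sphere_factorization U f z m ps"
      unfolding is_spherical_multiplicity_def by blast
    then show "m \<ge> 1 \<and> (\<exists>z. z \<in> U \<and> Im z \<noteq> 0 \<and> S = sphere_of z \<and> m = M z)"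
      using fin uniq(1) by blast
  next
    assume "m \<ge> 1 \<and> (\<exists>z. z \<in> U \<and> Im z \<noteq> 0 \<and> S = sphere_of z \<and> m = M z)"
    then show "is_spherical_multiplicity U f S m" unfolding is_spherical_multiplicity_def using fac by blast
  qed
  have iso: "is_isolated_multiplicity U f p k \<longleftrightarrow> k \<ge> 1 \<and> (\<exists>z. z \<in> U \<and> Im z \<noteq> 0 \<and> p = pt z \<and> k = n z)" for p k
  proof
    assume "is_isolated_multiplicity U f p k"
    then obtain z m ps where *: "k \<ge> 1" "sphere_factorization U f z m ps" "length ps = k" "hd ps = p"
      unfolding is_isolated_multiplicity_def by blast
    then have "ps \<noteq> []" by auto
    with * show "k \<ge> 1 \<and> (\<exists>z. z \<in> U \<and> Im z \<noteq> 0 \<and> p = pt z \<and> k = n z)"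
      using fin[OF *(2)] uniq[OF *(2)] by blast
  next
    assume "k \<ge> 1 \<and> (\<exists>z. z \<in> U \<and> Im z \<noteq> 0 \<and> p = pt z \<and> k = n z)"
    then obtain z where z: "k \<ge> 1" "z \<in> U" "Im z \<noteq> 0" "p = pt z" "k = n z" by blast
    show "is_isolated_multiplicity U f p k" unfolding is_isolated_multiplicity_def
      using z fac[OF z(2,3)] unfolding n_def pt_def by blast
  qed
  have smult: "spherical_multiplicity U f (sphere_of z) = M z" if z: "z \<in> ZM" for z
    unfolding spherical_multiplicity_def
  proof (rule the_equality)
    show "is_spherical_multiplicity U f (sphere_of z) (M z)" using sph ZMU[OF z] by blast
    fix m assume "is_spherical_multiplicity U f (sphere_of z) m"
    then obtain w where w: "w \<in> U" "Im w \<noteq> 0" "sphere_of z = sphere_of w" "m = M w" using sph by blast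
    then show "m = M z" using sphere_of_eq_iff[of z w] sym(1)[OF w(1,2)] by auto
  qed
  have imult: "isolated_multiplicity U f (pt z) = n z" if z: "z \<in> Zn" for z
    unfolding isolated_multiplicity_def
  proof (rule the_equality)
    show "is_isolated_multiplicity U f (pt z) (n z)" using iso ZnU[OF z] by blast
    fix k assume "is_isolated_multiplicity U f (pt z) k"
    then obtain w where w: "k \<ge> 1" "w \<in> U" "Im w \<noteq> 0" "pt z = pt w" "k = n w" using iso by blast
    then have "pt z \<in> sphere_of w" using ptS by simp
    then show "k = n z" using sphere_of_mem_iff[OF ptS[OF ZnU[OF z]]] sym(2)[OF ZnU(1,2)[OF z]] w by auto
  qed
  have sset: "{S. S \<in> spherical_zeros U f \<and> (\<exists>z. S = sphere_of z \<and> z \<in> \<Omega> \<and> R z)} = sphere_of ` {z \<in> ZM. R z}" for R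
  proof (intro equalityI subsetI)
    fix S assume "S \<in> {S. S \<in> spherical_zeros U f \<and> (\<exists>z. S = sphere_of z \<and> z \<in> \<Omega> \<and> R z)}"
    then obtain z w where z: "S = sphere_of z" "z \<in> \<Omega>" "R z" and w: "w \<in> U" "Im w \<noteq> 0" "S = sphere_of w" "M w \<ge> 1"
      unfolding spherical_zeros_def sph by blast
    then have "z = w \<or> z = cnj w" using sphere_of_eq_iff by blast
    then have "Im z \<noteq> 0" "M z \<ge> 1" using w sym(1)[OF w(1,2)] by auto
    then have "z \<in> ZM" using z memZ by (simp add: ZM_def)
    with z show "S \<in> sphere_of ` {z \<in> ZM. R z}" by blast
  next
    fix S assume "S \<in> sphere_of ` {z \<in> ZM. R z}"
    then obtain z where z: "z \<in> ZM" "R z" "S = sphere_of z" by blast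
    then have "z \<in> \<Omega>" by (simp add: ZM_def Z_def)
    then show "S \<in> {S. S \<in> spherical_zeros U f \<and> (\<exists>z. S = sphere_of z \<and> z \<in> \<Omega> \<and> R z)}"
      unfolding spherical_zeros_def sph using z ZMU[OF z(1)] by blast
  qed
  have iset: "{q. q \<in> isolated_zeros U f \<and> (\<exists>z. q \<in> sphere_of z \<and> z \<in> \<Omega> \<and> R z)} = pt ` {z \<in> Zn. R z}" for R
  proof (intro equalityI subsetI)
    fix q assume "q \<in> {q. q \<in> isolated_zeros U f \<and> (\<exists>z. q \<in> sphere_of z \<and> z \<in> \<Omega> \<and> R z)}"
    then obtain z w where z: "q \<in> sphere_of z" "z \<in> \<Omega>" "R z" and w: "w \<in> U" "Im w \<noteq> 0" "q = pt w" "n w \<ge> 1"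
      unfolding isolated_zeros_def iso by blast
    then have zw: "z = w \<or> z = cnj w" using sphere_of_mem_iff[OF ptS[OF w(1,2,4)]] by simp
    then have "Im z \<noteq> 0" "n z \<ge> 1" "pt z = q" using w sym[OF w(1,2)] by auto
    then have "z \<in> Zn" using z memZ by (simp add: Zn_def)
    with z \<open>pt z = q\<close> show "q \<in> pt ` {z \<in> Zn. R z}" by blast
  next
    fix q assume "q \<in> pt ` {z \<in> Zn. R z}"
    then obtain z where z: "z \<in> Zn" "R z" "q = pt z" by blast
    then have "z \<in> \<Omega>" by (simp add: Zn_def Z_def)
    then show "q \<in> {q. q \<in> isolated_zeros U f \<and> (\<exists>z. q \<in> sphere_of z \<and> z \<in> \<Omega> \<and> R z)}"
      unfolding isolated_zeros_def iso using z ZnU[OF z(1)] ptS[OF ZnU[OF z(1)]] by blast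
  qed

  have sumM: "(\<Sum>z\<in>ZM. M z) =
      2 * (\<Sum>S\<in>sphere_of ` {z \<in> ZM. cnj z \<in> \<Omega>}. spherical_multiplicity U f S) +
      (\<Sum>S\<in>sphere_of ` {z \<in> ZM. cnj z \<notin> \<Omega>}. spherical_multiplicity U f S)"
  proof (rule sum_over_conjugate_pairs)
    show "finite ZM" using finZ by (simp add: ZM_def)
    show "ZM \<subseteq> \<Omega>" by (auto simp: ZM_def Z_def)
    show "cnj z \<in> ZM" if "z \<in> ZM" "cnj z \<in> \<Omega>" for z
      using that sym[OF ZMU(1,2)[OF that(1)]] ZMU[OF that(1)] memZ[of "cnj z"] by (simp add: ZM_def)
  qed (use ZMU sym(1) smult sphere_of_cnj sphere_of_eq_iff in auto)
  have sumn: "(\<Sum>z\<in>Zn. n z) =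
      2 * (\<Sum>q\<in>pt ` {z \<in> Zn. cnj z \<in> \<Omega>}. isolated_multiplicity U f q) +
      (\<Sum>q\<in>pt ` {z \<in> Zn. cnj z \<notin> \<Omega>}. isolated_multiplicity U f q)"
  proof (rule sum_over_conjugate_pairs)
    show "finite Zn" using finZ by (simp add: Zn_def)
    show "Zn \<subseteq> \<Omega>" by (auto simp: Zn_def Z_def)
    show "cnj z \<in> Zn" if "z \<in> Zn" "cnj z \<in> \<Omega>" for z
      using that sym[OF ZnU(1,2)[OF that(1)]] ZnU[OF that(1)] memZ[of "cnj z"] by (simp add: Zn_def)
    show "z' = z \<or> z' = cnj z" if "z \<in> Zn" "z' \<in> Zn" "pt z' = pt z" for z z'
      using sphere_of_mem_iff[OF ptS[OF ZnU[OF that(1)]]] ptS[OF ZnU[OF that(2)]] that(3) by simp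
  qed (use ZnU sym imult in auto)
  have sM: "(\<Sum>z\<in>Z. M z) = (\<Sum>z\<in>ZM. M z)" "(\<Sum>z\<in>Z. n z) = (\<Sum>z\<in>Zn. n z)"
    using finZ by (auto intro!: sum.mono_neutral_right simp: ZM_def Zn_def)
  define X where "X = {x. x \<in> real_zeros U f \<and> of_real x \<in> \<Omega>}"
  have Xset: "{z \<in> \<Omega>. h z = 0 \<and> Im z = 0} = of_real ` X"
  proof (intro equalityI subsetI)
    fix z assume z: "z \<in> {z \<in> \<Omega>. h z = 0 \<and> Im z = 0}"
    then have e: "z = of_real (Re z)" by (simp add: complex_eq_iff)
    then have "Re z \<in> X" using z \<Omega>(1) unfolding X_def real_zeros_iff[OF F(1)] h_def by auto
    with e show "z \<in> of_real ` X" by blast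
  qed (auto simp: X_def real_zeros_iff[OF F(1)] h_def)
  have sumX: "(\<Sum>z | z \<in> \<Omega> \<and> h z = 0 \<and> Im z = 0. zorder h z) = int (2 * (\<Sum>x\<in>X. real_multiplicity U f x))"
  proof -
    have "(\<Sum>z\<in>{z \<in> \<Omega>. h z = 0 \<and> Im z = 0}. zorder h z) = (\<Sum>x\<in>X. zorder h (of_real x))"
      unfolding Xset by (subst sum.reindex) (auto intro: inj_onI)
    also have "\<dots> = (\<Sum>x\<in>X. int (2 * real_multiplicity U f x))"
      using real_multiplicity_zorder[OF U _ F] \<Omega>(1) unfolding h_def X_def by (intro sum.cong) auto
    finally show ?thesis by (simp add: sum_distrib_left)
  qed
  have "(\<Sum>z | z \<in> \<Omega> \<and> h z = 0. zorder h z) =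
          (\<Sum>z | z \<in> \<Omega> \<and> h z = 0 \<and> Im z = 0. zorder h z) + (\<Sum>z\<in>Z. zorder h z)"
  proof -
    have "{z. z \<in> \<Omega> \<and> h z = 0} = {z. z \<in> \<Omega> \<and> h z = 0 \<and> Im z = 0} \<union> Z" by (auto simp: Z_def)
    moreover have "finite {z. z \<in> \<Omega> \<and> h z = 0 \<and> Im z = 0}"
      by (rule finite_subset[OF _ \<Omega>(2)]) (auto simp: h_def)
    ultimately show ?thesis using finZ by (simp add: sum.union_disjoint Z_def disjoint_iff)
  qed
  also have "(\<Sum>z\<in>Z. zorder h z) = int (2 * (\<Sum>z\<in>ZM. M z) + (\<Sum>z\<in>Zn. n z))"
  proof -
    have "(\<Sum>z\<in>Z. zorder h z) = (\<Sum>z\<in>Z. int (2 * M z + n z))" using zo ZU by (intro sum.cong) auto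
    also have "\<dots> = int (\<Sum>z\<in>Z. 2 * M z + n z)" by simp
    also have "(\<Sum>z\<in>Z. 2 * M z + n z) = 2 * (\<Sum>z\<in>ZM. M z) + (\<Sum>z\<in>Zn. n z)"
      unfolding sM[symmetric] by (simp add: sum.distrib sum_distrib_left)
    finally show ?thesis .
  qed
  finally have total: "(\<Sum>z | z \<in> \<Omega> \<and> h z = 0. zorder h z) =
    int (2 * (\<Sum>x\<in>X. real_multiplicity U f x)) + int (2 * (\<Sum>z\<in>ZM. M z) + (\<Sum>z\<in>Zn. n z))"
    unfolding sumX .
  have hz: "Phi (F z) = h z" for z by (simp add: h_def)
  show ?thesis
    unfolding sset iset X_def[symmetric] h_def[symmetric] unfolding hz total sumM sumn by simp
qed

theorem theorem4p4:
  fixes f :: "quat \<Rightarrow> quat"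
    and \<U> \<Omega> :: "complex set"
    and \<alpha> \<beta> :: "complex \<Rightarrow> quat"
    and F :: "complex \<Rightarrow> complex \<times> complex \<times> complex \<times> complex"
    and \<Gamma> :: "(real \<Rightarrow> complex) set"
    and k\<^sub>0 k\<^sub>1 m\<^sub>0 m\<^sub>1 r :: nat
  assumes "open \<U>" and "connected \<U>" and "cnj ` \<U> = \<U>"
    and "slice_regular_with \<U> f \<alpha> \<beta>"
    and "F = assoc_map \<alpha> \<beta>"
    and "open \<Omega>" and "bounded \<Omega>" and "closure \<Omega> \<subseteq> \<U>"
    and "oriented_C1_boundary \<Omega> \<Gamma>"
    and "\<forall>z\<in>frontier \<Omega>. (Phi \<circ> F) z \<noteq> 0"
    and "k\<^sub>0 = (\<Sum>q | q \<in> isolated_zeros \<U> f \<and> (\<exists>z. q \<in> sphere_of z \<and> z \<in> \<Omega> \<and> cnj z \<in> \<Omega>).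
                 isolated_multiplicity \<U> f q)"
    and "m\<^sub>0 = (\<Sum>S | S \<in> spherical_zeros \<U> f \<and> (\<exists>z. S = sphere_of z \<and> z \<in> \<Omega> \<and> cnj z \<in> \<Omega>).
                 spherical_multiplicity \<U> f S)"
    and "k\<^sub>1 = (\<Sum>q | q \<in> isolated_zeros \<U> f \<and> (\<exists>z. q \<in> sphere_of z \<and> z \<in> \<Omega> \<and> cnj z \<notin> \<Omega>).
                 isolated_multiplicity \<U> f q)"
    and "m\<^sub>1 = (\<Sum>S | S \<in> spherical_zeros \<U> f \<and> (\<exists>z. S = sphere_of z \<and> z \<in> \<Omega> \<and> cnj z \<notin> \<Omega>).
                 spherical_multiplicity \<U> f S)"
    and "r = (\<Sum>x | x \<in> real_zeros \<U> f \<and> of_real x \<in> \<Omega>. real_multiplicity \<U> f x)"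
  shows "1 / (2 * of_real pi * \<i>) *
           (\<Sum>\<gamma>\<in>\<Gamma>. contour_integral \<gamma> (\<lambda>z. deriv (Phi \<circ> F) z / (Phi \<circ> F) z)) =
         of_nat (2 * k\<^sub>0 + k\<^sub>1 + 2 * r + 4 * m\<^sub>0 + 2 * m\<^sub>1)"
proof (cases "\<Omega> = {}")
  case True
  \<comment> \<open>the only case in which \<open>Phi \<circ> F\<close> may vanish identically, since any other \<open>\<Omega>\<close> has boundary points\<close>
  have "\<Gamma> = {}"
    using assms(9) path_image_nonempty unfolding oriented_C1_boundary_def True by auto
  then show ?thesis using assms(11-15) True by simp
next
  case False
  have rep: "slice_rep \<U> f F" unfolding assms(5) by (rule slice_regular_with_imp_rep[OF assms(1,4)])
  have h: "Phi \<circ> F = (\<lambda>w. Phi (F w))" by (simp add: fun_eq_iff)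
  have hol: "(\<lambda>w. Phi (F w)) holomorphic_on \<U>"
    using rep by (intro holomorphic_Phi) (simp add: slice_rep_def)
  have "\<Omega> \<noteq> UNIV" using assms(7) not_bounded_UNIV by blast
  then have fr: "frontier \<Omega> \<noteq> {}" using frontier_not_empty False by blast
  have sub: "frontier \<Omega> \<subseteq> \<U>" "\<Omega> \<subseteq> \<U>"
    using assms(8) closure_subset[of \<Omega>] by (auto simp: frontier_def)
  have nzf: "\<forall>z\<in>frontier \<Omega>. Phi (F z) \<noteq> 0" using assms(10) by simp
  have nz: "\<exists>w\<in>\<U>. Phi (F w) \<noteq> 0" using nzf fr sub(1) by blast
  have \<Gamma>: "finite \<Gamma>" "\<forall>\<gamma>\<in>\<Gamma>. valid_path \<gamma> \<and> pathfinish \<gamma> = pathstart \<gamma> \<and> path_image \<gamma> \<subseteq> frontier \<Omega>"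
    using assms(9) oriented_C1_boundary_valid_path[OF assms(9)] unfolding oriented_C1_boundary_def by auto
  have cpt: "compact (closure \<Omega>)" using assms(7) by (simp add: compact_closure)
  have wn: "\<forall>z. z \<notin> frontier \<Omega> \<longrightarrow> (\<Sum>\<gamma>\<in>\<Gamma>. winding_number \<gamma> z) = of_bool (z \<in> \<Omega>)"
    using winding_number_oriented_C1_boundary[OF assms(9,6,7)] by blast
  note AP = argument_principle_cycle[OF assms(1,2) hol assms(6) False cpt assms(8) nzf fr \<Gamma> wn]
  have count: "(\<Sum>z | z \<in> \<Omega> \<and> Phi (F z) = 0. zorder (\<lambda>w. Phi (F w)) z) = int (2 * k\<^sub>0 + k\<^sub>1 + 2 * r + 4 * m\<^sub>0 + 2 * m\<^sub>1)"
    unfolding assms(11-15)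
    by (rule sum_zorder_eq_multiplicities[OF assms(1-3) rep nz sub(2) AP(1)])
  show ?thesis unfolding h AP(2) count by simp
qed


end
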